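(* Let $G$ be a finite group. Then $G \cong \mathrm{PSL}(2,13)$ or $G \cong \mathbb{Z}_{14}\times(\mathbb{Z}_{13}\rtimes\mathbb{Z}_3)$, where $\mathbb{Z}_{13}\rtimes\mathbb{Z}_3$ is the non-abelian group of order $39$, if and only if $\operatorname{Exp}_{\rho}(G) = \operatorname{Exp}_{\rho}(\mathrm{PSL}(2,13))$.
   Context: For a finite group $G$, $o(g)$ denotes the order of $g\in G$ and $\rho(G)=\prod_{g\in G} o(g)$ is the product of the element orders. If $n=p_1^{\alpha_1}\cdots p_k^{\alpha_k}$ with $p_1,\dots,p_k$ distinct primes and all $\alpha_i\ge 1$, then $\operatorname{Exp}(n)=\{\alpha_1,\dots,\alpha_k\}$, regarded as a set (repetitions are not recorded, nor is which exponent belongs to which prime). Set $\operatorname{Exp}_{\rho}(G)=\operatorname{Exp}(\rho(G))$. $\mathbb{Z}_n$ denotes the cyclic group of order $n$. *)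

theory Defs
  imports "HOL-Analysis.Determinants" "HOL-Library.Numeral_Type"
    "HOL-Algebra.Multiplicative_Group" "HOL-Algebra.Elementary_Groups"
    "HOL-Computational_Algebra.Primes"
begin

section \<open>Exponents in the product of the element orders\<close>

definition Exp :: "nat \<Rightarrow> nat set" where
  "Exp n = (\<lambda>p. multiplicity p n) ` prime_factors n"

definition rho :: "('a, 'b) monoid_scheme \<Rightarrow> nat" where
  "rho G = (\<Prod>g\<in>carrier G. group.ord G g)"

definition Exp_rho :: "('a, 'b) monoid_scheme \<Rightarrow> nat set" where
  "Exp_rho G = Exp (rho G)"

section \<open>Projective special linear groups\<close>

definition center :: "('a, 'b) monoid_scheme \<Rightarrow> 'a set" where
  "center G = {z \<in> carrier G. \<forall>g\<in>carrier G. z \<otimes>\<^bsub>G\<^esub> g = g \<otimes>\<^bsub>G\<^esub> z}"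

definition SL :: "('a::comm_ring_1^'n^'n) monoid" where
  "SL = \<lparr>carrier = {A. det A = 1}, monoid.mult = (**), one = mat 1\<rparr>"

definition PSL :: "('a::comm_ring_1^'n^'n) set monoid" where
  "PSL = SL Mod center SL"

lemma group_SL_2: "group (SL :: ('a::comm_ring_1^2^2) monoid)"
proof (rule groupI, goal_cases)
  case (5 A)
  define B :: "'a^2^2" where
    "B = (\<chi> i j. if i = j then (if i = 1 then A $ 2 $ 2 else A $ 1 $ 1) else - A $ i $ j)"
  have "A $ 1 $ 1 * A $ 2 $ 2 - A $ 1 $ 2 * A $ 2 $ 1 = 1"
    using 5 by (simp add: SL_def det_2)
  then have 1: "A $ 2 $ 2 * A $ 1 $ 1 - A $ 1 $ 2 * A $ 2 $ 1 = 1"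
    "A $ 1 $ 1 * A $ 2 $ 2 - A $ 2 $ 1 * A $ 1 $ 2 = 1"
    by (simp_all add: mult.commute)
  have "det B = 1"
    using 1 by (simp add: B_def det_2)
  moreover have "B ** A = mat 1"
    using 1 by (simp add: B_def vec_eq_iff matrix_matrix_mult_def sum_2 forall_2 mat_def mult.commute)
  ultimately show ?case by (auto simp: SL_def)
qed (simp_all add: SL_def det_mul matrix_mul_assoc)

lemma (in group) center_normal: "center G \<lhd> G"
proof -
  have "subgroup (center G) G"
  proof (rule subgroupI)
    fix a assume a: "a \<in> center G"
    have "inv a \<otimes> g = g \<otimes> inv a" if g: "g \<in> carrier G" for g
    proof -
      have ac: "a \<in> carrier G" and ag: "a \<otimes> g = g \<otimes> a"
        using a g by (auto simp: center_def)
      have "inv a \<otimes> g = inv a \<otimes> (g \<otimes> a) \<otimes> inv a"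
        using ac g by (simp add: m_assoc)
      also have "\<dots> = inv a \<otimes> (a \<otimes> g) \<otimes> inv a"
        by (simp only: ag)
      also have "\<dots> = g \<otimes> inv a"
        using ac g by (simp add: m_assoc[symmetric])
      finally show ?thesis .
    qed
    with a show "inv a \<in> center G" by (simp add: center_def)
  next
    fix a b assume "a \<in> center G" "b \<in> center G"
    then have ab: "a \<in> carrier G" "b \<in> carrier G"
      and comm: "\<And>g. g \<in> carrier G \<Longrightarrow> a \<otimes> g = g \<otimes> a" "\<And>g. g \<in> carrier G \<Longrightarrow> b \<otimes> g = g \<otimes> b"
      by (auto simp: center_def)
    have "a \<otimes> b \<otimes> g = g \<otimes> (a \<otimes> b)" if g: "g \<in> carrier G" for g
    proof -
      have "a \<otimes> b \<otimes> g = a \<otimes> (g \<otimes> b)"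
        using ab g by (simp only: m_assoc comm(2)[OF g])
      also have "\<dots> = (a \<otimes> g) \<otimes> b"
        using ab g by (simp only: m_assoc)
      also have "\<dots> = g \<otimes> (a \<otimes> b)"
        using ab g by (simp only: comm(1)[OF g] m_assoc)
      finally show ?thesis .
    qed
    with ab show "a \<otimes> b \<in> center G"
      by (simp add: center_def)
  next
    have "\<one> \<in> center G" by (simp add: center_def)
    then show "center G \<noteq> {}" by blast
  qed (auto simp: center_def)
  moreover have "x \<otimes> h \<otimes> inv x \<in> center G" if x: "x \<in> carrier G" and h: "h \<in> center G" for x h
  proof -
    have hc: "h \<in> carrier G" and "x \<otimes> h = h \<otimes> x"
      using x h by (auto simp: center_def)
    then have "x \<otimes> h \<otimes> inv x = h"
      using x by (simp add: m_assoc)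
    with h show ?thesis by simp
  qed
  ultimately show ?thesis
    by (simp add: normal_inv_iff)
qed

lemma group_PSL_2: "group (PSL :: ('a::comm_ring_1^2^2) set monoid)"
  unfolding PSL_def by (intro normal.factorgroup_is_group group.center_normal group_SL_2)

text \<open>The numeral type \<^typ>\<open>13\<close> carries arithmetic modulo 13. It is an instance of
  \<^class>\<open>comm_ring_1\<close> and, 13 being prime, is the field with 13 elements.\<close>

abbreviation PSL_2_13 :: "(13^2^2) set monoid" where
  "PSL_2_13 \<equiv> PSL"

section \<open>Semidirect products\<close>

text \<open>Here \<open>\<phi>\<close> is meant to be a homomorphism from \<open>H\<close> to the automorphism group of \<open>N\<close>.\<close>

definition semidirect_product ::
  "('a, 'c) monoid_scheme \<Rightarrow> ('b, 'd) monoid_scheme \<Rightarrow> ('b \<Rightarrow> 'a \<Rightarrow> 'a) \<Rightarrow> ('a \<times> 'b) monoid" where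
  "semidirect_product N H \<phi> =
     \<lparr>carrier = carrier N \<times> carrier H,
      monoid.mult = (\<lambda>(x, h) (y, k). (x \<otimes>\<^bsub>N\<^esub> \<phi> h y, h \<otimes>\<^bsub>H\<^esub> k)),
      one = (\<one>\<^bsub>N\<^esub>, \<one>\<^bsub>H\<^esub>)\<rparr>"

text \<open>Since 3 has multiplicative order 3 modulo 13, the generator of the cyclic group of order 3
  can act on the cyclic group of order 13 as multiplication by 3. The lemmas below confirm that
  the result is a non-abelian group of order 39.\<close>

definition Z13_Z3 :: "(int \<times> int) monoid" where
  "Z13_Z3 = semidirect_product (integer_mod_group 13) (integer_mod_group 3)
     (\<lambda>h x. (3 ^ nat h * x) mod 13)"

lemma carrier_Z13_Z3: "carrier Z13_Z3 = {0..<13} \<times> {0..<3}"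
  by (simp add: Z13_Z3_def semidirect_product_def carrier_integer_mod_group)

lemma one_Z13_Z3: "\<one>\<^bsub>Z13_Z3\<^esub> = (0, 0)"
  by (simp add: Z13_Z3_def semidirect_product_def)

lemma mult_Z13_Z3:
  "(x, h) \<otimes>\<^bsub>Z13_Z3\<^esub> (y, k) = ((x + 3 ^ nat h * y) mod 13, (h + k) mod 3)"
  by (simp add: Z13_Z3_def semidirect_product_def mod_simps)

lemma order_Z13_Z3: "order Z13_Z3 = 39"
  by (simp add: order_def carrier_Z13_Z3 card_cartesian_product)

lemma power_3_mod_13:
  assumes "h \<in> {0..<3::int}" "k \<in> {0..<3}"
  shows "(3 ^ nat ((h + k) mod 3) * y) mod 13 = (3 ^ nat h * (3 ^ nat k * y)) mod (13::int)"
proof -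
  have "h = 0 \<or> h = 1 \<or> h = 2" "k = 0 \<or> k = 1 \<or> k = 2"
    using assms by auto
  then have "(3 ^ nat ((h + k) mod 3)) mod 13 = (3 ^ nat h * 3 ^ nat k) mod (13::int)"
    by (elim disjE) simp_all
  then have "(3 ^ nat ((h + k) mod 3) * y) mod 13 = (3 ^ nat h * 3 ^ nat k * y) mod 13"
    by (rule mod_mult_cong) simp
  then show ?thesis
    by (simp only: mult.assoc)
qed

lemma group_Z13_Z3: "group Z13_Z3"
proof (rule groupI, goal_cases)
  case (1 a b)
  then show ?case
    by (cases a; cases b) (auto simp: carrier_Z13_Z3 mult_Z13_Z3)
next
  case 2
  then show ?case by (simp add: carrier_Z13_Z3 one_Z13_Z3)
next
  case (3 a b c)
  obtain x h y k z l where abc: "a = (x, h)" "b = (y, k)" "c = (z, l)"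
    by (cases a; cases b; cases c)
  have hk: "h \<in> {0..<3}" "k \<in> {0..<3}"
    using 3 by (auto simp: abc carrier_Z13_Z3)
  have "((x + 3 ^ nat h * y) mod 13 + 3 ^ nat ((h + k) mod 3) * z) mod 13
      = (x + 3 ^ nat h * y + (3 ^ nat ((h + k) mod 3) * z) mod 13) mod 13"
    by (simp add: mod_simps)
  also have "\<dots> = (x + (3 ^ nat h * (y + 3 ^ nat k * z)) mod 13) mod 13"
    unfolding power_3_mod_13[OF hk] mod_add_right_eq by (simp only: distrib_left add.assoc)
  also have "\<dots> = (x + 3 ^ nat h * ((y + 3 ^ nat k * z) mod 13)) mod 13"
    by (metis mod_add_right_eq mod_mult_right_eq)
  finally show ?case
    by (simp add: abc mult_Z13_Z3 mod_simps add.assoc)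
next
  case (4 a)
  then show ?case
    by (cases a) (auto simp: carrier_Z13_Z3 mult_Z13_Z3 one_Z13_Z3)
next
  case (5 a)
  obtain x h where a: "a = (x, h)" by (cases a)
  define k where "k = (- h) mod 3"
  have "((- (3 ^ nat k * x)) mod 13, k) \<in> carrier Z13_Z3"
    by (simp add: carrier_Z13_Z3 k_def)
  moreover have "((- (3 ^ nat k * x)) mod 13, k) \<otimes>\<^bsub>Z13_Z3\<^esub> a = \<one>\<^bsub>Z13_Z3\<^esub>"
    by (simp add: a mult_Z13_Z3 one_Z13_Z3 k_def mod_simps)
  ultimately show ?case by blast
qed

lemma not_comm_group_Z13_Z3: "\<not> comm_group Z13_Z3"
proof
  assume "comm_group Z13_Z3"
  then interpret comm_group Z13_Z3 .
  have "(1, 0) \<otimes>\<^bsub>Z13_Z3\<^esub> (0, 1) = (0, 1) \<otimes>\<^bsub>Z13_Z3\<^esub> (1, 0)"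
    by (rule m_comm) (simp_all add: carrier_Z13_Z3)
  then show False by (simp add: mult_Z13_Z3)
qed

end

(* Idea: for a prime q and a class function F on G that depends only on the q-regular part of its
   argument, Frobenius' theorem (applied to centralizers) shows that the q-part of the group order
   divides the sum of F. Applied to the exponent of p in the element orders, this turns the set
   {168, 273, 364, 468} into the number of elements of order divisible by each of 2, 3, 7, 13 and
   leaves only the orders 546 and 1092 for G. A count of the elements of order 13 then gives
   either a unique Sylow 13-subgroup and order 546, where the elements of order 2 and 7 turn out
   to be central, or fourteen self-centralizing ones and order 1092. In the second case G
   acts faithfully on the fourteen subgroups as on a projective line, and one relation between an
   element swapping two points and a generator of a Sylow subgroup determines all permutations.
   PSL(2,13) itself is such a group, so G is isomorphic to it. *)
theory Submission
  imports Defs "HOL-Number_Theory.Cong" "HOL-Algebra.Sylow"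
begin

text \<open>The set forgets which exponent belongs to which prime. Let A(p) be the exponent of p;
  for every prime q other than p the full q-part of the group order divides A(p). So the prime with
  one of the exponents 273, 364, 468, 168 divides the other three, whose greatest common divisors
  are 4, 3, 7 and 13: this assigns 2, 3, 7, 13. The same divisibility bounds the order, since its
  odd part divides 273 and its 2-part divides 364. The recurring argument afterwards concerns
  multipliers. An element g normalizing a subgroup of order 13 raises its elements to a power k, and
  k^12 = 1 modulo 13. If g^n = 1 then also k^n = 1, so k^d = 1 with d = gcd(n, 12). Elements of
  order 7 and 13 thus have k = 1, elements of odd order have k in {1, 3, 9}, and elements fixing a
  second such subgroup have a square as multiplier, because only six elements fix both. PSL(2,13)
  passes through the same classification, so all that is computed with its matrices is their order
  modulo the centre, read off from the trace.\<close>

text \<open>Only the \<open>q\<close>-part of \<open>s\<close> contributes to the divisibility, the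
  rest being coprime to \<open>q\<close>. In the application \<open>c\<close> is the size of a
  conjugacy class, \<open>s\<close> the order of a centralizer and \<open>r\<close> the number of
  its \<open>q\<close>-elements.\<close>

lemma dvd_mult_of_prime_powers:
  fixes q c s r :: nat
  assumes "prime q" "s > 0" "q ^ k dvd c * s" "\<And>j. q ^ j dvd s \<Longrightarrow> q ^ j dvd r"
  shows "q ^ k dvd c * r"
proof -
  obtain t where t: "s = q ^ multiplicity q s * t" "\<not> q dvd t"
    using assms(1,2) by (metis multiplicity_decompose' not_prime_unit gr_implies_not0)
  define j where "j = multiplicity q s"
  have st: "s = q ^ j * t" using t by (simp add: j_def)
  have "coprime (q ^ k) t"
    using assms(1) t(2) by (simp add: prime_imp_coprime)
  moreover have "q ^ k dvd c * q ^ j * t" using assms(3) by (simp add: st mult.assoc)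
  ultimately have "q ^ k dvd c * q ^ j" by (simp add: coprime_dvd_mult_left_iff)
  moreover have "q ^ j dvd r" using assms(4) st by simp
  ultimately show ?thesis by (meson dvd_refl dvd_trans mult_dvd_mono)
qed

lemma card_eq_card_image_mult:
  assumes "finite A" "\<And>y. y \<in> f ` A \<Longrightarrow> card {x \<in> A. f x = y} = c"
  shows "card A = card (f ` A) * c"
proof -
  have "card A = (\<Sum>y\<in>f ` A. card {x \<in> A. f x = y})"
    using sum.image_gen[OF assms(1), of "\<lambda>_. 1::nat" f] by simp
  also have "\<dots> = card (f ` A) * c" using assms(2) by simp
  finally show ?thesis .
qed

section \<open>Conjugation, centralizers and Cauchy's theorem\<close>

context group
begin

text \<open>Taken relative to a subgroup \<open>H\<close> of one ambient group, because Frobenius'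
  theorem is proved by induction over subgroups.\<close>

definition Cen :: "'a set \<Rightarrow> 'a \<Rightarrow> 'a set" where
  "Cen H u = {h \<in> H. h \<otimes> u = u \<otimes> h}"

definition conjug :: "'a \<Rightarrow> 'a \<Rightarrow> 'a" where
  "conjug g u = g \<otimes> u \<otimes> inv g"

lemma conj_closed [simp]: "g \<in> carrier G \<Longrightarrow> u \<in> carrier G \<Longrightarrow> conjug g u \<in> carrier G"
  by (simp add: conjug_def)

lemma conj_mult:
  "g \<in> carrier G \<Longrightarrow> h \<in> carrier G \<Longrightarrow> u \<in> carrier G \<Longrightarrow> conjug (g \<otimes> h) u = conjug g (conjug h u)"
  by (simp add: conjug_def m_assoc inv_mult_group)

lemma conj_one [simp]: "u \<in> carrier G \<Longrightarrow> conjug \<one> u = u"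
  by (simp add: conjug_def)

lemma conj_id [simp]: "g \<in> carrier G \<Longrightarrow> conjug g \<one> = \<one>"
  by (simp add: conjug_def)

lemma conj_inv_cancel [simp]:
  "g \<in> carrier G \<Longrightarrow> u \<in> carrier G \<Longrightarrow> conjug (inv g) (conjug g u) = u"
  "g \<in> carrier G \<Longrightarrow> u \<in> carrier G \<Longrightarrow> conjug g (conjug (inv g) u) = u"
  by (simp_all flip: conj_mult)

lemma conj_hom:
  "g \<in> carrier G \<Longrightarrow> u \<in> carrier G \<Longrightarrow> v \<in> carrier G \<Longrightarrow> conjug g (u \<otimes> v) = conjug g u \<otimes> conjug g v"
  by (simp add: conjug_def m_assoc inv_solve_left' flip: m_assoc)
    (simp add: m_assoc)

lemma conj_pow:
  "g \<in> carrier G \<Longrightarrow> u \<in> carrier G \<Longrightarrow> conjug g (u [^] (k::nat)) = conjug g u [^] k"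
  by (induction k) (simp_all add: conj_hom)

lemma conj_eq_iff:
  "g \<in> carrier G \<Longrightarrow> u \<in> carrier G \<Longrightarrow> v \<in> carrier G \<Longrightarrow> conjug g u = conjug g v \<longleftrightarrow> u = v"
  by (metis conj_inv_cancel(1))

lemma conj_eq_self_iff:
  "g \<in> carrier G \<Longrightarrow> u \<in> carrier G \<Longrightarrow> conjug g u = u \<longleftrightarrow> g \<otimes> u = u \<otimes> g"
  by (metis conjug_def inv_solve_right m_closed)

lemma ord_conj [simp]:
  assumes "g \<in> carrier G" "u \<in> carrier G" shows "ord (conjug g u) = ord u"
proof -
  have "conjug g u [^] k = \<one> \<longleftrightarrow> u [^] k = \<one>" for k :: nat
    using assms by (metis conj_eq_iff conj_id conj_pow nat_pow_closed one_closed)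
  then have "ord (conjug g u) dvd k \<longleftrightarrow> ord u dvd k" for k
    using assms by (simp flip: pow_eq_id)
  then show ?thesis by (meson dvd_antisym dvd_refl)
qed

lemma Cen_subgroup:
  assumes "subgroup H G" "u \<in> carrier G" shows "subgroup (Cen H u) G"
proof -
  interpret H: subgroup H G by fact
  show ?thesis
  proof (rule subgroupI)
    fix a assume "a \<in> Cen H u"
    then have *: "a \<in> H" "conjug a u = u"
      using assms(2) H.mem_carrier by (auto simp: Cen_def conj_eq_self_iff)
    have "conjug (inv a) u = u"
      using conj_inv_cancel(1)[of a u] * assms(2) by simp
    then show "inv a \<in> Cen H u"
      using * assms(2) by (simp add: Cen_def conj_eq_self_iff)
  next
    fix a b assume "a \<in> Cen H u" "b \<in> Cen H u"
    then have *: "a \<in> H" "b \<in> H" "conjug a u = u" "conjug b u = u"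
      using assms(2) H.mem_carrier by (auto simp: Cen_def conj_eq_self_iff)
    then have "conjug (a \<otimes> b) u = u" using assms(2) H.mem_carrier by (simp add: conj_mult)
    then show "a \<otimes> b \<in> Cen H u"
      using * assms(2) H.mem_carrier by (simp add: Cen_def conj_eq_self_iff)
  next
    have "\<one> \<in> Cen H u" using assms(2) by (simp add: Cen_def)
    then show "Cen H u \<noteq> {}" by blast
  qed (use H.mem_carrier in \<open>auto simp: Cen_def\<close>)
qed

lemma card_subgroup_dvd:
  assumes "finite (carrier G)" "subgroup K G" "subgroup H G" "K \<subseteq> H" shows "card K dvd card H"
proof -
  interpret H: subgroup H G by fact
  interpret GH: group "G\<lparr>carrier := H\<rparr>" by (rule H.subgroup_is_group) (rule is_group)
  have "subgroup K (G\<lparr>carrier := H\<rparr>)" using assms by (simp add: subgroup_incl)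
  from GH.lagrange[OF this] have "card (rcosets\<^bsub>G\<lparr>carrier := H\<rparr>\<^esub> K) * card K = card H"
    by (simp add: order_def)
  then show ?thesis by (metis dvd_triv_right)
qed

lemma ord_dvd_card_subgroup:
  assumes "subgroup H G" "h \<in> H" shows "ord h dvd card H"
proof -
  interpret H: subgroup H G by fact
  have "group (G\<lparr>carrier := H\<rparr>)" by (rule H.subgroup_is_group) (rule is_group)
  then have "h [^] card H = \<one>"
    using group.pow_order_eq_1[of "G\<lparr>carrier := H\<rparr>" h] assms(2)
    by (simp add: order_def flip: nat_pow_consistent)
  then show ?thesis using H.mem_carrier[OF assms(2)] by (simp add: pow_eq_id)
qed

text \<open>Sylow's theorem with exponent 1 gives a subgroup of order \<open>q\<close>, in which
  every element except the identity has order \<open>q\<close>.\<close>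

lemma cauchy:
  assumes "finite (carrier G)" "subgroup H G" "prime q" "q dvd card H"
  obtains w where "w \<in> H" "ord w = q"
proof -
  obtain r where r: "card H = q ^ 1 * r" using assms(4) by auto
  interpret H: subgroup H G by fact
  have "group (G\<lparr>carrier := H\<rparr>)" by (rule H.subgroup_is_group) (rule is_group)
  moreover have "finite H" using assms(1) H.subset finite_subset by blast
  ultimately obtain K where K: "subgroup K (G\<lparr>carrier := H\<rparr>)" "card K = q ^ 1"
    using sylow_thm[OF assms(3), of "G\<lparr>carrier := H\<rparr>" 1 r] r by (auto simp: order_def)
  then have KG: "subgroup K G" using incl_subgroup assms(2) by blast
  have KH: "K \<subseteq> H" using K subgroup.subset by fastforce
  have "\<not> K \<subseteq> {\<one>}"
  proof
    assume "K \<subseteq> {\<one>}"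
    then have "card K \<le> 1" using card_mono[of "{\<one>}" K] by simp
    then show False using K(2) prime_ge_2_nat[OF assms(3)] by simp
  qed
  then obtain h where h: "h \<in> K" "h \<noteq> \<one>" by blast
  then have hc: "h \<in> carrier G" using KG subgroup.mem_carrier by fast
  have "ord h dvd q" using ord_dvd_card_subgroup[OF KG h(1)] K(2) by simp
  moreover have "ord h \<noteq> 1" using h hc ord_eq_1 by blast
  ultimately have "ord h = q" using assms(3) by (metis prime_nat_iff)
  then show ?thesis using that h KH by blast
qed

text \<open>The elements of \<open>H\<close> that conjugate \<open>u\<close> as \<open>k\<close>
  does form the coset of \<open>Cen H u\<close> containing \<open>k\<close>.\<close>

lemma card_conj_fiber:
  assumes "subgroup H G" "u \<in> carrier G" "k \<in> H"
  shows "card {h \<in> H. conjug h u = conjug k u} = card (Cen H u)"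
proof -
  interpret H: subgroup H G by fact
  have "bij_betw (\<lambda>c. k \<otimes> c) (Cen H u) {h \<in> H. conjug h u = conjug k u}"
  proof (rule bij_betw_byWitness[where f' = "\<lambda>h. inv k \<otimes> h"])
    show "\<forall>a\<in>Cen H u. inv k \<otimes> (k \<otimes> a) = a"
      "\<forall>a\<in>{h \<in> H. conjug h u = conjug k u}. k \<otimes> (inv k \<otimes> a) = a"
      using assms(3) H.mem_carrier by (auto simp: Cen_def simp flip: m_assoc)
    show "(\<otimes>) k ` Cen H u \<subseteq> {h \<in> H. conjug h u = conjug k u}"
      using assms(2,3) H.mem_carrier by (auto simp: Cen_def conj_mult conj_eq_self_iff[THEN iffD2])
    show "(\<otimes>) (inv k) ` {h \<in> H. conjug h u = conjug k u} \<subseteq> Cen H u"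
      using assms(2,3) H.mem_carrier
      by (auto simp: Cen_def conj_mult simp flip: conj_eq_self_iff)
  qed
  then show ?thesis by (simp add: bij_betw_same_card)
qed

lemma card_conj_class:
  assumes "finite (carrier G)" "subgroup H G" "u \<in> carrier G"
  shows "card ((\<lambda>h. conjug h u) ` H) * card (Cen H u) = card H"
proof -
  have "finite H" using assms subgroup.subset finite_subset by blast
  then have "card H = card ((\<lambda>h. conjug h u) ` H) * card (Cen H u)"
    by (rule card_eq_card_image_mult) (use card_conj_fiber[OF assms(2,3)] in auto)
  then show ?thesis by simp
qed

text \<open>\<open>S\<close> is a union of classes under \<open>H\<close> on each of which
  \<open>\<phi>\<close> is constant, so the classes can be split off one by one; the last premise is
  the claim for a single class.\<close>

lemma dvd_sum_class_function:
  fixes \<phi> :: "'a \<Rightarrow> nat"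
  assumes "finite (carrier G)" "subgroup H G" "S \<subseteq> carrier G"
    and "\<And>h u. h \<in> H \<Longrightarrow> u \<in> S \<Longrightarrow> conjug h u \<in> S"
    and "\<And>h u. h \<in> H \<Longrightarrow> u \<in> S \<Longrightarrow> \<phi> (conjug h u) = \<phi> u"
    and "\<And>u. u \<in> S \<Longrightarrow> d dvd card ((\<lambda>h. conjug h u) ` H) * \<phi> u"
  shows "d dvd sum \<phi> S"
proof -
  interpret H: subgroup H G by fact
  have "finite S" using assms by (meson finite_subset)
  then show ?thesis using assms(3-)
  proof (induction "card S" arbitrary: S rule: less_induct)
    case less
    show ?case
    proof (cases "S = {}")
      case False
      then obtain u where u: "u \<in> S" by blast
      define K where "K = (\<lambda>h. conjug h u) ` H"
      have KS: "K \<subseteq> S" using u less.prems by (auto simp: K_def)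
      have uc: "u \<in> carrier G" using u less.prems by auto
      have uK: "u \<in> K" unfolding K_def using H.one_closed uc by (metis conj_one image_eqI)
      have closed: "conjug h v \<in> S - K" if "h \<in> H" "v \<in> S - K" for h v
      proof -
        have "v \<in> K" if hv: "conjug h v \<in> K"
        proof -
          obtain k where k: "k \<in> H" "conjug h v = conjug k u" using hv by (auto simp: K_def)
          have "v = conjug (inv h \<otimes> k) u"
            using k \<open>h \<in> H\<close> \<open>v \<in> S - K\<close> uc less.prems(2)
            by (metis DiffD1 H.mem_carrier conj_inv_cancel(1) conj_mult inv_closed subsetD)
          then show ?thesis using k \<open>h \<in> H\<close> by (auto simp: K_def)
        qed
        then show ?thesis using that less.prems by blast
      qed
      have "d dvd sum \<phi> (S - K)"
      proof (rule less.hyps)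
        show "card (S - K) < card S"
          by (metis Diff_iff Diff_subset less.prems(1) psubsetI psubset_card_mono u uK)
      qed (use less.prems closed in auto)
      moreover have "\<phi> v = \<phi> u" if "v \<in> K" for v
        using less.prems(4) u that by (auto simp: K_def)
      then have "sum \<phi> K = card K * \<phi> u" by simp
      then have "d dvd sum \<phi> K" using less.prems(5)[OF u] by (simp add: K_def)
      ultimately show ?thesis
        using sum.subset_diff[OF KS less.prems(1), of \<phi>] by (simp add: dvd_add)
    qed simp
  qed
qed

end

text \<open>An element of a group of order \<open>q^b * m\<close> is the product of its \<open>q\<close>-regular part \<open>g [^] e\<close>
  and its \<open>q\<close>-part \<open>g [^] f\<close>.\<close>

locale prime_part_group = group G for G (structure) +
  fixes q b m e f :: nat
  assumes fin: "finite (carrier G)" and prime: "prime q"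
    and order: "order G = q ^ b * m" and ndvd: "\<not> q dvd m"
    and e: "[e = 1] (mod m)" "[e = 0] (mod q ^ b)"
    and f: "[f = 0] (mod m)" "[f = 1] (mod q ^ b)"
begin

section \<open>Regular parts and Frobenius' theorem\<close>

definition Qel :: "'a set" where "Qel = {w \<in> carrier G. w [^] (q ^ b) = \<one>}"
definition Reg :: "'a set" where "Reg = {u \<in> carrier G. u [^] m = \<one>}"

lemma pow_cong:
  assumes "g \<in> carrier G" "g [^] k = \<one>" "[i = j] (mod k)"
  shows "g [^] (i::nat) = g [^] j"
proof -
  have "[i = j] (mod ord g)"
    using assms by (metis cong_dvd_modulus_nat pow_eq_id)
  then have "int (ord g) dvd int j - int i"
    by (metis cong_iff_dvd_diff cong_int_iff cong_sym)
  then show ?thesis using assms(1) by (metis int_pow_eq int_pow_int)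
qed


lemma decompose: "g \<in> carrier G \<Longrightarrow> g [^] e \<otimes> g [^] f = g"
proof -
  assume g: "g \<in> carrier G"
  have "[e + f = 1] (mod m)" "[e + f = 1] (mod q ^ b)"
    using cong_add[OF e(1) f(1)] cong_add[OF e(2) f(2)] by simp_all
  moreover have "coprime (q ^ b) m" using prime ndvd by (simp add: prime_imp_coprime)
  ultimately have "[e + f = 1] (mod (q ^ b * m))" by (simp add: coprime_cong_mult_nat)
  then have "g [^] (e + f) = g [^] (1::nat)"
    using g order pow_order_eq_1 pow_cong by (metis)
  then show ?thesis using g by (simp add: nat_pow_mult)
qed

lemma Reg_pow: "u \<in> Reg \<Longrightarrow> u [^] e = u" "u \<in> Reg \<Longrightarrow> u [^] f = \<one>"
  using pow_cong[of u m e 1] pow_cong[of u m f 0] e f by (auto simp: Reg_def)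

lemma Qel_pow: "w \<in> Qel \<Longrightarrow> w [^] f = w" "w \<in> Qel \<Longrightarrow> w [^] e = \<one>"
  using pow_cong[of w "q ^ b" f 1] pow_cong[of w "q ^ b" e 0] e f by (auto simp: Qel_def)

lemma pow_e_Reg: "g \<in> carrier G \<Longrightarrow> g [^] e \<in> Reg"
  using e(2) order pow_order_eq_1
  by (auto simp: Reg_def nat_pow_pow cong_0_iff)
    (metis (no_types, lifting) dvd_refl mult_dvd_mono ord_dvd_group_order dvd_trans pow_eq_id)

lemma pow_f_Qel: "g \<in> carrier G \<Longrightarrow> g [^] f \<in> Qel"
  using f(1) order pow_order_eq_1
  by (auto simp: Qel_def nat_pow_pow cong_0_iff)
    (metis (no_types, lifting) dvd_refl mult_dvd_mono ord_dvd_group_order dvd_trans pow_eq_id mult.commute)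

lemma mult_pow_Reg_Qel:
  assumes "u \<in> Reg" "w \<in> Qel" "u \<otimes> w = w \<otimes> u"
  shows "(u \<otimes> w) [^] e = u" "(u \<otimes> w) [^] f = w"
proof -
  have c: "u \<in> carrier G" "w \<in> carrier G" using assms by (auto simp: Reg_def Qel_def)
  show "(u \<otimes> w) [^] e = u" "(u \<otimes> w) [^] f = w"
    using c assms Reg_pow Qel_pow by (simp_all add: pow_mult_distrib)
qed

lemma subgroup_pow: "subgroup H G \<Longrightarrow> h \<in> H \<Longrightarrow> h [^] (k::nat) \<in> H"
  by (induction k) (auto simp: subgroup.one_closed subgroup.m_closed)

text \<open>The elements of \<open>H\<close> with \<open>q\<close>-regular part \<open>u\<close> are
  the products of \<open>u\<close> with the \<open>q\<close>-elements of \<open>H\<close> commuting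
  with it, and \<open>g [^] f\<close> recovers the second factor. So the fibre of
  \<open>g [^] e\<close> over \<open>u\<close> has \<open>card (Cen H u \<inter> Qel)\<close>
  elements.\<close>

lemma sum_by_regular_part:
  fixes F :: "'a \<Rightarrow> nat"
  assumes H: "subgroup H G" and F: "\<And>g. g \<in> H \<Longrightarrow> F (g [^] e) = F g"
  shows "sum F H = (\<Sum>u\<in>H \<inter> Reg. F u * card (Cen H u \<inter> Qel))"
proof -
  interpret H: subgroup H G by fact
  have finH: "finite H" using fin H.subset finite_subset by blast
  have img: "(\<lambda>g. g [^] e) ` H = H \<inter> Reg"
  proof
    show "(\<lambda>g. g [^] e) ` H \<subseteq> H \<inter> Reg"
      using subgroup_pow[OF H] pow_e_Reg H.mem_carrier by auto
    show "H \<inter> Reg \<subseteq> (\<lambda>g. g [^] e) ` H"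
      using Reg_pow(1) by (metis IntE imageI subsetI)
  qed
  have "sum F H = (\<Sum>u\<in>H \<inter> Reg. sum F {g \<in> H. g [^] e = u})"
    using sum.image_gen[OF finH, of F "\<lambda>g. g [^] e"] by (simp add: img)
  also have "\<dots> = (\<Sum>u\<in>H \<inter> Reg. F u * card (Cen H u \<inter> Qel))"
  proof (rule sum.cong)
    fix u assume u: "u \<in> H \<inter> Reg"
    have "sum F {g \<in> H. g [^] e = u} = (\<Sum>g\<in>{g \<in> H. g [^] e = u}. F u)"
      using F by (intro sum.cong) auto
    also have "\<dots> = F u * card {g \<in> H. g [^] e = u}" by simp
    also have "card {g \<in> H. g [^] e = u} = card (Cen H u \<inter> Qel)"
    proof (rule bij_betw_same_card, rule bij_betw_byWitness[where f' = "\<lambda>w. u \<otimes> w"])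
      show "\<forall>g\<in>{g \<in> H. g [^] e = u}. u \<otimes> g [^] f = g"
        using decompose H.mem_carrier by blast
      show "\<forall>w\<in>Cen H u \<inter> Qel. (u \<otimes> w) [^] f = w"
        using u mult_pow_Reg_Qel(2) by (metis (mono_tags, lifting) Cen_def Int_iff mem_Collect_eq)
      show "(\<lambda>g. g [^] f) ` {g \<in> H. g [^] e = u} \<subseteq> Cen H u \<inter> Qel"
        using subgroup_pow[OF H] pow_f_Qel H.mem_carrier
        by (auto simp: Cen_def nat_pow_mult add.commute)
      show "(\<otimes>) u ` (Cen H u \<inter> Qel) \<subseteq> {g \<in> H. g [^] e = u}"
        using u mult_pow_Reg_Qel(1) H.m_closed
        by (smt (verit) Cen_def Int_iff image_subset_iff mem_Collect_eq)
    qed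
    finally show "sum F {g \<in> H. g [^] e = u} = F u * card (Cen H u \<inter> Qel)" .
  qed simp
  finally show ?thesis .
qed

lemma Reg_conjug: "g \<in> carrier G \<Longrightarrow> u \<in> Reg \<Longrightarrow> conjug g u \<in> Reg"
  by (auto simp: Reg_def simp flip: conj_pow)

lemma Qel_conjug: "g \<in> carrier G \<Longrightarrow> u \<in> Qel \<Longrightarrow> conjug g u \<in> Qel"
  by (auto simp: Qel_def simp flip: conj_pow)

lemma card_Cen_conjug:
  assumes H: "subgroup H G" and h: "h \<in> H" and u: "u \<in> carrier G"
  shows "card (Cen H (conjug h u) \<inter> Qel) = card (Cen H u \<inter> Qel)"
proof -
  interpret H: subgroup H G by fact
  have *: "conjug k ` (Cen H v \<inter> Qel) \<subseteq> Cen H (conjug k v) \<inter> Qel"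
    if "k \<in> H" "v \<in> carrier G" for k v
  proof -
    have "conjug k c \<in> H" if "c \<in> H" for c
      using that \<open>k \<in> H\<close> by (simp add: conjug_def)
    then show ?thesis
      using that H.mem_carrier Qel_conjug by (auto simp: Cen_def simp flip: conj_hom)
  qed
  have "bij_betw (conjug h) (Cen H u \<inter> Qel) (Cen H (conjug h u) \<inter> Qel)"
  proof (rule bij_betw_byWitness[where f' = "conjug (inv h)"])
    show "conjug (inv h) ` (Cen H (conjug h u) \<inter> Qel) \<subseteq> Cen H u \<inter> Qel"
      using *[of "inv h" "conjug h u"] h u by simp
    show "\<forall>a\<in>Cen H u \<inter> Qel. conjug (inv h) (conjug h a) = a"
      "\<forall>a\<in>Cen H (conjug h u) \<inter> Qel. conjug h (conjug (inv h) a) = a"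
      using h H.mem_carrier by (auto simp: Cen_def)
  qed (rule *[OF h u])
  then show ?thesis by (simp add: bij_betw_same_card)
qed

text \<open>The size of the class of \<open>u\<close> times the order of its centralizer is
  \<open>card H\<close>. By \<open>frob\<close>, replacing the centralizer by its set of
  \<open>q\<close>-elements keeps the divisor \<open>q ^ k\<close>. Frobenius' theorem is a
  hypothesis here so that its own induction can use the lemma for proper centralizers.\<close>

lemma dvd_sum_Reg:
  fixes F :: "'a \<Rightarrow> nat"
  assumes H: "subgroup H G" and S: "S \<subseteq> Reg"
    "\<And>h u. h \<in> H \<Longrightarrow> u \<in> S \<Longrightarrow> conjug h u \<in> S"
    and F: "\<And>h u. h \<in> H \<Longrightarrow> u \<in> S \<Longrightarrow> F (conjug h u) = F u"
    and frob: "\<And>u j. u \<in> S \<Longrightarrow> q ^ j dvd card (Cen H u) \<Longrightarrow> q ^ j dvd card (Cen H u \<inter> Qel)"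
    and k: "q ^ k dvd card H"
  shows "q ^ k dvd (\<Sum>u\<in>S. F u * card (Cen H u \<inter> Qel))"
proof (rule dvd_sum_class_function[OF fin H])
  show SC: "S \<subseteq> carrier G" using S(1) by (auto simp: Reg_def)
  fix u assume u: "u \<in> S"
  then have uc: "u \<in> carrier G" using SC by auto
  have "q ^ k dvd card ((\<lambda>h. conjug h u) ` H) * card (Cen H u \<inter> Qel)"
  proof (rule dvd_mult_of_prime_powers[OF prime _ _ frob[OF u]])
    show "0 < card (Cen H u)"
      using Cen_subgroup[OF H uc] fin subgroup.finite_imp_card_positive by blast
    show "q ^ k dvd card ((\<lambda>h. conjug h u) ` H) * card (Cen H u)"
      using k card_conj_class[OF fin H uc] by simp
  qed
  then show "q ^ k dvd card ((\<lambda>h. conjug h u) ` H) * (F u * card (Cen H u \<inter> Qel))"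
    by (metis dvd_mult mult.left_commute)
  show "F (conjug h u) * card (Cen H (conjug h u) \<inter> Qel) = F u * card (Cen H u \<inter> Qel)"
    if "h \<in> H" for h
    using F[OF that u] card_Cen_conjug[OF H that uc] by simp
qed (use S in auto)

lemma not_dvd_card_regular_subgroup:
  assumes "subgroup Z G" "Z \<subseteq> Reg" shows "\<not> q dvd card Z"
proof
  assume "q dvd card Z"
  then obtain w where w: "w \<in> Z" "ord w = q" using cauchy fin assms(1) prime by blast
  then have "w \<in> carrier G" "w [^] m = \<one>" using assms(2) by (auto simp: Reg_def)
  then show False using ndvd w by (simp add: pow_eq_id)
qed

text \<open>Counting \<open>H\<close> by regular parts splits its order. The central regular
  elements \<open>Z\<close> contribute \<open>card Z * card (H \<inter> Qel)\<close>; the others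
  have centralizers smaller than \<open>H\<close>, so the induction hypothesis makes their
  contribution divisible by \<open>q ^ k\<close>. The factor \<open>card Z\<close> cancels because a
  subgroup of regular elements has order prime to \<open>q\<close>.\<close>

theorem frobenius_dvd:
  assumes "subgroup H G" "q ^ k dvd card H"
  shows "q ^ k dvd card (H \<inter> Qel)"
  using assms
proof (induction "card H" arbitrary: H k rule: less_induct)
  case less
  interpret H: subgroup H G by (rule less.prems)
  have finH: "finite H" using fin H.subset finite_subset by blast
  define Z where "Z = {u \<in> H \<inter> Reg. \<forall>h\<in>H. h \<otimes> u = u \<otimes> h}"
  define S where "S = H \<inter> Reg - Z"
  have ZS: "H \<inter> Reg = Z \<union> S" "Z \<inter> S = {}" by (auto simp: Z_def S_def)
  have finZS: "finite Z" "finite S" using finH by (auto simp: Z_def S_def)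
  have CZ: "Cen H u = H" if "u \<in> Z" for u using that by (auto simp: Z_def Cen_def)
  have "card H = (\<Sum>u\<in>H \<inter> Reg. card (Cen H u \<inter> Qel))"
    using sum_by_regular_part[OF less.prems(1), of "\<lambda>_. 1"] by simp
  also have "\<dots> = card Z * card (H \<inter> Qel) + (\<Sum>u\<in>S. card (Cen H u \<inter> Qel))"
    unfolding ZS(1) using finZS ZS(2) CZ by (simp add: sum.union_disjoint)
  finally have eq: "card H = card Z * card (H \<inter> Qel) + (\<Sum>u\<in>S. card (Cen H u \<inter> Qel))" .
  have "q ^ k dvd (\<Sum>u\<in>S. 1 * card (Cen H u \<inter> Qel))"
  proof (rule dvd_sum_Reg[OF less.prems(1)])
    show "S \<subseteq> Reg" by (auto simp: S_def)
    show "conjug h u \<in> S" if h: "h \<in> H" and u: "u \<in> S" for h u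
    proof -
      have uc: "u \<in> H" "u \<in> Reg" using u by (auto simp: S_def)
      obtain k where k: "k \<in> H" "conjug k u \<noteq> u"
        using u by (auto simp: S_def Z_def conj_eq_self_iff)
      \<comment> \<open>If \<open>k\<close> moves \<open>u\<close>, then the conjugate of
        \<open>k\<close> by \<open>h\<close> moves the conjugate of \<open>u\<close>, so noncentral
        elements stay noncentral.\<close>
      have "conjug (conjug h k) (conjug h u) \<noteq> conjug h u"
      proof -
        have "conjug (conjug h k) (conjug h u) = conjug h (conjug k u)"
          using h k uc by (simp add: conjug_def m_assoc inv_mult_group)
            (simp add: h k uc flip: m_assoc)
        then show ?thesis using h k uc by (simp add: conj_eq_iff)
      qed
      moreover have "conjug h k \<in> H" "conjug h u \<in> H" using h k uc by (simp_all add: conjug_def)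
      ultimately show ?thesis
        using Reg_conjug h uc by (auto simp: S_def Z_def conj_eq_self_iff)
    qed
    fix u j assume u: "u \<in> S" and j: "q ^ j dvd card (Cen H u)"
    show "q ^ j dvd card (Cen H u \<inter> Qel)"
    proof (rule less.hyps[OF _ _ j])
      have "Cen H u \<noteq> H" "Cen H u \<subseteq> H" using u by (auto simp: S_def Z_def Cen_def)
      then show "card (Cen H u) < card H" using finH by (simp add: psubset_card_mono psubsetI)
      show "subgroup (Cen H u) G" using u by (intro Cen_subgroup less.prems) (auto simp: S_def)
    qed
  qed (use less.prems in auto)
  then have "q ^ k dvd card Z * card (H \<inter> Qel)"
    using eq less.prems(2) by (metis (no_types, lifting) dvd_add_left_iff mult_1 sum.cong)
  moreover have "\<not> q dvd card Z"
  proof (rule not_dvd_card_regular_subgroup)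
    show "Z \<subseteq> Reg" by (auto simp: Z_def)
    have fixes_Z: "u \<in> Z \<longleftrightarrow> u \<in> H \<and> u \<in> Reg \<and> (\<forall>h\<in>H. conjug h u = u)" for u
      by (auto simp: Z_def conj_eq_self_iff)
    have ZD: "u \<in> H \<and> u \<in> carrier G \<and> u [^] m = \<one> \<and> (\<forall>h\<in>H. h \<otimes> u = u \<otimes> h)" if "u \<in> Z" for u
      using that unfolding Z_def Reg_def by blast
    show "subgroup Z G"
    proof (rule subgroupI)
      have "\<one> \<in> Z" by (auto simp: Z_def Reg_def)
      then show "Z \<noteq> {}" by blast
    next
      fix a b assume ab: "a \<in> Z" "b \<in> Z"
      then have *: "a \<in> H" "b \<in> H" "a \<in> carrier G" "b \<in> carrier G" "a \<otimes> b = b \<otimes> a"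
        "a [^] m = \<one>" "b [^] m = \<one>"
        by (blast dest: ZD)+
      then have "(a \<otimes> b) [^] m = \<one>" using pow_mult_distrib[of a b m] by simp
      moreover have "conjug h (a \<otimes> b) = a \<otimes> b" if "h \<in> H" for h
        using ab that * H.mem_carrier by (simp add: fixes_Z conj_hom)
      ultimately show "a \<otimes> b \<in> Z" using * by (simp add: fixes_Z Reg_def)
    next
      fix a assume a: "a \<in> Z"
      then have *: "a \<in> H" "a \<in> carrier G" "a [^] m = \<one>" "\<And>h. h \<in> H \<Longrightarrow> conjug h a = a"
        by (blast dest: ZD fixes_Z[THEN iffD1])+
      \<comment> \<open>The inverse of \<open>a\<close> is the power with exponent
        \<open>order G - 1\<close>, so the closure of \<open>Z\<close> under powers is
        enough.\<close>
      define k where "k = order G - 1"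
      have "Suc k = order G" using fin order_gt_0_iff_finite by (simp add: k_def)
      then have "a [^] k \<otimes> a = \<one>" using * pow_order_eq_1 by (metis nat_pow_Suc)
      then have inv: "inv a = a [^] k" using * by (simp add: inv_equality)
      have "(a [^] k) [^] m = (a [^] m) [^] k" using *(2) by (simp only: nat_pow_pow mult.commute)
      then have "(a [^] k) [^] m = \<one>" using * by simp
      moreover have "conjug h (a [^] k) = a [^] k" if "h \<in> H" for h
        using that * H.mem_carrier by (simp add: conj_pow)
      ultimately show "inv a \<in> Z"
        unfolding inv using * subgroup_pow[OF less.prems(1)] by (simp add: fixes_Z Reg_def)
    qed (auto simp: Z_def)
  qed
  ultimately show ?case using prime
    by (metis coprime_dvd_mult_right_iff prime_imp_coprime prime_imp_power_coprime_nat coprime_commute)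
qed

theorem dvd_sum_class_function_order:
  fixes F :: "'a \<Rightarrow> nat"
  assumes "\<And>g u. g \<in> carrier G \<Longrightarrow> u \<in> carrier G \<Longrightarrow> F (conjug g u) = F u"
    and "\<And>g. g \<in> carrier G \<Longrightarrow> F (g [^] e) = F g" and "q ^ k dvd order G"
  shows "q ^ k dvd sum F (carrier G)"
proof -
  have R: "carrier G \<inter> Reg = Reg" by (auto simp: Reg_def)
  have "q ^ k dvd (\<Sum>u\<in>Reg. F u * card (Cen (carrier G) u \<inter> Qel))"
  proof (rule dvd_sum_Reg[OF subgroup_self])
    show "q ^ j dvd card (Cen (carrier G) u \<inter> Qel)"
      if "u \<in> Reg" "q ^ j dvd card (Cen (carrier G) u)" for u j
      using that by (intro frobenius_dvd Cen_subgroup subgroup_self) (auto simp: Reg_def)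
  qed (use assms Reg_conjug in \<open>auto simp: order_def Reg_def\<close>)
  then show ?thesis using sum_by_regular_part[OF subgroup_self, of F] assms(2) by (simp add: R)
qed

end

section \<open>Sums over element orders and elements of prime order\<close>

lemma prime_part_group_exists:
  assumes "group G" "finite (carrier G)" "prime q" "order G = q ^ b * m" "\<not> q dvd m"
  obtains e f where "prime_part_group G q b m e f"
proof -
  interpret group G by fact
  have "coprime q m" using assms(3,5) by (rule prime_imp_coprime)
  then have c: "coprime m (q ^ b)" by (simp add: coprime_commute)
  obtain e where e: "[e = 1] (mod m)" "[e = 0] (mod q ^ b)"
    using binary_chinese_remainder_nat[OF c, of 1 0] by blast
  obtain f where f: "[f = 0] (mod m)" "[f = 1] (mod q ^ b)"
    using binary_chinese_remainder_nat[OF c, of 0 1] by blast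
  show ?thesis
    by (rule that[of e f]) (unfold_locales; use assms e f in auto)
qed

text \<open>The discarded factor \<open>g [^] f\<close> has order dividing \<open>q ^ b\<close>, so
  \<open>ord g\<close> divides \<open>ord (g [^] e) * q ^ b\<close>, and the second factor does not
  affect the exponent of \<open>p\<close>.\<close>

lemma (in prime_part_group) multiplicity_ord_pow_e:
  assumes "prime p" "p \<noteq> q" "g \<in> carrier G"
  shows "multiplicity p (ord (g [^] e)) = multiplicity p (ord g)"
proof (rule antisym)
  have pos: "ord g > 0" "ord (g [^] e) > 0"
    using assms(3) ord_ge_1[OF fin, of g] ord_ge_1[OF fin, of "g [^] e"] by auto
  have "(g [^] e) [^] ord g = \<one>"
    using assms(3) by (metis mult.commute nat_pow_one nat_pow_pow pow_ord_eq_1)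
  then have "ord (g [^] e) dvd ord g" using assms(3) by (simp add: pow_eq_id)
  then show "multiplicity p (ord (g [^] e)) \<le> multiplicity p (ord g)"
    using pos by (intro dvd_imp_multiplicity_le) auto
  define k where "k = ord (g [^] e)"
  have "g [^] (k * q ^ b) = (g [^] e \<otimes> g [^] f) [^] (k * q ^ b)" using decompose assms(3) by simp
  also have "\<dots> = (g [^] e) [^] (k * q ^ b) \<otimes> (g [^] f) [^] (k * q ^ b)"
    using assms(3) by (intro pow_mult_distrib) (simp_all add: nat_pow_mult add.commute)
  also have "(g [^] e) [^] (k * q ^ b) = \<one>"
    using assms(3) k_def by (metis nat_pow_closed nat_pow_one nat_pow_pow pow_ord_eq_1)
  also have "(g [^] f) [^] (k * q ^ b) = \<one>"
    using pow_f_Qel[OF assms(3)] unfolding Qel_def mem_Collect_eq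
    by (metis dvd_mult pow_eq_id)
  finally have "ord g dvd k * q ^ b" using assms(3) by (simp add: pow_eq_id)
  then have "multiplicity p (ord g) \<le> multiplicity p (k * q ^ b)"
    using pos prime_gt_0_nat[OF prime] by (intro dvd_imp_multiplicity_le) (auto simp: k_def)
  also have "multiplicity p (k * q ^ b) = multiplicity p k + multiplicity p (q ^ b)"
    using pos prime_gt_0_nat[OF prime] assms(1)
    by (intro prime_elem_multiplicity_mult_distrib) (auto simp: k_def)
  also have "multiplicity p (q ^ b) = 0"
    using assms(1,2) prime by (metis not_dvd_imp_multiplicity_0 prime_dvd_power primes_dvd_imp_eq)
  finally show "multiplicity p (ord g) \<le> multiplicity p (ord (g [^] e))" by (simp add: k_def)
qed

context group
begin

text \<open>The exponent of \<open>p\<close> survives passing to the \<open>q\<close>-regular part,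
  so any function of it may be summed. \<open>\<psi>\<close> is later the identity, for the
  exponents in \<open>rho\<close>, and the indicator of a positive exponent, for counting the
  elements of even order.\<close>

lemma dvd_sum_multiplicity_ord:
  fixes \<psi> :: "nat \<Rightarrow> nat"
  assumes "finite (carrier G)" "prime p" "prime q" "p \<noteq> q" "q ^ k dvd order G"
  shows "q ^ k dvd (\<Sum>g\<in>carrier G. \<psi> (multiplicity p (ord g)))"
proof -
  have "order G > 0" using assms(1) order_gt_0_iff_finite by simp
  then obtain m where "order G = q ^ multiplicity q (order G) * m" "\<not> q dvd m"
    using multiplicity_decompose'[of "order G" q] assms(3) by (metis less_irrefl not_prime_unit)
  then obtain b e f where "prime_part_group G q b m e f"
    using prime_part_group_exists assms(1,3) is_group by metis
  then interpret prime_part_group G q b m e f .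
  show ?thesis
    using assms by (intro dvd_sum_class_function_order) (auto simp: multiplicity_ord_pow_e)
qed

definition cyc :: "'a \<Rightarrow> 'a set" where
  "cyc x = (\<lambda>i::nat. x [^] i) ` {..<ord x}"

lemma mem_cyc_iff:
  assumes "finite (carrier G)" "x \<in> carrier G" shows "y \<in> cyc x \<longleftrightarrow> (\<exists>i::nat. y = x [^] i)"
proof -
  have "ord x > 0" using ord_ge_1[OF assms] by simp
  moreover have "x [^] i = x [^] (i mod ord x)" for i :: nat
  proof -
    have "int (ord x) dvd int i - int (i mod ord x)"
      by (metis dvd_minus_mod of_nat_mod)
    then have "x [^] int (i mod ord x) = x [^] int i"
      using assms(2) by (metis int_pow_eq)
    then show ?thesis by (simp only: int_pow_int)
  qed
  ultimately show ?thesis unfolding cyc_def by (auto) (metis imageI lessThan_iff mod_less_divisor)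
qed

lemma card_cyc: "finite (carrier G) \<Longrightarrow> x \<in> carrier G \<Longrightarrow> card (cyc x) = ord x"
proof -
  assume *: "finite (carrier G)" "x \<in> carrier G"
  then have "{..<ord x} = {0..ord x - 1}" using ord_ge_1[of x] by (auto simp: less_eq_Suc_le)
  then have "inj_on (\<lambda>i::nat. x [^] i) {..<ord x}" using ord_inj[OF *(2)] by simp
  then show ?thesis by (simp add: cyc_def card_image)
qed

lemma cyc_eq:
  assumes "finite (carrier G)" "x \<in> carrier G" "prime (ord x)" "y \<in> cyc x" "y \<noteq> \<one>"
  shows "cyc y = cyc x" "ord y = ord x"
proof -
  obtain i where i: "y = x [^] (i::nat)" using assms mem_cyc_iff by auto
  have yc: "y \<in> carrier G" using i assms by simp
  have "y [^] ord x = \<one>" using assms(2) by (metis i mult.commute nat_pow_one nat_pow_pow pow_ord_eq_1)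
  then have "ord y dvd ord x" using yc by (simp add: pow_eq_id)
  moreover have "ord y \<noteq> 1" using yc assms(5) ord_eq_1 by blast
  ultimately show o: "ord y = ord x" using assms(3) by (metis prime_nat_iff)
  have "cyc y \<subseteq> cyc x"
    using assms(1,2) yc by (auto simp: mem_cyc_iff i nat_pow_pow)
  moreover have "card (cyc y) = card (cyc x)" using o card_cyc assms yc by simp
  ultimately show "cyc y = cyc x" by (simp add: card_subset_eq cyc_def)
qed

lemma one_mem_cyc: "finite (carrier G) \<Longrightarrow> x \<in> carrier G \<Longrightarrow> \<one> \<in> cyc x"
  using mem_cyc_iff[of x \<one>] by (metis nat_pow_0)

lemma self_mem_cyc: "finite (carrier G) \<Longrightarrow> x \<in> carrier G \<Longrightarrow> x \<in> cyc x"
  using mem_cyc_iff[of x x] by (metis nat_pow_eone)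

lemma cyc_subset: "x \<in> carrier G \<Longrightarrow> cyc x \<subseteq> carrier G"
  by (auto simp: cyc_def)

definition ord_set :: "nat \<Rightarrow> 'a set" where
  "ord_set p = {g \<in> carrier G. ord g = p}"

text \<open>The elements are grouped by the subgroup they generate; each subgroup of order
  \<open>p\<close> has \<open>p - 1\<close> generators.\<close>

lemma card_ord_set:
  assumes fin: "finite (carrier G)" and p: "prime p"
  shows "card (ord_set p) = card (cyc ` ord_set p) * (p - 1)"
proof (rule card_eq_card_image_mult)
  show "finite (ord_set p)" using fin by (simp add: ord_set_def)
  fix Y assume "Y \<in> cyc ` ord_set p"
  then obtain x where x: "x \<in> carrier G" "ord x = p" "Y = cyc x" by (auto simp: ord_set_def)
  have "{y \<in> ord_set p. cyc y = Y} = cyc x - {\<one>}"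
  proof
    have "\<one> \<notin> ord_set p" using p by (auto simp: ord_set_def)
    then show "{y \<in> ord_set p. cyc y = Y} \<subseteq> cyc x - {\<one>}"
      using x self_mem_cyc[OF fin] by (auto simp: ord_set_def)
    show "cyc x - {\<one>} \<subseteq> {y \<in> ord_set p. cyc y = Y}"
      using x p cyc_eq[OF fin x(1)] cyc_subset[OF x(1)] by (auto simp: ord_set_def)
  qed
  then show "card {y \<in> ord_set p. cyc y = Y} = p - 1"
    using x card_cyc[OF fin x(1)] one_mem_cyc[OF fin x(1)] by simp
qed


lemma insert_ord_set_prime:
  "prime p \<Longrightarrow> {w \<in> carrier G. w [^] p = \<one>} = insert \<one> (ord_set p)"
  using ord_eq_1 by (auto simp: ord_set_def pow_eq_id prime_nat_iff)

text \<open>Frobenius' theorem with \<open>p\<close> dividing the order exactly once: the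
  \<open>p\<close>-elements are those of order \<open>p\<close> together with the identity, which
  accounts for \<open>Suc\<close>.\<close>

lemma dvd_Suc_card_ord_set:
  assumes fin: "finite (carrier G)" and p: "prime p" and o: "order G = p * m" "\<not> p dvd m"
    and H: "subgroup H G" "p dvd card H"
  shows "p dvd Suc (card (H \<inter> ord_set p))"
proof -
  obtain e f where "prime_part_group G p 1 m e f"
    using prime_part_group_exists[of G p 1 m] assms is_group by auto
  then interpret prime_part_group G p 1 m e f .
  interpret H: subgroup H G by fact
  have "Qel = insert \<one> (ord_set p)"
    unfolding Qel_def power_one_right by (rule insert_ord_set_prime[OF p])
  then have "H \<inter> Qel = insert \<one> (H \<inter> ord_set p)" by auto
  moreover have "\<one> \<notin> ord_set p" using p by (auto simp: ord_set_def)
  moreover have "finite (H \<inter> ord_set p)" using fin by (simp add: ord_set_def)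
  ultimately have "card (H \<inter> Qel) = Suc (card (H \<inter> ord_set p))" by simp
  then show ?thesis using frobenius_dvd[OF H(1), of 1] H(2) by simp
qed

text \<open>There is only one subgroup of order \<open>p\<close>, and it consists of all
  \<open>p\<close>-elements. If \<open>p\<close> divides \<open>ord g\<close>, the
  \<open>p\<close>-part of \<open>g\<close> generates it, so \<open>g\<close> commutes with
  \<open>x\<close>. Inside the centralizer \<open>C\<close> every regular element commutes with all
  \<open>p\<close>-elements, hence is the regular part of exactly \<open>p\<close> elements, and
  just one of these is regular itself.\<close>

lemma card_centralizer_unique_cyc:
  assumes fin: "finite (carrier G)" and p: "prime p" and o: "order G = p * m" "\<not> p dvd m"
    and x: "x \<in> ord_set p" and u: "card (ord_set p) = p - 1"
  shows "p * card {g \<in> carrier G. p dvd ord g} = (p - 1) * card (Cen (carrier G) x)"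
    and "{g \<in> carrier G. p dvd ord g} \<subseteq> Cen (carrier G) x"
proof -
  obtain e f where "prime_part_group G p 1 m e f"
    using prime_part_group_exists[of G p 1 m] assms is_group by auto
  then interpret prime_part_group G p 1 m e f .
  define C where "C = Cen (carrier G) x"
  have xc: "x \<in> carrier G" "ord x = p" using x by (auto simp: ord_set_def)
  have Q: "Qel = insert \<one> (ord_set p)"
    unfolding Qel_def power_one_right by (rule insert_ord_set_prime[OF p])
  have "\<one> \<notin> ord_set p" "finite (ord_set p)" using p fin by (auto simp: ord_set_def)
  then have cQ: "card Qel = p" using u p prime_gt_0_nat[of p] unfolding Q by simp
  have "cyc x \<subseteq> Qel"
    unfolding Q using cyc_eq[OF fin xc(1)] xc p cyc_subset[OF xc(1)] by (auto simp: ord_set_def)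
  then have Qc: "Qel = cyc x"
    using cQ card_cyc[OF fin xc(1)] xc fin by (metis Q \<open>finite (ord_set p)\<close> card_subset_eq finite_insert)
  have comm_pow: "g \<otimes> w [^] (i::nat) = w [^] i \<otimes> g"
    if "g \<in> carrier G" "w \<in> carrier G" "g \<otimes> w = w \<otimes> g" for g w i
    using that by (metis conj_eq_self_iff conj_pow nat_pow_closed)
  have C: "subgroup C G" unfolding C_def by (rule Cen_subgroup[OF subgroup_self xc(1)])
  have R: "g \<in> Reg \<longleftrightarrow> \<not> p dvd ord g" if g: "g \<in> carrier G" for g
  proof
    assume "g \<in> Reg"
    then have "ord g dvd m" using g by (simp add: Reg_def pow_eq_id)
    then show "\<not> p dvd ord g" using o(2) by (meson dvd_trans)
  next
    assume "\<not> p dvd ord g"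
    then have "coprime (ord g) p" using p by (metis coprime_commute prime_imp_coprime)
    moreover have "ord g dvd p * m" using ord_dvd_group_order[OF g] o(1) by simp
    ultimately show "g \<in> Reg" using g by (simp add: Reg_def pow_eq_id coprime_dvd_mult_right_iff)
  qed
  have sub: "g \<in> C" if g: "g \<in> carrier G" "p dvd ord g" for g
  proof -
    have "g [^] f \<noteq> \<one>"
      using decompose[OF g(1)] pow_e_Reg[OF g(1)] R[OF g(1)] g by auto
    moreover have "g [^] f \<in> cyc x" using pow_f_Qel[OF g(1)] Qc by simp
    ultimately have "cyc (g [^] f) = cyc x" using cyc_eq[OF fin xc(1)] xc p by simp
    then obtain i where i: "x = (g [^] f) [^] (i::nat)"
      using self_mem_cyc[OF fin xc(1)] mem_cyc_iff[OF fin, of "g [^] f" x] g by auto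
    have "g \<otimes> x = x \<otimes> g"
      unfolding i using g by (intro comm_pow) auto
    then show ?thesis using g by (simp add: C_def Cen_def)
  qed
  then show "{g \<in> carrier G. p dvd ord g} \<subseteq> Cen (carrier G) x" by (auto simp: C_def)
  have "card C = (\<Sum>u\<in>C \<inter> Reg. card (Cen C u \<inter> Qel))"
    using sum_by_regular_part[OF C, of "\<lambda>_. 1"] by simp
  also have "\<dots> = (\<Sum>u\<in>C \<inter> Reg. p)"
  proof (rule sum.cong)
    fix u assume u: "u \<in> C \<inter> Reg"
    have "Qel \<subseteq> Cen C u"
    proof
      fix w assume "w \<in> Qel"
      then obtain i where "w = x [^] (i::nat)" using Qc mem_cyc_iff[OF fin xc(1)] by auto
      then show "w \<in> Cen C u"
        using u xc comm_pow[of x x i] comm_pow[of u x i] by (auto simp: C_def Cen_def)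
    qed
    then have "Cen C u \<inter> Qel = Qel" by blast
    then show "card (Cen C u \<inter> Qel) = p" using cQ by simp
  qed simp
  finally have cC: "card C = card (C \<inter> Reg) * p" by simp
  have Cc: "C \<subseteq> carrier G" using C subgroup.subset by blast
  have "{g \<in> carrier G. p dvd ord g} = C - C \<inter> Reg"
    using sub R Cc by blast
  moreover have "finite C" using Cc fin finite_subset by blast
  ultimately have "card {g \<in> carrier G. p dvd ord g} = card C - card (C \<inter> Reg)"
    by (simp add: card_Diff_subset)
  then have "card {g \<in> carrier G. p dvd ord g} = (p - 1) * card (C \<inter> Reg)"
    using cC by (simp add: diff_mult_distrib mult.commute)
  then show "p * card {g \<in> carrier G. p dvd ord g} = (p - 1) * card (Cen (carrier G) x)"
    using cC by (simp add: C_def)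
qed

section \<open>From the set of exponents to the order of the group\<close>

lemma multiplicity_rho:
  assumes "finite (carrier G)" "prime p"
  shows "multiplicity p (rho G) = (\<Sum>g\<in>carrier G. multiplicity p (ord g))"
proof -
  have "0 \<notin> ord ` carrier G"
    using ord_ge_1[OF assms(1)] by (metis imageE not_one_le_zero)
  then show ?thesis
    unfolding rho_def using assms by (intro prime_elem_multiplicity_prod_distrib) auto
qed

lemma prime7: "prime (7::nat)" and prime13: "prime (13::nat)" and prime3: "prime (3::nat)"
  by simp_all

lemma card_eq_sum_of_bool:
  "finite (carrier G) \<Longrightarrow> card {g \<in> carrier G. P g} = (\<Sum>g\<in>carrier G. of_bool (P g))"
  by (simp add: of_bool_def sum.If_cases Int_def)

lemma sum_multiplicity_ord:
  assumes fin: "finite (carrier G)" and p: "prime p"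
    and sq: "\<And>g. g \<in> carrier G \<Longrightarrow> \<not> p\<^sup>2 dvd ord g"
  shows "(\<Sum>g\<in>carrier G. multiplicity p (ord g)) = card {g \<in> carrier G. p dvd ord g}"
  unfolding card_eq_sum_of_bool[OF fin]
proof (rule sum.cong)
  fix g assume g: "g \<in> carrier G"
  show "multiplicity p (ord g) = of_bool (p dvd ord g)"
  proof (cases "p dvd ord g")
    case True
    then have "multiplicity p (ord g) = 1"
      using sq[OF g] by (intro multiplicity_eqI) (auto simp: power2_eq_square)
    then show ?thesis using True by simp
  qed (simp add: not_dvd_imp_multiplicity_0)
qed simp

text \<open>The squares of 3, 7 and 13 do not divide 1092, so once 4 is excluded every exponent in
  \<open>rho G\<close> is just the number of elements whose order the prime divides. It serves both
  groups of the theorem.\<close>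

lemma Exp_rho_eqI:
  assumes fin: "finite (carrier G)" and o: "order G dvd 1092"
    and sq: "\<And>g. g \<in> carrier G \<Longrightarrow> \<not> 4 dvd ord g"
    and E: "card {g \<in> carrier G. 2 dvd ord g} = 273" "card {g \<in> carrier G. 3 dvd ord g} = 364"
      "card {g \<in> carrier G. 7 dvd ord g} = 468" "card {g \<in> carrier G. 13 dvd ord g} = 168"
  shows "Exp_rho G = {168, 273, 364, 468}"
proof -
  define A where "A p = multiplicity p (rho G)" for p
  have ord_dvd: "ord g dvd 1092" if "g \<in> carrier G" for g
    using o ord_dvd_group_order[OF that] dvd_trans by blast
  have A: "A p = card {g \<in> carrier G. p dvd ord g}" if "p \<in> {2, 3, 7, 13}" for p
  proof -
    have "\<not> p\<^sup>2 dvd ord g" if g: "g \<in> carrier G" for g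
    proof (cases "p = 2")
      case False
      then have "\<not> p\<^sup>2 dvd 1092" using \<open>p \<in> {2, 3, 7, 13}\<close> by auto
      then show ?thesis using ord_dvd[OF g] dvd_trans by blast
    qed (use sq[OF g] in simp)
    moreover have "prime p" using that by auto
    ultimately show ?thesis
      unfolding A_def using multiplicity_rho[OF fin] sum_multiplicity_ord[OF fin] by simp
  qed
  have A_val: "A 2 = 273" "A 3 = 364" "A 7 = 468" "A 13 = 168" using A E by simp_all
  have "prime_factors (rho G) = {2, 3, 7, 13}"
  proof
    show "prime_factors (rho G) \<subseteq> {2, 3, 7, 13}"
    proof
      fix p assume p: "p \<in> prime_factors (rho G)"
      then have pp: "prime p" by auto
      have "p dvd (\<Prod>g\<in>carrier G. ord g)" using p by (auto simp: rho_def)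
      then obtain g where "g \<in> carrier G" "p dvd ord g"
        using pp fin prime_dvd_prod_iff by metis
      then have "p dvd 1092" using ord_dvd dvd_trans by blast
      then have "p dvd 2 * 2 * 3 * 7 * 13" by simp
      then have "p dvd 2 \<or> p dvd 3 \<or> p dvd 7 \<or> p dvd 13" using pp prime_dvd_multD by metis
      then show "p \<in> {2, 3, 7, 13}"
        using primes_dvd_imp_eq[OF pp] prime3 prime7 prime13 two_is_prime_nat by blast
    qed
    have "p \<in> prime_factors (rho G)" if "prime p" "A p > 0" for p
      using that by (simp add: prime_factors_multiplicity A_def)
    then show "{2, 3, 7, 13} \<subseteq> prime_factors (rho G)" using A_val by simp
  qed
  then show ?thesis using A_val by (auto simp: Exp_rho_def Exp_def A_def)
qed

lemma dvd_273:
  fixes a :: nat assumes "3 dvd a" "7 dvd a" "13 dvd a" shows "273 dvd a"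
proof -
  have "3 * 7 dvd a"
    using assms by (intro divides_mult primes_coprime) simp_all
  moreover have "coprime (3 * 7) (13::nat)"
    unfolding coprime_mult_left_iff by (simp add: primes_coprime)
  ultimately have "3 * 7 * 13 dvd a" using assms(3) by (metis divides_mult)
  then show ?thesis by simp
qed

lemma order_cases:
  assumes fin: "finite (carrier G)" and E: "Exp_rho G = {168, 273, 364, 468}"
  shows "order G \<in> {546, 1092}"
    and "card {g \<in> carrier G. 2 dvd ord g} = 273" "card {g \<in> carrier G. 3 dvd ord g} = 364"
    and "card {g \<in> carrier G. 7 dvd ord g} = 468" "card {g \<in> carrier G. 13 dvd ord g} = 168"
proof -
  define A where "A p = (\<Sum>g\<in>carrier G. multiplicity p (ord g))" for p
  define P where "P = prime_factors (rho G)"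
  have n0: "order G > 0" using fin order_gt_0_iff_finite by simp
  have AP: "A ` P = {168, 273, 364, 468}"
    using E unfolding Exp_rho_def Exp_def P_def A_def
    by (metis (no_types, lifting) fin image_cong in_prime_factors_imp_prime multiplicity_rho)
  have pP: "prime p" "p dvd order G" if p: "p \<in> P" for p
  proof -
    show "prime p" using p by (auto simp: P_def)
    have "p dvd (\<Prod>g\<in>carrier G. ord g)" using p by (auto simp: P_def rho_def)
    then obtain g where "g \<in> carrier G" "p dvd ord g"
      using \<open>prime p\<close> fin prime_dvd_prod_iff by metis
    then show "p dvd order G" using ord_dvd_group_order dvd_trans by blast
  qed
  have D: "q ^ k dvd A p" if "p \<in> P" "prime q" "p \<noteq> q" "q ^ k dvd order G" for p q k
    unfolding A_def using dvd_sum_multiplicity_ord[OF fin pP(1)[OF that(1)] that(2-4), of id] by simp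
  have D1: "q dvd A p" if "p \<in> P" "q \<in> P" "p \<noteq> q" for p q
    using D[of p q 1] that pP by simp
  have "273 \<in> A ` P" "364 \<in> A ` P" "468 \<in> A ` P" "168 \<in> A ` P" unfolding AP by simp_all
  then obtain p2 p3 p7 p13 where p: "p2 \<in> P" "p3 \<in> P" "p7 \<in> P" "p13 \<in> P"
    and Ap: "A p2 = 273" "A p3 = 364" "A p7 = 468" "A p13 = 168"
    by (elim imageE) metis
  have ne: "p2 \<noteq> p3" "p2 \<noteq> p7" "p2 \<noteq> p13" "p3 \<noteq> p7" "p3 \<noteq> p13" "p7 \<noteq> p13" using Ap by auto
  have pr: "prime p2" "prime p3" "prime p7" "prime p13" using p pP by auto
  \<comment> \<open>The prime owning one exponent divides the exponents of the other primes. For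
    \<open>p2\<close> two of them suffice: 28 leaves 2 and 7, and 7 turns out to be
    \<open>p7\<close>.\<close>
  have "p2 dvd gcd 168 364" "p3 dvd gcd (gcd 168 273) 468" "p7 dvd gcd (gcd 168 273) 364"
    "p13 dvd gcd (gcd 273 364) 468"
    using p ne D1[of _ p2] D1[of _ p3] D1[of _ p7] D1[of _ p13] Ap by (metis gcd_greatest)+
  moreover have "gcd 168 (364::nat) = 2 * 2 * 7" "gcd (gcd 168 273) (468::nat) = 3"
    "gcd (gcd 168 273) (364::nat) = 7" "gcd (gcd 273 364) (468::nat) = 13" by code_simp+
  ultimately have dv: "p3 dvd 3" "p7 dvd 7" "p13 dvd 13" "p2 dvd 2 * 2 * 7" by simp_all
  have "p2 dvd 2 \<or> p2 dvd 7" using dv(4) pr(1) by (metis prime_dvd_multD)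
  then have "p2 = 2 \<or> p2 = 7"
    using primes_dvd_imp_eq[OF pr(1) two_is_prime_nat] primes_dvd_imp_eq[OF pr(1) prime7] by blast
  moreover have "p3 = 3" "p7 = 7" "p13 = 13"
    using primes_dvd_imp_eq[OF pr(2) prime3] primes_dvd_imp_eq[OF pr(3) prime7]
      primes_dvd_imp_eq[OF pr(4) prime13] dv by blast+
  ultimately have ps: "p2 = 2" "p3 = 3" "p7 = 7" "p13 = 13" using ne by auto
  \<comment> \<open>Every prime is tested, also outside \<open>P\<close>: an odd prime power
    dividing the order divides the exponent 273 of 2, and a power of 2 divides the exponent 364 of
    3.\<close>
  have "order G dvd 1092"
  proof (rule multiplicity_le_imp_dvd)
    fix q :: nat assume q: "prime q"
    define k where "k = multiplicity q (order G)"
    have k: "q ^ k dvd order G" by (simp add: k_def multiplicity_dvd)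
    have "q ^ k dvd 1092"
    proof (cases "q = 2")
      case True
      then have "q ^ k dvd 364" using D[OF p(2) q _ k] Ap ps by simp
      moreover have "(364::nat) dvd 1092" by simp
      ultimately show ?thesis using dvd_trans by blast
    next
      case False
      then have "q ^ k dvd 273" using D[OF p(1) q _ k] Ap ps by simp
      moreover have "(273::nat) dvd 1092" by simp
      ultimately show ?thesis using dvd_trans by blast
    qed
    then show "multiplicity q (order G) \<le> multiplicity q 1092"
      unfolding k_def[symmetric] using q by (intro multiplicity_geI) auto
  qed (use n0 in auto)
  then obtain c where c: "1092 = order G * c" by (elim dvdE)
  have dv: "2 dvd order G" "3 dvd order G" "7 dvd order G" "13 dvd order G"
    using pP(2) p ps by auto
  then have "2 * 273 dvd order G" by (intro divides_mult dvd_273) simp_all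
  then obtain r where r: "order G = 546 * r" by (elim dvdE) simp
  have rc: "r * c = 2" using c r by (simp add: mult.commute)
  then have "r dvd 2" by (metis dvd_triv_left)
  then have "r = 1 \<or> r = 2" by (metis prime_nat_iff two_is_prime_nat)
  then show o: "order G \<in> {546, 1092}" using r by auto
  have A1: "card {g \<in> carrier G. p dvd ord g} = A p" if "prime p" "\<not> p\<^sup>2 dvd order G" for p
    unfolding A_def using that ord_dvd_group_order
    by (subst sum_multiplicity_ord[OF fin that(1)]) (meson dvd_trans)+
  have "\<not> 3\<^sup>2 dvd order G" "\<not> 7\<^sup>2 dvd order G" "\<not> 13\<^sup>2 dvd order G" using o by auto
  then show "card {g \<in> carrier G. 3 dvd ord g} = 364" "card {g \<in> carrier G. 7 dvd ord g} = 468"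
    "card {g \<in> carrier G. 13 dvd ord g} = 168"
    using A1[of 3] A1[of 7] A1[of 13] Ap ps pr by auto
  \<comment> \<open>Elements of order divisible by 4 would contribute more than 1 to the exponent
    273 of 2, so at first it only bounds the number of elements of even order. This number is
    nonzero and itself divisible by 3 * 7 * 13 = 273, which forces equality.\<close>
  let ?E = "card {g \<in> carrier G. 2 dvd ord g}"
  have E2: "?E = (\<Sum>g\<in>carrier G. of_bool (multiplicity 2 (ord g) > 0))"
    unfolding card_eq_sum_of_bool[OF fin]
  proof (rule sum.cong)
    fix g assume "g \<in> carrier G"
    then have "ord g > 0" using ord_ge_1[OF fin] by fastforce
    then show "of_bool (2 dvd ord g) = of_bool (multiplicity 2 (ord g) > 0)"
      by (simp add: multiplicity_gt_zero_iff)
  qed simp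
  have q: "q dvd ?E" if "prime q" "q \<noteq> 2" "q dvd order G" for q
    unfolding E2 using dvd_sum_multiplicity_ord[OF fin two_is_prime_nat that(1), of 1 "\<lambda>i. of_bool (i > 0)"] that by simp
  have "3 dvd ?E" "7 dvd ?E" "13 dvd ?E"
    using q[of 3] q[of 7] q[of 13] dv pr ps by auto
  then have "273 dvd ?E" by (rule dvd_273)
  moreover have "?E \<le> A 2"
    unfolding E2 A_def by (intro sum_mono) auto
  then have "?E \<le> 273" using Ap ps by simp
  moreover have "?E \<noteq> 0"
  proof
    assume "?E = 0"
    then have "\<not> 2 dvd ord g" if "g \<in> carrier G" for g using fin that by auto
    then have "A 2 = 0" unfolding A_def by (simp add: not_dvd_imp_multiplicity_0)
    then show False using Ap ps by simp
  qed
  ultimately show "?E = 273" by (auto elim!: dvdE)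
qed

end

section \<open>Subgroups of order 13 in groups of order 546 and 1092\<close>

lemma nat_1_12_cases:
  "k \<in> {1..12::nat} \<Longrightarrow> k = 1 \<or> k = 2 \<or> k = 3 \<or> k = 4 \<or> k = 5 \<or> k = 6 \<or> k = 7 \<or> k = 8 \<or> k = 9 \<or>
    k = 10 \<or> k = 11 \<or> k = 12"
  unfolding atLeastAtMost_iff by presburger

context group
begin

lemma pow_mod_13:
  assumes "x \<in> carrier G" "ord x = 13" shows "x [^] (i::nat) = x [^] (i mod 13)"
proof -
  have "int (ord x) dvd int i - int (i mod 13)"
    using assms(2) by (metis dvd_minus_mod of_nat_mod of_nat_numeral)
  then have "x [^] int (i mod 13) = x [^] int i"
    using assms(1) by (metis int_pow_eq)
  then show ?thesis by (simp only: int_pow_int)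
qed

lemma pow_eq_13_iff:
  assumes "x \<in> carrier G" "ord x = 13" "i < 13" "j < 13"
  shows "x [^] (i::nat) = x [^] j \<longleftrightarrow> i = j"
proof -
  have "x [^] i = x [^] j \<longleftrightarrow> int 13 dvd int j - int i"
    using int_pow_eq[OF assms(1), of "int i" "int j"] assms(2) by (simp add: int_pow_int)
  also have "\<dots> \<longleftrightarrow> i = j" using assms(3,4) by presburger
  finally show ?thesis .
qed

lemma conjug_pow_power:
  assumes "g \<in> carrier G" "x \<in> carrier G" "conjug g x = x [^] (k::nat)"
  shows "conjug (g [^] n) x = x [^] (k ^ n)"
proof (induction n)
  case (Suc n)
  have "conjug (g [^] Suc n) x = conjug (g [^] n) (x [^] k)"
    using assms by (simp add: conj_mult)
  also have "\<dots> = (x [^] (k ^ n)) [^] k" using assms Suc by (simp add: conj_pow)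
  finally show ?case using assms(2) by (simp add: nat_pow_pow mult.commute)
qed (use assms in simp)

lemma mem_Cen_iff:
  "g \<in> carrier G \<Longrightarrow> u \<in> carrier G \<Longrightarrow> g \<in> Cen (carrier G) u \<longleftrightarrow> conjug g u = u"
  by (auto simp: Cen_def conj_eq_self_iff)

text \<open>If \<open>g\<close> acts on \<open>cyc x\<close> by the multiplier \<open>k\<close>,
  then \<open>g [^] n\<close> acts by \<open>k ^ n\<close>. The exponent \<open>n\<close> is chosen
  beforehand, in the applications so that \<open>g [^] n\<close> is the identity, and the
  equivalence then becomes an equation for \<open>k\<close> modulo 13.\<close>

lemma conjug_cyc_13:
  assumes fin: "finite (carrier G)" and x: "x \<in> carrier G" "ord x = 13"
    and g: "g \<in> carrier G" "conjug g x \<in> cyc x"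
  obtains k where "k \<in> {1..12}" "conjug g x = x [^] (k::nat)"
    "k ^ n mod 13 = 1 \<longleftrightarrow> g [^] n \<in> Cen (carrier G) x"
proof -
  obtain k where k: "k < (13::nat)" "conjug g x = x [^] k" using g(2) x by (auto simp: cyc_def)
  have "k \<noteq> 0"
  proof
    assume "k = 0"
    then have "conjug g x = \<one>" using k by simp
    then have "ord x = 1" using ord_conj[OF g(1) x(1)] by simp
    then show False using x by simp
  qed
  have "k ^ n mod 13 = 1 \<longleftrightarrow> x [^] (k ^ n mod 13) = x [^] (1::nat)"
    using pow_eq_13_iff[OF x, of "k ^ n mod 13" 1] by simp
  also have "\<dots> \<longleftrightarrow> conjug (g [^] n) x = x"
    using conjug_pow_power[OF g(1) x(1) k(2), of n] pow_mod_13[OF x, of "k ^ n"] x by simp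
  also have "\<dots> \<longleftrightarrow> g [^] n \<in> Cen (carrier G) x"
    using g x by (simp add: conj_eq_self_iff Cen_def)
  finally have "k ^ n mod 13 = 1 \<longleftrightarrow> g [^] n \<in> Cen (carrier G) x" .
  then show ?thesis using k \<open>k \<noteq> 0\<close> by (intro that[of k]) simp_all
qed

text \<open>The number \<open>c\<close> of subgroups of order 13 is at most 14, as 12 elements each
  must fit into 168, and is congruent to 1 modulo 13 by Frobenius' theorem.\<close>

lemma card_ord_set_13:
  assumes fin: "finite (carrier G)" and o: "order G \<in> {546, 1092}"
    and E: "card {g \<in> carrier G. 13 dvd ord g} = 168"
  shows "card (ord_set 13) \<in> {12, 168}"
proof -
  define c where "c = card (cyc ` ord_set 13)"
  have O: "card (ord_set 13) = c * 12" using card_ord_set[OF fin prime13] by (simp add: c_def)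
  have sub: "ord_set 13 \<subseteq> {g \<in> carrier G. 13 dvd ord g}" by (auto simp: ord_set_def)
  have "card (ord_set 13) \<le> 168"
    using card_mono[OF _ sub] fin E by simp
  then have "c < 15" using O by simp
  obtain m where "order G = 13 * m" "\<not> 13 dvd m"
  proof -
    have "order G = 13 * 42 \<or> order G = 13 * 84" using o by auto
    then show ?thesis using that[of 42] that[of 84] by auto
  qed
  then have "13 dvd Suc (card (carrier G \<inter> ord_set 13))"
    using dvd_Suc_card_ord_set[OF fin prime13 _ _ subgroup_self] by (simp add: order_def)
  moreover have "carrier G \<inter> ord_set 13 = ord_set 13" by (auto simp: ord_set_def)
  ultimately have "13 dvd Suc (c * 12)" using O by simp
  then have "c = 1 \<or> c = 14" using \<open>c < 15\<close> by presburger
  then show ?thesis using O by auto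
qed

lemma ord_set_13_eq_cyc:
  assumes fin: "finite (carrier G)" and x: "x \<in> ord_set 13" and c: "card (ord_set 13) = 12"
  shows "insert \<one> (ord_set 13) = cyc x"
proof -
  have xc: "x \<in> carrier G" "ord x = 13" using x by (auto simp: ord_set_def)
  have *: "cyc x \<subseteq> insert \<one> (ord_set 13)"
    using cyc_eq[OF fin xc(1)] xc prime13 cyc_subset[OF xc(1)] by (auto simp: ord_set_def)
  have "finite (ord_set 13)" "\<one> \<notin> ord_set 13" using fin by (auto simp: ord_set_def)
  then have "card (insert \<one> (ord_set 13)) = card (cyc x)"
    using c card_cyc[OF fin xc(1)] xc by simp
  then show ?thesis using * \<open>finite (ord_set 13)\<close> by (metis card_subset_eq finite_insert)
qed

lemma conjug_mem_cyc_13: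
  assumes fin: "finite (carrier G)" and x: "x \<in> ord_set 13" and c: "card (ord_set 13) = 12"
    and g: "g \<in> carrier G"
  shows "conjug g x \<in> cyc x"
proof -
  have "conjug g x \<in> ord_set 13" using x g by (simp add: ord_set_def)
  then show ?thesis using ord_set_13_eq_cyc[OF fin x c] by blast
qed

text \<open>The 1092 - 273 = 819 elements of odd order would act on \<open>cyc x\<close> with
  multiplier 1, 3 or 9. Each multiplier belongs to at most one coset of the centralizer, so there
  could be only 3 * 182 = 546 such elements.\<close>

lemma not_order_1092_unique_cyc:
  assumes fin: "finite (carrier G)" and o: "order G = 1092"
    and E: "card {g \<in> carrier G. 2 dvd ord g} = 273"
    and x: "x \<in> ord_set 13" and c: "card (ord_set 13) = 12"
    and C: "card (Cen (carrier G) x) = 182"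
  shows False
proof -
  have xc: "x \<in> carrier G" "ord x = 13" using x by (auto simp: ord_set_def)
  define S where "S = {g \<in> carrier G. \<not> 2 dvd ord g}"
  have "S = carrier G - {g \<in> carrier G. 2 dvd ord g}" by (auto simp: S_def)
  then have "card S = 819"
    using E o fin by (simp add: card_Diff_subset order_def)
  have "S \<subseteq> (\<Union>y\<in>{x [^] (1::nat), x [^] (3::nat), x [^] (9::nat)}. {g \<in> carrier G. conjug g x = y})"
  proof
    fix g assume g: "g \<in> S"
    then have gc: "g \<in> carrier G" by (simp add: S_def)
    obtain k where k: "k \<in> {1..12}" "conjug g x = x [^] (k::nat)"
      "k ^ 273 mod 13 = 1 \<longleftrightarrow> g [^] (273::nat) \<in> Cen (carrier G) x"
      using conjug_cyc_13[OF fin xc gc conjug_mem_cyc_13[OF fin x c gc]] by blast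
    have "coprime (ord g) 2" using g by (simp add: S_def)
    then have "coprime (ord g) (2 ^ 2)" by (metis coprime_power_right_iff)
    moreover have "ord g dvd 2 ^ 2 * 273" using ord_dvd_group_order[OF gc] o by simp
    ultimately have "ord g dvd 273" using coprime_dvd_mult_right_iff by blast
    then have "g [^] (273::nat) = \<one>" using gc by (simp add: pow_eq_id)
    then have k273: "k ^ 273 mod 13 = 1" using k xc by (simp add: Cen_def)
    \<comment> \<open>273 = 12 * 22 + 9, so \<open>k ^ 9\<close> is 1 modulo 13. Together with
      \<open>k ^ 12\<close> this leaves the cube roots of 1.\<close>
    have "k ^ 12 mod 13 = 1" using nat_1_12_cases[OF k(1)] by (elim disjE) simp_all
    moreover have "k ^ 273 = (k ^ 12) ^ 22 * k ^ 9" by (simp flip: power_mult power_add)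
    ultimately have "k ^ 9 mod 13 = 1" using k273 by (metis mod_mult_left_eq mult_1 power_mod power_one)
    moreover note nat_1_12_cases[OF k(1)]
    ultimately have "k = 1 \<or> k = 3 \<or> k = 9" by (elim disjE) simp_all
    then show "g \<in> (\<Union>y\<in>{x [^] (1::nat), x [^] (3::nat), x [^] (9::nat)}. {g \<in> carrier G. conjug g x = y})"
      using k gc by auto
  qed
  then have "card S \<le> card (\<Union>y\<in>{x [^] (1::nat), x [^] (3::nat), x [^] (9::nat)}. {g \<in> carrier G. conjug g x = y})"
    using fin by (intro card_mono) auto
  also have "\<dots> \<le> (\<Sum>y\<in>{x [^] (1::nat), x [^] (3::nat), x [^] (9::nat)}. card {g \<in> carrier G. conjug g x = y})"
    by (rule card_UN_le) simp
  also have "\<dots> \<le> (\<Sum>y\<in>{x [^] (1::nat), x [^] (3::nat), x [^] (9::nat)}. 182)"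
  proof (rule sum_mono)
    fix y
    show "card {g \<in> carrier G. conjug g x = y} \<le> 182"
    proof (cases "\<exists>k\<in>carrier G. y = conjug k x")
      case True
      then show ?thesis using card_conj_fiber[OF subgroup_self xc(1)] C by auto
    next
      case False
      then have "{g \<in> carrier G. conjug g x = y} = {}" by auto
      then show ?thesis by (metis card.empty zero_le)
    qed
  qed
  also have "\<dots> \<le> 546" using card_insert_le_m1 by (auto simp: card_insert_if)
  finally show False using \<open>card S = 819\<close> by simp
qed

lemma central_if_card_Cen:
  assumes "finite (carrier G)" "card (Cen (carrier G) y) = order G" "g \<in> carrier G"
  shows "g \<otimes> y = y \<otimes> g"
proof -
  have "Cen (carrier G) y \<subseteq> carrier G" by (auto simp: Cen_def)
  then have "Cen (carrier G) y = carrier G"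
    using assms by (simp add: card_subset_eq order_def)
  then show ?thesis using assms(3) by (auto simp: Cen_def)
qed

text \<open>The centralizer \<open>C\<close> of \<open>x\<close> has order 182, since 13 * 168 = 12
  * 182, and 14 of its elements, the set \<open>T\<close>, have order prime to 13. Elements of order
  7 lie in \<open>T\<close>, because 7 is coprime to 12; their number turns out to be 6, which makes
  them central. \<open>T\<close> then consists of the powers of \<open>y\<close> and their products
  with an involution \<open>t\<close>, so \<open>t\<close> is the only involution of the normal
  subgroup \<open>C\<close> and is central as well.\<close>

lemma order_546_structure:
  assumes fin: "finite (carrier G)" and o: "order G = 546"
    and E7: "card {g \<in> carrier G. 7 dvd ord g} = 468"
    and E13: "card {g \<in> carrier G. 13 dvd ord g} = 168"
    and c: "card (ord_set 13) = 12"
  obtains z x h where "z \<in> carrier G" "x \<in> carrier G" "h \<in> carrier G"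
    "ord z = 14" "ord x = 13" "ord h = 3" "\<And>g. g \<in> carrier G \<Longrightarrow> z \<otimes> g = g \<otimes> z"
    "conjug h x = x [^] (3::nat)"
proof -
  have "ord_set 13 \<noteq> {}" using c by auto
  then obtain x where x: "x \<in> ord_set 13" by blast
  then have xc: "x \<in> carrier G" "ord x = 13" by (auto simp: ord_set_def)
  define C where "C = Cen (carrier G) x"
  have CG: "subgroup C G" unfolding C_def by (rule Cen_subgroup[OF subgroup_self xc(1)])
  interpret C: subgroup C G by (rule CG)
  have finC: "finite C" using fin C.subset finite_subset by blast
  have "order G = 13 * 42" "\<not> 13 dvd (42::nat)" using o by simp_all
  note cu = card_centralizer_unique_cyc[OF fin prime13 this x, folded C_def]
  have cC: "card C = 182" using cu(1) c E13 by simp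
  define T where "T = {g \<in> C. \<not> 13 dvd ord g}"
  have "T = C - {g \<in> carrier G. 13 dvd ord g}" using C.subset by (auto simp: T_def)
  moreover have "finite {g \<in> carrier G. 13 dvd ord g}" using fin by simp
  ultimately have cT: "card T = 14"
    using cu(2) c cC E13 by (simp add: card_Diff_subset)
  have finT: "finite T" using finC by (simp add: T_def)
  obtain t where t: "t \<in> C" "ord t = 2"
    using cauchy[OF fin CG two_is_prime_nat] cC by auto
  have in_C: "g \<in> C" if g: "g \<in> carrier G" "ord g = 7" for g
  proof -
    obtain k where k: "k \<in> {1..12}" "conjug g x = x [^] (k::nat)"
      "k ^ 7 mod 13 = 1 \<longleftrightarrow> g [^] (7::nat) \<in> Cen (carrier G) x"
      using conjug_cyc_13[OF fin xc g(1) conjug_mem_cyc_13[OF fin x c g(1)]] by blast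
    have "g [^] (7::nat) = \<one>" using g by (simp add: pow_eq_id)
    then have "k ^ 7 mod 13 = 1" using k xc by (simp add: Cen_def)
    moreover note nat_1_12_cases[OF k(1)]
    ultimately have "k = 1" by (elim disjE) simp_all
    then have "conjug g x = x" using k(2) xc by simp
    then show ?thesis using g xc unfolding C_def by (simp only: mem_Cen_iff)
  qed
  have O7: "C \<inter> ord_set 7 = ord_set 7" using in_C by (auto simp: ord_set_def)
  \<comment> \<open>Removing \<open>t\<close> as well as the identity matters: the number is 6
    modulo 7, and a bound of 13 instead of 12 would still admit 13.\<close>
  have "ord_set 7 \<subseteq> T - {\<one>, t}"
    using in_C t by (auto simp: ord_set_def T_def)
  moreover have "{\<one>, t} \<subseteq> T" "\<one> \<noteq> t" using t by (auto simp: T_def)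
  then have "card (T - {\<one>, t}) = 12" using cT finT by (simp add: card_Diff_subset)
  ultimately have "card (ord_set 7) \<le> 12" using card_mono[of "T - {\<one>, t}" "ord_set 7"] finT by simp
  moreover have "order G = 7 * 78" "\<not> 7 dvd (78::nat)" using o by simp_all
  note o7 = this
  have "7 dvd Suc (card (ord_set 7))"
    using dvd_Suc_card_ord_set[OF fin prime7 o7 CG] cC by (simp add: O7)
  ultimately have c7: "card (ord_set 7) = 6" by presburger
  then have "ord_set 7 \<noteq> {}" by auto
  then obtain y where y: "y \<in> ord_set 7" by blast
  then have yc: "y \<in> carrier G" "ord y = 7" by (auto simp: ord_set_def)
  \<comment> \<open>7 * 468 = 6 * 546.\<close>
  have "card (Cen (carrier G) y) = order G"
    using card_centralizer_unique_cyc(1)[OF fin prime7 o7 y] c7 E7 o by simp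
  then have ycen: "g \<otimes> y = y \<otimes> g" if "g \<in> carrier G" for g
    using central_if_card_Cen[OF fin] that by blast
  have tc: "t \<in> carrier G" "t \<otimes> t = \<one>" "t \<noteq> \<one>"
  proof -
    show "t \<in> carrier G" using t C.subset by blast
    then have "t [^] (2::nat) = \<one>" using t by (simp add: pow_eq_id)
    then show "t \<otimes> t = \<one>" using \<open>t \<in> carrier G\<close> by (simp add: numeral_2_eq_2)
  qed (use t in auto)
  have ty: "\<one> \<in> cyc y" "cyc y \<subseteq> carrier G" "card (cyc y) = 7"
    using one_mem_cyc[OF fin yc(1)] cyc_subset[OF yc(1)] card_cyc[OF fin yc(1)] yc by auto
  have pow7: "w [^] (7::nat) = \<one>" "\<And>g. g \<in> carrier G \<Longrightarrow> g \<otimes> w = w \<otimes> g" if w: "w \<in> cyc y" for w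
  proof -
    obtain i where i: "w = y [^] (i::nat)" using w by (auto simp: cyc_def)
    have "y [^] (i * 7) = \<one>" using yc by (simp add: pow_eq_id)
    then show "w [^] (7::nat) = \<one>" using yc by (simp add: i nat_pow_pow)
    fix g assume g: "g \<in> carrier G"
    then have "conjug g y = y" using ycen yc by (simp add: conj_eq_self_iff)
    then have "conjug g w = w" using g yc by (simp add: i conj_pow)
    then show "g \<otimes> w = w \<otimes> g" using g yc by (simp add: i conj_eq_self_iff)
  qed
  have t_pow: "t [^] (14::nat) = \<one>" "t [^] (7::nat) = t"
  proof -
    show "t [^] (14::nat) = \<one>" using t tc by (simp add: pow_eq_id)
    have "t [^] (6::nat) = \<one>" using t tc by (simp add: pow_eq_id)
    then show "t [^] (7::nat) = t" using nat_pow_mult[of t 6 1] tc by simp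
  qed
  have sub: "cyc y \<union> (\<lambda>w. t \<otimes> w) ` cyc y \<subseteq> T"
  proof -
    have "w \<in> T" "t \<otimes> w \<in> T" if w: "w \<in> cyc y" for w
    proof -
      have wc: "w \<in> carrier G" using w ty by blast
      have "w \<in> C" using pow7(2)[OF w xc(1)] wc unfolding C_def Cen_def by simp
      moreover have "w [^] (14::nat) = \<one>"
      proof -
        have "w [^] (7 * 2::nat) = \<one>" using pow7(1)[OF w] wc by (metis nat_pow_one nat_pow_pow)
        then show ?thesis by simp
      qed
      moreover have "(t \<otimes> w) [^] (14::nat) = \<one>"
        using pow_mult_distrib[of t w 14] pow7(2)[OF w tc(1)] tc wc t_pow \<open>w [^] (14::nat) = \<one>\<close> by simp
      moreover have "\<not> 13 dvd d" if "d dvd (14::nat)" for d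
        using that dvd_trans[of 13 d 14] by auto
      ultimately show "w \<in> T" "t \<otimes> w \<in> T"
        using t wc tc by (simp_all add: T_def pow_eq_id)
    qed
    then show ?thesis by blast
  qed
  \<comment> \<open>The seventh power is the identity on \<open>cyc y\<close> and \<open>t\<close>
    on its translate.\<close>
  have disj: "cyc y \<inter> (\<lambda>w. t \<otimes> w) ` cyc y = {}"
  proof -
    have False if w: "w \<in> cyc y" "t \<otimes> w \<in> cyc y" for w
    proof -
      have wc: "w \<in> carrier G" using w ty by blast
      have "(t \<otimes> w) [^] (7::nat) = t"
        using pow_mult_distrib[of t w 7] pow7[OF w(1)] tc wc t_pow by simp
      then show False using pow7(1)[OF w(2)] tc by simp
    qed
    then show ?thesis by blast
  qed
  have "inj_on (\<lambda>w. t \<otimes> w) (cyc y)" using ty(2) tc by (intro inj_onI) (auto simp: subset_eq)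
  then have "card (cyc y \<union> (\<lambda>w. t \<otimes> w) ` cyc y) = 14"
    using disj ty(3) by (simp add: card_Un_disjoint card_image cyc_def)
  then have T_eq: "cyc y \<union> (\<lambda>w. t \<otimes> w) ` cyc y = T"
    using sub cT finT by (simp add: card_subset_eq)
  have tcen: "g \<otimes> t = t \<otimes> g" if g: "g \<in> carrier G" for g
  proof -
    define s where "s = conjug g t"
    have sc: "s \<in> carrier G" "ord s = 2" using g tc t by (simp_all add: s_def)
    then have s2: "s [^] (2::nat) = \<one>" by (simp add: pow_eq_id)
    have s7: "s [^] (7::nat) \<noteq> \<one>" using sc by (simp add: pow_eq_id)
    \<comment> \<open>\<open>C\<close> is normal: \<open>inv g\<close> carries \<open>x\<close> to a
      power of \<open>x\<close>, which \<open>t\<close> fixes, and \<open>g\<close> carries it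
      back.\<close>
    have "s \<in> C"
    proof -
      obtain k where k: "conjug (inv g) x = x [^] (k::nat)"
        using conjug_mem_cyc_13[OF fin x c, of "inv g"] g by (auto simp: cyc_def)
      have "conjug t x = x" using t(1) tc(1) xc unfolding C_def by (simp only: mem_Cen_iff)
      have "conjug s x = conjug g (conjug t (conjug (inv g) x))"
        using g tc xc by (simp add: s_def flip: conj_mult) (simp add: conjug_def m_assoc)
      also have "conjug t (conjug (inv g) x) = conjug (inv g) x"
        using \<open>conjug t x = x\<close> k tc xc by (simp add: conj_pow)
      finally have "conjug s x = x" using g xc by simp
      then show ?thesis using sc xc unfolding C_def by (simp only: mem_Cen_iff)
    qed
    then have "s \<in> T" using sc by (simp add: T_def)
    moreover have "s \<notin> cyc y" using pow7(1) s7 by blast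
    ultimately obtain w where w: "w \<in> cyc y" "s = t \<otimes> w" using T_eq by blast
    have wc: "w \<in> carrier G" using w ty by blast
    have "t [^] (2::nat) = \<one>" using t tc by (simp add: pow_eq_id)
    then have "w [^] (2::nat) = \<one>"
      using pow_mult_distrib[of t w 2] pow7(2)[OF w(1) tc(1)] tc wc s2 w by simp
    then have "ord w dvd 2" "ord w dvd 7" using pow7(1)[OF w(1)] wc by (simp_all add: pow_eq_id)
    moreover have "\<not> 7 dvd (2::nat)" by simp
    ultimately have "ord w = 1" using prime7 by (metis prime_nat_iff)
    then have "s = t" using w wc tc ord_eq_1 by simp
    then show ?thesis using g tc by (simp add: s_def conj_eq_self_iff)
  qed
  define z where "z = t \<otimes> y"
  have zc: "z \<in> carrier G" using tc yc by (simp add: z_def)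
  have zcen: "z \<otimes> g = g \<otimes> z" if "g \<in> carrier G" for g
  proof -
    have "conjug g t = t" "conjug g y = y"
      using that tc(1) yc(1) tcen ycen by (simp_all only: conj_eq_self_iff)
    then have "conjug g z = z" using that tc(1) yc(1) by (simp add: z_def conj_hom)
    then show ?thesis using that zc by (metis conj_eq_self_iff)
  qed
  have zpow: "z [^] (k::nat) = t [^] k \<otimes> y [^] k" for k
    unfolding z_def by (rule pow_mult_distrib[OF ycen[OF tc(1)] tc(1) yc(1)])
  have yself: "y \<in> cyc y" using self_mem_cyc[OF fin yc(1)] .
  have "z [^] (7::nat) = t" using zpow[of 7] pow7(1)[OF yself] t_pow tc by simp
  moreover have "z [^] (2::nat) \<noteq> \<one>"
  proof
    assume "z [^] (2::nat) = \<one>"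
    moreover have "t [^] (2::nat) = \<one>" using t tc by (simp add: pow_eq_id)
    ultimately have "y [^] (2::nat) = \<one>" using zpow[of 2] yc by simp
    then show False using yc by (simp add: pow_eq_id)
  qed
  moreover have "z [^] (14::nat) = \<one>"
  proof -
    have "y [^] (14::nat) = \<one>" using yc by (simp add: pow_eq_id)
    then show ?thesis using zpow[of 14] t_pow by simp
  qed
  ultimately have z14: "ord z = 14"
  proof -
    assume a: "z [^] (7::nat) = t" "z [^] (2::nat) \<noteq> \<one>" "z [^] (14::nat) = \<one>"
    then have "ord z dvd 14" "\<not> ord z dvd 7" "\<not> ord z dvd 2" using zc tc by (auto simp flip: pow_eq_id)
    moreover have "ord z \<in> {..14}" using \<open>ord z dvd 14\<close> by (simp add: dvd_imp_le)
    moreover have "\<forall>d\<in>{..14::nat}. d dvd 14 \<longrightarrow> \<not> d dvd 7 \<longrightarrow> \<not> d dvd 2 \<longrightarrow> d = 14"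
      by (simp add: atMost_nat_numeral atMost_Suc)
    ultimately show ?thesis by blast
  qed
  obtain h where h: "h \<in> carrier G" "ord h = 3"
    using cauchy[OF fin subgroup_self prime3] o by (auto simp: order_def)
  obtain k where k: "k \<in> {1..12}" "conjug h x = x [^] (k::nat)"
    "k ^ 3 mod 13 = 1 \<longleftrightarrow> h [^] (3::nat) \<in> Cen (carrier G) x"
    using conjug_cyc_13[OF fin xc h(1) conjug_mem_cyc_13[OF fin x c h(1)]] by blast
  have "h [^] (3::nat) = \<one>" using h by (simp add: pow_eq_id)
  then have "k ^ 3 mod 13 = 1" using k xc by (simp add: Cen_def)
  moreover note nat_1_12_cases[OF k(1)]
  ultimately have "k = 1 \<or> k = 3 \<or> k = 9" by (elim disjE) simp_all
  moreover have "k \<noteq> 1"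
  proof
    assume "k = 1"
    then have "conjug h x = x" using k(2) xc by simp
    then have "h \<in> C" using h xc unfolding C_def by (simp only: mem_Cen_iff)
    then have "3 dvd (182::nat)" using ord_dvd_card_subgroup[OF CG, of h] h cC by simp
    then show False by simp
  qed
  ultimately consider "k = 3" | "k = 9" by blast
  then show ?thesis
  proof cases
    case 1
    then show ?thesis using that[of z x h] zc xc h z14 zcen k by blast
  next
    case 2
    \<comment> \<open>The inverse of 9 modulo 13 is 3, so \<open>inv h\<close>, which equals
      \<open>h [^] 2\<close>, has the required multiplier: 9 * 9 = 81 = 3 + 6 * 13.\<close>
    have "conjug (h [^] (2::nat)) x = x [^] (9 ^ 2::nat)"
      using conjug_pow_power[OF h(1) xc(1), of 9 2] k 2 by blast
    also have "\<dots> = x [^] (3::nat)" using pow_mod_13[OF xc, of "9 ^ 2"] by simp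
    finally have "conjug (h [^] (2::nat)) x = x [^] (3::nat)" .
    moreover have "h [^] (2::nat) = inv h"
    proof -
      have "h [^] Suc 2 = \<one>" using h by (simp add: pow_eq_id)
      then show ?thesis using h(1) by (metis inv_equality nat_pow_Suc nat_pow_closed)
    qed
    ultimately show ?thesis using that[of z x "inv h"] zc xc h z14 zcen by simp
  qed
qed

text \<open>All 168 elements of order divisible by 13 have order exactly 13. A nontrivial element of
  order prime to 13 commuting with \<open>x\<close> would produce a proper multiple of 13, so the
  centralizer contains only elements of order 1 and 13, and 13 divides 1092 only once.\<close>

lemma order_1092_cycs_13:
  assumes fin: "finite (carrier G)" and o: "order G = 1092"
    and E13: "card {g \<in> carrier G. 13 dvd ord g} = 168"
    and c: "card (ord_set 13) = 168"
  shows "card (cyc ` ord_set 13) = 14"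
    and "\<And>x. x \<in> ord_set 13 \<Longrightarrow> Cen (carrier G) x = cyc x"
proof -
  show "card (cyc ` ord_set 13) = 14" using card_ord_set[OF fin prime13] c by simp
  have sub: "ord_set 13 \<subseteq> {g \<in> carrier G. 13 dvd ord g}" by (auto simp: ord_set_def)
  have all13: "{g \<in> carrier G. 13 dvd ord g} = ord_set 13"
    using card_subset_eq[OF _ sub] fin E13 c by simp
  fix x assume x: "x \<in> ord_set 13"
  then have xc: "x \<in> carrier G" "ord x = 13" by (auto simp: ord_set_def)
  define C where "C = Cen (carrier G) x"
  have CG: "subgroup C G" unfolding C_def by (rule Cen_subgroup[OF subgroup_self xc(1)])
  have ords: "ord g \<in> {1, 13}" if g: "g \<in> C" for g
  proof -
    have gc: "g \<in> carrier G" "x \<otimes> g = g \<otimes> x" using g by (auto simp: C_def Cen_def)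
    show ?thesis
    proof (cases "13 dvd ord g")
      case True
      then show ?thesis using all13 gc by (auto simp: ord_set_def)
    next
      case False
      define k where "k = ord (x \<otimes> g)"
      have "(x \<otimes> g) [^] k = \<one>" unfolding k_def using gc xc by simp
      then have "((x \<otimes> g) [^] k) [^] ord g = \<one>" by simp
      then have "(x \<otimes> g) [^] (k * ord g) = \<one>" using gc xc by (simp add: nat_pow_pow)
      then have "x [^] (k * ord g) \<otimes> g [^] (k * ord g) = \<one>"
        using pow_mult_distrib[OF gc(2) xc(1) gc(1)] by simp
      moreover have "g [^] (k * ord g) = \<one>" using gc by (simp add: pow_eq_id)
      ultimately have "x [^] (k * ord g) = \<one>" using xc by simp
      then have "13 dvd k * ord g" using xc by (simp add: pow_eq_id)
      then have "13 dvd k" using False prime13 by (metis prime_dvd_multD)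
      then have "x \<otimes> g \<in> ord_set 13" using all13 gc xc unfolding k_def by auto
      then have "(x \<otimes> g) [^] (13::nat) = \<one>" by (auto simp: ord_set_def pow_eq_id)
      then have "x [^] (13::nat) \<otimes> g [^] (13::nat) = \<one>"
        using pow_mult_distrib[OF gc(2) xc(1) gc(1)] by simp
      moreover have "x [^] (13::nat) = \<one>" using xc by (simp add: pow_eq_id)
      ultimately have "g [^] (13::nat) = \<one>" using gc by simp
      then have "ord g dvd 13" using gc by (simp add: pow_eq_id)
      then show ?thesis using prime13 by (metis insertCI prime_nat_iff)
    qed
  qed
  have cop: "coprime q (card C)" if q: "prime q" "q \<noteq> 13" for q
  proof -
    have "\<not> q dvd card C"
    proof
      assume "q dvd card C"
      then obtain w where "w \<in> C" "ord w = q" using cauchy[OF fin CG q(1)] by blast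
      then have "q = 1 \<or> q = 13" using ords by blast
      then show False using q by auto
    qed
    then show ?thesis using q(1) by (rule prime_imp_coprime[rotated])
  qed
  have "coprime (2 * 2 * 3 * 7) (card C)"
    unfolding coprime_mult_left_iff by (intro conjI cop) simp_all
  moreover have "card C dvd (2 * 2 * 3 * 7) * 13"
    using card_subgroup_dvd[OF fin CG subgroup_self] CG subgroup.subset o by (force simp: order_def)
  ultimately have "card C dvd 13" by (metis coprime_commute coprime_dvd_mult_right_iff)
  then have "card C \<le> 13" by (simp add: dvd_imp_le)
  moreover have "cyc x \<subseteq> C"
  proof
    fix w assume "w \<in> cyc x"
    then obtain i where i: "w = x [^] (i::nat)" by (auto simp: cyc_def)
    have "conjug x w = w" using xc by (simp add: i conj_pow conj_eq_self_iff[THEN iffD2])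
    then show "w \<in> C" using xc by (simp add: i C_def Cen_def conj_eq_self_iff)
  qed
  moreover have "finite C" using CG subgroup.subset fin finite_subset by blast
  ultimately have "cyc x = C"
    using card_cyc[OF fin xc(1)] xc card_mono by (metis card_subset_eq le_antisym)
  then show "Cen (carrier G) x = cyc x" by (simp add: C_def)
qed

end

section \<open>The solvable group\<close>

context group
begin

text \<open>Conjugating \<open>x\<close> isolates the exponent of \<open>h\<close>: the other
  factors commute with \<open>x\<close>, and 3 has order 3 modulo 13. The thirteenth power then
  removes \<open>x\<close>, and 13 is coprime to the order 14 of \<open>z\<close>.\<close>

lemma normal_form_eq_one:
  assumes zxh: "z \<in> carrier G" "x \<in> carrier G" "h \<in> carrier G"
    and ords: "ord z = 14" "ord x = 13" "ord h = 3"
    and central: "\<And>g. g \<in> carrier G \<Longrightarrow> z \<otimes> g = g \<otimes> z"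
    and act: "conjug h x = x [^] (3::nat)"
    and ijk: "i < 14" "j < 13" "k < (3::nat)"
    and eq: "z [^] (i::nat) \<otimes> x [^] (j::nat) \<otimes> h [^] k = \<one>"
  shows "i = 0 \<and> j = 0 \<and> k = 0"
proof -
  have cz: "conjug (z [^] i) y = y" if "y \<in> carrier G" for y
  proof -
    have "conjug y z = z" using that zxh central by (metis conj_eq_self_iff)
    then have "conjug y (z [^] i) = z [^] i" using that zxh by (simp add: conj_pow)
    then show ?thesis using that zxh by (metis conj_eq_self_iff nat_pow_closed)
  qed
  have cx: "conjug (x [^] j) (x [^] n) = x [^] n" for n :: nat
    using zxh by (simp add: conj_eq_self_iff nat_pow_mult add.commute)
  have "x = conjug (z [^] i \<otimes> x [^] j \<otimes> h [^] k) x" using zxh by (simp add: eq)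
  also have "\<dots> = conjug (z [^] i) (conjug (x [^] j) (conjug (h [^] k) x))"
    using zxh by (simp add: conj_mult)
  also have "conjug (h [^] k) x = x [^] (3 ^ k :: nat)"
    using conjug_pow_power[OF zxh(3,2) act] .
  also have "conjug (z [^] i) (conjug (x [^] j) (x [^] (3 ^ k :: nat))) = x [^] (3 ^ k :: nat)"
    using zxh by (simp add: cx cz)
  finally have "x [^] (1::nat) = x [^] (3 ^ k mod 13 :: nat)"
    using zxh pow_mod_13[OF zxh(2) ords(2)] by simp
  then have "3 ^ k mod 13 = (1::nat)"
    using pow_eq_13_iff[OF zxh(2) ords(2), of 1 "3 ^ k mod 13"] by simp
  moreover have "k = 0 \<or> k = 1 \<or> k = 2" using ijk by auto
  ultimately have k: "k = 0" by (elim disjE) simp_all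
  then have zx: "z [^] i \<otimes> x [^] j = \<one>" using eq zxh by simp
  have "(z [^] i \<otimes> x [^] j) [^] (13::nat) = (z [^] i) [^] (13::nat) \<otimes> (x [^] j) [^] (13::nat)"
    using zxh cz[of "x [^] j"] by (intro pow_mult_distrib) (simp_all add: conj_eq_self_iff)
  moreover have "(x [^] j) [^] (13::nat) = \<one>"
    using zxh ords by (simp add: nat_pow_pow pow_eq_id)
  ultimately have "z [^] (i * 13) = \<one>" using zx zxh by (simp add: nat_pow_pow)
  then have "14 dvd i * 13" using zxh ords by (simp add: pow_eq_id)
  then have i: "i = 0" using ijk by presburger
  then have "x [^] j = \<one>" using zx zxh by simp
  then have "j = 0" using pow_eq_13_iff[OF zxh(2) ords(2), of j 0] ijk by simp
  then show ?thesis using i k by simp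
qed

text \<open>The triple \<open>(i, j, k)\<close> is sent to the product of the powers of
  \<open>z\<close>, \<open>x\<close> and \<open>h\<close>. Moving a power of \<open>h\<close> past a
  power of \<open>x\<close> multiplies the exponent of \<open>x\<close> by \<open>3 ^ k\<close>, the
  multiplication rule of \<open>Z13_Z3\<close>; the kernel is trivial, and 14 * 13 * 3 = 546 gives
  surjectivity.\<close>

lemma iso_Z14_Z13_Z3:
  assumes fin: "finite (carrier G)" and o: "order G = 546"
    and zxh: "z \<in> carrier G" "x \<in> carrier G" "h \<in> carrier G"
    and ords: "ord z = 14" "ord x = 13" "ord h = 3"
    and central: "\<And>g. g \<in> carrier G \<Longrightarrow> z \<otimes> g = g \<otimes> z"
    and act: "conjug h x = x [^] (3::nat)"
  shows "G \<cong> integer_mod_group 14 \<times>\<times> Z13_Z3"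
proof -
  let ?H = "integer_mod_group 14 \<times>\<times> Z13_Z3"
  define \<phi> where "\<phi> = (\<lambda>(i::int, j::int, k::int). z [^] nat i \<otimes> x [^] nat j \<otimes> h [^] nat k)"
  have grpH: "group ?H" by (intro DirProd_group group_Z13_Z3) simp
  have carH: "carrier ?H = {0..<14} \<times> {0..<13} \<times> {0..<3}"
    by (simp add: carrier_Z13_Z3 carrier_integer_mod_group)
  have pow_mod: "w [^] (n mod ord w) = w [^] n" if "w \<in> carrier G" for w and n :: nat
  proof -
    have "int (ord w) dvd int n - int (n mod ord w)" by (metis dvd_minus_mod of_nat_mod)
    then have "w [^] int (n mod ord w) = w [^] int n" using that by (metis int_pow_eq)
    then show ?thesis by (simp only: int_pow_int)
  qed
  have \<phi>: "\<phi> (int i, int j, int k) = z [^] i \<otimes> x [^] j \<otimes> h [^] k" for i j k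
    by (simp add: \<phi>_def)
  have hom: "\<phi> (a \<otimes>\<^bsub>?H\<^esub> b) = \<phi> a \<otimes> \<phi> b" if ab: "a \<in> carrier ?H" "b \<in> carrier ?H" for a b
  proof -
    obtain i j k where a: "a = (int i, int j, int k)"
      using ab(1) unfolding carH by (auto elim!: nonneg_int_cases)
    obtain i' j' k' where b: "b = (int i', int j', int k')"
      using ab(2) unfolding carH by (auto elim!: nonneg_int_cases)
    have "a \<otimes>\<^bsub>?H\<^esub> b = (int ((i + i') mod 14), int ((j + 3 ^ k * j') mod 13), int ((k + k') mod 3))"
      unfolding a b by (simp add: mult_Z13_Z3 zmod_int)
    then have 1: "\<phi> (a \<otimes>\<^bsub>?H\<^esub> b) = z [^] (i + i') \<otimes> x [^] (j + 3 ^ k * j') \<otimes> h [^] (k + k')"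
      using pow_mod[OF zxh(1), of "i + i'"] pow_mod[OF zxh(2), of "j + 3 ^ k * j'"]
        pow_mod[OF zxh(3), of "k + k'"] ords by (simp add: \<phi>)
    define Z where "Z = z [^] i'"
    define X where "X = x [^] j'"
    define W where "W = h [^] k"
    have c: "Z \<in> carrier G" "X \<in> carrier G" "W \<in> carrier G" using zxh by (auto simp: Z_def X_def W_def)
    have comZ: "y \<otimes> Z = Z \<otimes> y" if "y \<in> carrier G" for y
    proof -
      have "conjug y z = z" using that zxh central by (metis conj_eq_self_iff)
      then have "conjug y Z = Z" using that zxh by (simp add: Z_def conj_pow)
      then show ?thesis using that c by (metis conj_eq_self_iff)
    qed
    have "conjug W X = x [^] (3 ^ k * j' :: nat)"
      using conjug_pow_power[OF zxh(3,2) act, of k] zxh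
      by (simp add: W_def X_def conj_pow nat_pow_pow)
    then have comX: "W \<otimes> X = x [^] (3 ^ k * j') \<otimes> W"
      using c zxh by (metis conjug_def inv_solve_right m_closed nat_pow_closed)
    have "\<phi> a \<otimes> \<phi> b = z [^] i \<otimes> (x [^] j \<otimes> W \<otimes> Z) \<otimes> X \<otimes> h [^] k'"
      unfolding a b \<phi> using zxh c by (simp add: m_assoc Z_def X_def W_def)
    also have "x [^] j \<otimes> W \<otimes> Z = Z \<otimes> (x [^] j \<otimes> W)" using comZ c zxh by simp
    also have "z [^] i \<otimes> (Z \<otimes> (x [^] j \<otimes> W)) \<otimes> X \<otimes> h [^] k' = z [^] i \<otimes> Z \<otimes> x [^] j \<otimes> (W \<otimes> X) \<otimes> h [^] k'"
      using c zxh by (simp add: m_assoc)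
    also have "\<dots> = (z [^] i \<otimes> Z) \<otimes> (x [^] j \<otimes> x [^] (3 ^ k * j')) \<otimes> (W \<otimes> h [^] k')"
      unfolding comX using c zxh by (simp add: m_assoc)
    also have "\<dots> = \<phi> (a \<otimes>\<^bsub>?H\<^esub> b)"
      unfolding 1 Z_def W_def using zxh by (simp add: nat_pow_mult)
    finally show ?thesis by simp
  qed
  have closed: "\<phi> a \<in> carrier G" for a
    using zxh by (auto simp: \<phi>_def split: prod.split)
  interpret gh: group_hom ?H G \<phi>
    by (intro group_hom.intro group_hom_axioms.intro grpH is_group homI closed hom)
  have inj: "inj_on \<phi> (carrier ?H)"
  proof -
    have "a = \<one>\<^bsub>?H\<^esub>" if a: "a \<in> carrier ?H" "\<phi> a = \<one>" for a
    proof -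
      obtain i j k where ijk: "a = (int i, int j, int k)" "i < 14" "j < 13" "k < 3"
        using a(1) unfolding carH by (auto elim!: nonneg_int_cases)
      then show ?thesis
        using normal_form_eq_one[OF zxh ords central act ijk(2-4)] a(2)
        by (simp add: \<phi> one_Z13_Z3)
    qed
    then show ?thesis using gh.inj_on_one_iff by blast
  qed
  have "card (\<phi> ` carrier ?H) = card (carrier G)"
    using card_image[OF inj] o unfolding carH by (simp add: order_def card_cartesian_product)
  moreover have "\<phi> ` carrier ?H \<subseteq> carrier G" using closed by blast
  ultimately have "\<phi> ` carrier ?H = carrier G" using fin by (simp add: card_subset_eq)
  then have "\<phi> \<in> iso ?H G" using inj gh.homh by (simp add: iso_def bij_betw_def)
  then have "?H \<cong> G" by (auto simp: is_iso_def)
  then show ?thesis using group.iso_sym[OF grpH] by blast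
qed

end

lemma pow_DirProd:
  "(a, b) [^]\<^bsub>G \<times>\<times> H\<^esub> (n::nat) = (a [^]\<^bsub>G\<^esub> n, b [^]\<^bsub>H\<^esub> n)"
  by (induction n) (simp_all add: nat_pow_def)

lemma snd_pow_Z13_Z3: "snd (g [^]\<^bsub>Z13_Z3\<^esub> (n::nat)) = (int n * snd g) mod 3"
proof (induction n)
  case (Suc n)
  then show ?case
    by (cases "g [^]\<^bsub>Z13_Z3\<^esub> n"; cases g) (simp add: mult_Z13_Z3 mod_simps algebra_simps)
qed (simp add: one_Z13_Z3)

lemma pow_Z13_Z3: "(x, 0) [^]\<^bsub>Z13_Z3\<^esub> (n::nat) = ((int n * x) mod 13, 0)"
  by (induction n) (simp_all add: one_Z13_Z3 mult_Z13_Z3 mod_simps algebra_simps)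

lemma pow_3_Z13_Z3:
  assumes "k = 1 \<or> k = 2" shows "(x, k) [^]\<^bsub>Z13_Z3\<^esub> (3::nat) = \<one>\<^bsub>Z13_Z3\<^esub>"
proof -
  \<comment> \<open>The cube sums the powers of the multiplier: 1 + 3 + 9 = 13 for 3 and 1 + 9 + 81
    = 91 for 9, both multiples of 13.\<close>
  have "(x, 1) [^]\<^bsub>Z13_Z3\<^esub> (3::nat) = ((13 * x) mod 13, 0)"
    "(x, 2) [^]\<^bsub>Z13_Z3\<^esub> (3::nat) = ((91 * x) mod 13, 0)"
    by (simp_all add: numeral_3_eq_3 one_Z13_Z3 mult_Z13_Z3 mod_simps algebra_simps)
  moreover have "(13 * x) mod 13 = 0" "(91 * x) mod 13 = 0" by presburger+
  ultimately show ?thesis using assms by (auto simp: one_Z13_Z3)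
qed

lemma Exp_rho_Z14_Z13_Z3: "Exp_rho (integer_mod_group 14 \<times>\<times> Z13_Z3) = {168, 273, 364, 468}"
proof -
  let ?H = "integer_mod_group 14 \<times>\<times> Z13_Z3"
  interpret H: group ?H by (intro DirProd_group group_Z13_Z3) simp
  interpret F: group Z13_Z3 by (rule group_Z13_Z3)
  have carH: "carrier ?H = {0..<14} \<times> {0..<13} \<times> {0..<3}"
    by (simp add: carrier_Z13_Z3 carrier_integer_mod_group)
  have fin: "finite (carrier ?H)" unfolding carH by simp
  have o: "order ?H = 546" unfolding order_def carH by (simp add: card_cartesian_product)
  \<comment> \<open>546 is squarefree, so \<open>p\<close> divides the order of an element exactly
    when its power with exponent 546 / \<open>p\<close> is nontrivial. For 2 and 7 this exponent is
    a multiple of 39 and kills the factor \<open>Z13_Z3\<close>; for 3 and 13 it is a multiple of 14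
    and kills the cyclic factor.\<close>
  have ord_iff: "p dvd H.ord g \<longleftrightarrow> g [^]\<^bsub>?H\<^esub> m \<noteq> \<one>\<^bsub>?H\<^esub>"
    if g: "g \<in> carrier ?H" and p: "prime p" "546 = p * m" "\<not> p dvd m" for g p m
  proof
    assume "p dvd H.ord g"
    then show "g [^]\<^bsub>?H\<^esub> m \<noteq> \<one>\<^bsub>?H\<^esub>"
      using p(3) g H.pow_eq_id dvd_trans by blast
  next
    assume "g [^]\<^bsub>?H\<^esub> m \<noteq> \<one>\<^bsub>?H\<^esub>"
    then have "\<not> H.ord g dvd m" using g H.pow_eq_id by blast
    moreover have "H.ord g dvd p * m" using H.ord_dvd_group_order[OF g] o p by simp
    ultimately show "p dvd H.ord g"
      using p(1) by (metis coprime_commute coprime_dvd_mult_right_iff prime_imp_coprime)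
  qed
  have pow39: "g [^]\<^bsub>Z13_Z3\<^esub> (39 * n) = \<one>\<^bsub>Z13_Z3\<^esub>" if "g \<in> carrier Z13_Z3" for g and n :: nat
    using that F.ord_dvd_group_order[OF that] by (simp add: F.pow_eq_id order_Z13_Z3)
  have "{g \<in> carrier ?H. 2 dvd H.ord g} = {1, 3, 5, 7, 9, 11, 13} \<times> {0..<13} \<times> {0..<3}"
  proof -
    have "2 dvd H.ord (i, g) \<longleftrightarrow> (273 * i) mod 14 \<noteq> 0"
      if "(i, g) \<in> carrier ?H" for i g
      using ord_iff[OF that, of 2 273] pow39[of g 7] that by (simp add: pow_DirProd)
    moreover have "\<forall>i\<in>{0..<14::int}. (273 * i) mod 14 \<noteq> 0 \<longleftrightarrow> i \<in> {1, 3, 5, 7, 9, 11, 13}"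
      by code_simp
    ultimately show ?thesis unfolding carH by auto
  qed
  then have E2: "card {g \<in> carrier ?H. 2 dvd H.ord g} = 273" by (simp add: card_cartesian_product)
  have "{g \<in> carrier ?H. 7 dvd H.ord g} = ({0..<14} - {0, 7}) \<times> {0..<13} \<times> {0..<3}"
  proof -
    have "7 dvd H.ord (i, g) \<longleftrightarrow> (78 * i) mod 14 \<noteq> 0"
      if "(i, g) \<in> carrier ?H" for i g
      using ord_iff[OF that, of 7 78] pow39[of g 2] that by (simp add: pow_DirProd)
    moreover have "\<forall>i\<in>{0..<14::int}. (78 * i) mod 14 \<noteq> 0 \<longleftrightarrow> i \<notin> {0, 7}"
      by code_simp
    ultimately show ?thesis unfolding carH by auto
  qed
  then have E7: "card {g \<in> carrier ?H. 7 dvd H.ord g} = 468"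
    by (simp add: card_cartesian_product card_Diff_subset)
  have k_cases: "k = 0 \<or> k = 1 \<or> k = 2" if "k \<in> {0..<3}" for k :: int using that by auto
  have "{g \<in> carrier ?H. 3 dvd H.ord g} = {0..<14} \<times> {0..<13} \<times> {1, 2}"
  proof -
    have "3 dvd H.ord (i, x, k) \<longleftrightarrow> k \<noteq> 0" if g: "(i, x, k) \<in> carrier ?H" for i x k
    proof -
      have "(182 * i) mod 14 = 0" by presburger
      then have "3 dvd H.ord (i, x, k) \<longleftrightarrow> (x, k) [^]\<^bsub>Z13_Z3\<^esub> (182::nat) \<noteq> (0, 0)"
        using ord_iff[OF g, of 3 182] by (simp add: pow_DirProd one_Z13_Z3)
      also have "\<dots> \<longleftrightarrow> k \<noteq> 0"
      proof (cases "k = 0")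
        case True
        have "(182 * x) mod 13 = 0" by presburger
        then show ?thesis using True by (simp add: pow_Z13_Z3)
      next
        case False
        then have "(182 * k) mod 3 \<noteq> 0" using k_cases[of k] g unfolding carH by auto
        then have "snd ((x, k) [^]\<^bsub>Z13_Z3\<^esub> (182::nat)) \<noteq> 0" by (simp add: snd_pow_Z13_Z3)
        then show ?thesis using False by auto
      qed
      finally show ?thesis .
    qed
    then show ?thesis unfolding carH by auto
  qed
  then have E3: "card {g \<in> carrier ?H. 3 dvd H.ord g} = 364" by (simp add: card_cartesian_product)
  have "{g \<in> carrier ?H. 13 dvd H.ord g} = {0..<14} \<times> {1..<13} \<times> {0}"
  proof -
    have "13 dvd H.ord (i, x, k) \<longleftrightarrow> x \<noteq> 0 \<and> k = 0" if g: "(i, x, k) \<in> carrier ?H" for i x k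
    proof -
      have "(42 * i) mod 14 = 0" by presburger
      then have "13 dvd H.ord (i, x, k) \<longleftrightarrow> (x, k) [^]\<^bsub>Z13_Z3\<^esub> (42::nat) \<noteq> (0, 0)"
        using ord_iff[OF g, of 13 42] by (simp add: pow_DirProd one_Z13_Z3)
      also have "\<dots> \<longleftrightarrow> x \<noteq> 0 \<and> k = 0"
      proof (cases "k = 0")
        case True
        have "\<forall>x\<in>{0..<13::int}. (42 * x) mod 13 = 0 \<longleftrightarrow> x = 0" by code_simp
        moreover have "x \<in> {0..<13}" using g unfolding carH by simp
        ultimately have "(42 * x) mod 13 = 0 \<longleftrightarrow> x = 0" by (rule bspec)
        then show ?thesis using True by (simp add: pow_Z13_Z3)
      next
        case False
        have gc: "(x, k) \<in> carrier Z13_Z3" using g unfolding carH carrier_Z13_Z3 by simp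
        have "(x, k) [^]\<^bsub>Z13_Z3\<^esub> (3::nat) = \<one>\<^bsub>Z13_Z3\<^esub>"
          using False k_cases[of k] g pow_3_Z13_Z3 unfolding carH by auto
        then have "F.ord (x, k) dvd 3" using F.pow_eq_id[OF gc] by blast
        moreover have "3 dvd (42::nat)" by simp
        ultimately have "F.ord (x, k) dvd 42" by (rule dvd_trans)
        then have "(x, k) [^]\<^bsub>Z13_Z3\<^esub> (42::nat) = (0, 0)"
          using F.pow_eq_id[OF gc] one_Z13_Z3 by metis
        then show ?thesis using False by simp
      qed
      finally show ?thesis .
    qed
    then show ?thesis unfolding carH by auto
  qed
  then have E13: "card {g \<in> carrier ?H. 13 dvd H.ord g} = 168" by (simp add: card_cartesian_product)
  have "\<not> 4 dvd H.ord g" if "g \<in> carrier ?H" for g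
  proof
    assume "4 dvd H.ord g"
    then have "4 dvd (546::nat)" using H.ord_dvd_group_order[OF that] o dvd_trans by metis
    then show False by simp
  qed
  then show ?thesis using H.Exp_rho_eqI[OF fin _ _ E2 E3 E7 E13] o by simp
qed

section \<open>The action on the fourteen Sylow 13-subgroups\<close>

locale sylow13_action = group G for G (structure) +
  assumes fin: "finite (carrier G)" and order: "order G = 1092"
    and card_Syl: "card (cyc ` ord_set 13) = 14"
    and Cen_eq_cyc: "\<And>x. x \<in> ord_set 13 \<Longrightarrow> Cen (carrier G) x = cyc x"
begin

definition Syl :: "'a set set" where "Syl = cyc ` ord_set 13"

definition act :: "'a \<Rightarrow> 'a set \<Rightarrow> 'a set" where "act g P = conjug g ` P"

lemma ord_setD: "x \<in> ord_set 13 \<Longrightarrow> x \<in> carrier G" "x \<in> ord_set 13 \<Longrightarrow> ord x = 13"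
  by (auto simp: ord_set_def)

lemma finite_Syl: "finite Syl"
  using fin by (simp add: Syl_def ord_set_def)

lemma Syl_subset: "P \<in> Syl \<Longrightarrow> P \<subseteq> carrier G"
  using cyc_subset ord_setD by (auto simp: Syl_def)

lemma act_cyc:
  assumes "g \<in> carrier G" "y \<in> carrier G" shows "act g (cyc y) = cyc (conjug g y)"
  using assms by (auto simp: act_def cyc_def image_image conj_pow)

lemma act_Syl [simp]: "g \<in> carrier G \<Longrightarrow> P \<in> Syl \<Longrightarrow> act g P \<in> Syl"
  by (auto simp: Syl_def act_cyc ord_set_def)

lemma act_one [simp]: "P \<in> Syl \<Longrightarrow> act \<one> P = P"
  using Syl_subset[of P] by (force simp: act_def)

lemma act_mult:
  assumes "g \<in> carrier G" "h \<in> carrier G" "P \<in> Syl"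
  shows "act (g \<otimes> h) P = act g (act h P)"
proof -
  have "conjug (g \<otimes> h) ` P = (\<lambda>u. conjug g (conjug h u)) ` P"
    using assms Syl_subset[of P] by (intro image_cong) (auto simp: conj_mult)
  then show ?thesis by (simp add: act_def image_image)
qed

lemma act_inj: "g \<in> carrier G \<Longrightarrow> P \<in> Syl \<Longrightarrow> Q \<in> Syl \<Longrightarrow> act g P = act g Q \<longleftrightarrow> P = Q"
  by (metis act_mult act_one inv_closed l_inv)

lemma conjug_pow_self: "x \<in> carrier G \<Longrightarrow> conjug (x [^] (i::nat)) x = x"
  using nat_pow_Suc[of x i] nat_pow_Suc2[of x i] by (simp only: conj_eq_self_iff nat_pow_closed)

lemma act_pow_self: "x \<in> ord_set 13 \<Longrightarrow> act (x [^] (i::nat)) (cyc x) = cyc x"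
  using ord_setD by (simp add: act_cyc conjug_pow_self)

text \<open>The multiplier of \<open>x\<close> on \<open>Q\<close> satisfies
  \<open>k ^ 13 = 1\<close> modulo 13, hence is 1. So \<open>x\<close> lies in the centralizer of a
  generator of \<open>Q\<close>, which is \<open>Q\<close> itself.\<close>

lemma fixed_imp_eq:
  assumes x: "x \<in> ord_set 13" and Q: "Q \<in> Syl" and fixed: "act x Q = Q"
  shows "Q = cyc x"
proof -
  note xc = ord_setD[OF x]
  obtain y where y: "y \<in> ord_set 13" "Q = cyc y" using Q by (auto simp: Syl_def)
  note yc = ord_setD[OF y(1)]
  have "conjug x y \<in> cyc y"
    using fixed self_mem_cyc[OF fin yc(1)] y(2) by (auto simp: act_def)
  then obtain k where k: "k \<in> {1..12}" "conjug x y = y [^] (k::nat)"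
    "k ^ 13 mod 13 = 1 \<longleftrightarrow> x [^] (13::nat) \<in> Cen (carrier G) y"
    using conjug_cyc_13[OF fin yc xc(1)] by blast
  have "x [^] (13::nat) = \<one>" using xc by (simp add: pow_eq_id)
  then have k13: "k ^ 13 mod 13 = 1" using k(3) yc by (simp add: Cen_def)
  have "k = 1" using nat_1_12_cases[OF k(1)] k13 by (elim disjE) simp_all
  then have "conjug x y = y" using k(2) yc by simp
  then have "x \<in> cyc y" using Cen_eq_cyc[OF y(1)] mem_Cen_iff[OF xc(1) yc(1)] by blast
  moreover have "x \<noteq> \<one>" using xc by auto
  ultimately show ?thesis using cyc_eq[OF fin yc(1)] yc prime13 y(2) by simp
qed

lemma pow_in_ord_set:
  assumes x: "x \<in> ord_set 13" and i: "0 < i" "i < 13"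
  shows "x [^] (i::nat) \<in> ord_set 13" and "cyc (x [^] i) = cyc x"
proof -
  note xc = ord_setD[OF x]
  have "x [^] i \<noteq> \<one>" using pow_eq_13_iff[OF xc i(2), of 0] i by simp
  moreover have "x [^] i \<in> cyc x" using mem_cyc_iff[OF fin xc(1)] by blast
  moreover have "prime (ord x)" using xc(2) prime13 by simp
  ultimately have "cyc (x [^] i) = cyc x" "ord (x [^] i) = ord x"
    using cyc_eq[OF fin xc(1)] by blast+
  then show "x [^] i \<in> ord_set 13" "cyc (x [^] i) = cyc x"
    using xc by (simp_all add: ord_set_def)
qed

lemma act_pow_inj:
  assumes x: "x \<in> ord_set 13" and Q: "Q \<in> Syl" "Q \<noteq> cyc x"
  shows "inj_on (\<lambda>i::nat. act (x [^] i) Q) {..<13}"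
proof (rule linorder_inj_onI)
  fix i j :: nat assume ij: "i < j" "i \<in> {..<13}" "j \<in> {..<13}"
  show "act (x [^] i) Q \<noteq> act (x [^] j) Q"
  proof
    assume eq: "act (x [^] i) Q = act (x [^] j) Q"
    have "x [^] j = x [^] i \<otimes> x [^] (j - i)"
      using ij ord_setD[OF x] by (simp add: nat_pow_mult)
    then have "act (x [^] i) (act (x [^] (j - i)) Q) = act (x [^] i) Q"
      using eq Q ord_setD[OF x] by (simp add: act_mult)
    then have "act (x [^] (j - i)) Q = Q"
      using Q ord_setD[OF x] by (simp add: act_inj)
    then have "Q = cyc (x [^] (j - i))"
      using fixed_imp_eq[OF pow_in_ord_set(1)[OF x, of "j - i"] Q(1)] ij by simp
    then show False using pow_in_ord_set(2)[OF x, of "j - i"] ij Q by simp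
  qed
qed auto

text \<open>Two powers of \<open>x\<close> agreeing on \<open>Q\<close> would give a generator of
  \<open>cyc x\<close> fixing \<open>Q\<close>. So the 13 images are distinct and fill the 13
  remaining subgroups.\<close>

lemma act_pow_image:
  assumes x: "x \<in> ord_set 13" and Q: "Q \<in> Syl" "Q \<noteq> cyc x"
  shows "(\<lambda>i::nat. act (x [^] i) Q) ` {..<13} = Syl - {cyc x}"
proof (rule card_subset_eq)
  have cx: "cyc x \<in> Syl" using x by (simp add: Syl_def)
  show "finite (Syl - {cyc x})" using finite_Syl by simp
  show "(\<lambda>i::nat. act (x [^] i) Q) ` {..<13} \<subseteq> Syl - {cyc x}"
  proof (rule image_subsetI)
    fix i :: nat
    have xi: "x [^] i \<in> carrier G" using ord_setD[OF x] by simp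
    then have "act (x [^] i) Q \<noteq> act (x [^] i) (cyc x)" using act_inj[OF xi Q(1) cx] Q(2) by simp
    then show "act (x [^] i) Q \<in> Syl - {cyc x}"
      using act_pow_self[OF x, of i] act_Syl[OF xi Q(1)] by simp
  qed
  show "card ((\<lambda>i::nat. act (x [^] i) Q) ` {..<13}) = card (Syl - {cyc x})"
    using card_image[OF act_pow_inj[OF assms]] card_Syl cx by (simp add: Syl_def)
qed

lemma transitive_off:
  assumes "A \<in> Syl" "Q \<in> Syl" "R \<in> Syl" "Q \<noteq> A" "R \<noteq> A"
  obtains g where "g \<in> carrier G" "act g A = A" "act g Q = R"
proof -
  obtain x where x: "x \<in> ord_set 13" "A = cyc x" using assms(1) by (auto simp: Syl_def)
  have "R \<in> (\<lambda>i::nat. act (x [^] i) Q) ` {..<13}" using act_pow_image[OF x(1), of Q] assms x by auto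
  then obtain i :: nat where "R = act (x [^] i) Q" by blast
  then show ?thesis using that[of "x [^] i"] act_pow_self[OF x(1)] x ord_setD by simp
qed

lemma transitive2:
  assumes "A \<in> Syl" "B \<in> Syl" "A \<noteq> B" "A' \<in> Syl" "B' \<in> Syl" "A' \<noteq> B'"
  obtains g where "g \<in> carrier G" "act g A = A'" "act g B = B'"
proof -
  \<comment> \<open>A third subgroup \<open>C\<close> serves as a pivot: the stabilizer of
    \<open>C\<close> carries \<open>A\<close> to \<open>A'\<close>, and the stabilizer of
    \<open>A'\<close> then corrects the image of \<open>B\<close>.\<close>
  have "card {A, A'} < card Syl" using card_Syl by (simp add: Syl_def card_insert_if)
  then have "\<not> Syl \<subseteq> {A, A'}" using card_mono[of "{A, A'}" Syl] by auto
  then obtain C where C: "C \<in> Syl" "C \<noteq> A" "C \<noteq> A'" by auto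
  obtain g where g: "g \<in> carrier G" "act g A = A'"
    using transitive_off[OF C(1) assms(1,4)] C by metis
  then have "act g B \<noteq> A'" "act g B \<in> Syl" using assms act_inj by auto
  then obtain h where h: "h \<in> carrier G" "act h A' = A'" "act h (act g B) = B'"
    using transitive_off[OF assms(4) _ assms(5)] assms(6) by metis
  show ?thesis
    using that[of "h \<otimes> g"] g h assms by (simp add: act_mult)
qed

text \<open>By double transitivity all 14 * 13 ordered pairs occur as images of
  \<open>(A, B)\<close>, each for one coset of the stabilizer, and 1092 = 14 * 13 * 6.\<close>

lemma card_stabilizer2:
  assumes AB: "A \<in> Syl" "B \<in> Syl" "A \<noteq> B"
  shows "card {g \<in> carrier G. act g A = A \<and> act g B = B} = 6"
proof -
  define K where "K = {g \<in> carrier G. act g A = A \<and> act g B = B}"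
  define f where "f g = (act g A, act g B)" for g
  have img: "f ` carrier G = Sigma Syl (\<lambda>P. Syl - {P})"
  proof
    have "f g \<in> Sigma Syl (\<lambda>P. Syl - {P})" if "g \<in> carrier G" for g
      using AB act_inj[OF that AB(1,2)] that by (simp add: f_def)
    then show "f ` carrier G \<subseteq> Sigma Syl (\<lambda>P. Syl - {P})" by blast
    show "Sigma Syl (\<lambda>P. Syl - {P}) \<subseteq> f ` carrier G"
    proof
      fix p assume "p \<in> Sigma Syl (\<lambda>P. Syl - {P})"
      then obtain P Q where p: "p = (P, Q)" "P \<in> Syl" "Q \<in> Syl" "P \<noteq> Q" by auto
      obtain g where "g \<in> carrier G" "act g A = P" "act g B = Q"
        using transitive2[OF AB p(2-4)] by blast
      then show "p \<in> f ` carrier G" using p by (auto simp: f_def)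
    qed
  qed
  have "card (carrier G) = card (f ` carrier G) * card K"
  proof (rule card_eq_card_image_mult[OF fin])
    fix y assume "y \<in> f ` carrier G"
    then obtain k where k: "k \<in> carrier G" "y = f k" by blast
    have "bij_betw (\<lambda>c. k \<otimes> c) K {g \<in> carrier G. f g = y}"
    proof (rule bij_betw_byWitness[where f' = "\<lambda>h. inv k \<otimes> h"])
      show "\<forall>a\<in>K. inv k \<otimes> (k \<otimes> a) = a" "\<forall>a\<in>{g \<in> carrier G. f g = y}. k \<otimes> (inv k \<otimes> a) = a"
        using k by (auto simp: K_def simp flip: m_assoc)
      show "(\<otimes>) k ` K \<subseteq> {g \<in> carrier G. f g = y}"
        using k AB by (auto simp: K_def f_def act_mult)
      have "act (inv k) (act k P) = P" if "P \<in> Syl" for P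
        using that k by (simp flip: act_mult)
      then show "(\<otimes>) (inv k) ` {g \<in> carrier G. f g = y} \<subseteq> K"
        using k AB by (auto simp: K_def f_def act_mult)
    qed
    then show "card {g \<in> carrier G. f g = y} = card K" by (simp add: bij_betw_same_card)
  qed
  moreover have "card (Sigma Syl (\<lambda>P. Syl - {P})) = 14 * 13"
    using finite_Syl card_Syl by (simp add: card_SigmaI Syl_def)
  ultimately have "card K = 6" using order by (simp add: img order_def)
  then show ?thesis by (simp add: K_def)
qed

lemma stabilizer2_subgroup:
  assumes "A \<in> Syl" "B \<in> Syl"
  shows "subgroup {g \<in> carrier G. act g A = A \<and> act g B = B} G"
proof (rule subgroupI)
  have "\<one> \<in> {g \<in> carrier G. act g A = A \<and> act g B = B}" using assms by simp
  then show "{g \<in> carrier G. act g A = A \<and> act g B = B} \<noteq> {}" by blast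
  fix a assume a: "a \<in> {g \<in> carrier G. act g A = A \<and> act g B = B}"
  have "act (inv a) (act a P) = P" if "P \<in> Syl" for P
    using that a by (simp flip: act_mult)
  from this[OF assms(1)] this[OF assms(2)]
  have "act (inv a) A = A" "act (inv a) B = B" using a by simp_all
  then show "inv a \<in> {g \<in> carrier G. act g A = A \<and> act g B = B}" using a by simp
qed (use assms in \<open>auto simp: act_mult\<close>)

end

text \<open>One Sylow subgroup is labelled 13 (the point at infinity), the orbit of a second one under
  a generator of the first is labelled 0 to 12; a permutation is the list of its values.\<close>

definition lcomp :: "nat list \<Rightarrow> nat list \<Rightarrow> nat list" where
  "lcomp a b = map ((!) a) b"

definition perm_add :: "nat \<Rightarrow> nat list" where
  "perm_add j = map (\<lambda>i. (i + j) mod 13) [0..<13] @ [13]"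

definition perm_mult :: "nat \<Rightarrow> nat list" where
  "perm_mult k = map (\<lambda>i. k * i mod 13) [0..<13] @ [13]"

text \<open>The map t -> 1/t of the projective line over the field with 13 elements. Its determinant
  -1 is a square modulo 13, so it belongs to PSL(2,13).\<close>

definition perm_inverse :: "nat list" where
  "perm_inverse = [13, 1, 7, 9, 10, 8, 11, 2, 5, 3, 4, 6, 12, 0]"

text \<open>Generated by t + 1, 4 t and 1/t, where 4 generates the group of squares modulo 13: this
  is PSL(2,13) acting on the projective line, described independently of any abstract group so that
  two groups can be compared through it.\<close>

inductive_set proj_perms :: "nat list set" where
  id: "[0..<14] \<in> proj_perms"
| add1: "L \<in> proj_perms \<Longrightarrow> lcomp (perm_add 1) L \<in> proj_perms"
| mult4: "L \<in> proj_perms \<Longrightarrow> lcomp (perm_mult 4) L \<in> proj_perms"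
| inverse: "L \<in> proj_perms \<Longrightarrow> lcomp perm_inverse L \<in> proj_perms"

definition proj_perm_monoid :: "nat list monoid" where
  "proj_perm_monoid = \<lparr>carrier = proj_perms, monoid.mult = lcomp, one = [0..<14]\<rparr>"

text \<open>The permutation swapping 0 and 13 that maps 1 and 2, representatives of the orbits of
  multiplication by 4, to \<open>a\<close> and \<open>d\<close> and turns multiplication by 4 into multiplication by \<open>k\<close>.\<close>

definition swap_table :: "nat \<Rightarrow> nat \<Rightarrow> nat \<Rightarrow> nat list" where
  "swap_table k a d = (let m = (\<lambda>i. k * i mod 13) in
     [13, a, d, m (m a), m a, m (m (m (m d))), m (m d), m (m (m (m (m d)))), m d,
      m (m (m (m a))), m (m (m (m (m a)))), m (m (m d)), m (m (m a)), 0])"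



definition shift :: "nat \<Rightarrow> nat \<Rightarrow> nat" where
  "shift j t = (if t < 13 then (t + j) mod 13 else t)"




text \<open>The composite of \<open>shift e\<close>, \<open>w\<close>, \<open>shift i\<close>, \<open>w\<close>, \<open>shift 1\<close>, \<open>w\<close> fixes 0 and 13, hence acts on
  the other points as multiplication by a square \<open>r\<close>; its values at 1 and 2 already determine \<open>w\<close>.\<close>

lemma swap_unique:
  assumes w: "w = swap_table k a d" and kad: "k \<in> {4, 10}" "a \<in> {1, 2}" "d \<in> {1..12}"
    and i: "i = 13 - w ! 1" and e: "e = 13 - w ! i"
    and p: "p = w ! shift 1 (w ! 1)" "q = w ! shift i p" "r = shift e q"
    and p': "p' = w ! shift 1 (w ! 2)" "q' = w ! shift i p'" "r' = shift e q'"
    and r: "r \<in> {1, 3, 4, 9, 10, 12}" "r' = 2 * r mod 13"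
    and dist: "distinct w"
  shows "w = perm_inverse"
proof -
  \<comment> \<open>There remain 2 * 2 * 12 = 48 tables, each of which either contradicts a premise
    or is \<open>perm_inverse\<close>.\<close>
  have "k = 4 \<or> k = 10" "a = 1 \<or> a = 2" using kad by simp_all
  with nat_1_12_cases[OF kad(3)] show ?thesis
    by (elim disjE; insert w i e p p' r dist; simp add: swap_table_def perm_inverse_def shift_def)
qed

text \<open>The squares modulo 13 are the successive powers 1, 4, 3, 12, 9, 10 of 4.\<close>

lemma perm_mult_mem:
  assumes "s \<in> {1, 3, 4, 9, 10, 12}" shows "perm_mult s \<in> proj_perms"
proof -
  have step: "perm_mult a \<in> proj_perms \<Longrightarrow> lcomp (perm_mult 4) (perm_mult a) = perm_mult b \<Longrightarrow> perm_mult b \<in> proj_perms" for a b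
    using proj_perms.mult4 by metis
  have "perm_mult 1 = [0..<14]" by (simp add: perm_mult_def upt_rec)
  then have 1: "perm_mult 1 \<in> proj_perms" using proj_perms.id by simp
  have 4: "perm_mult 4 \<in> proj_perms" by (rule step[OF 1]) (simp add: perm_mult_def lcomp_def upt_rec)
  have 3: "perm_mult 3 \<in> proj_perms" by (rule step[OF 4]) (simp add: perm_mult_def lcomp_def upt_rec)
  have 12: "perm_mult 12 \<in> proj_perms" by (rule step[OF 3]) (simp add: perm_mult_def lcomp_def upt_rec)
  have 9: "perm_mult 9 \<in> proj_perms" by (rule step[OF 12]) (simp add: perm_mult_def lcomp_def upt_rec)
  have 10: "perm_mult 10 \<in> proj_perms" by (rule step[OF 9]) (simp add: perm_mult_def lcomp_def upt_rec)
  show ?thesis using assms 1 3 4 9 10 12 by blast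
qed

section \<open>Coordinates on the fourteen subgroups and the permutations that occur\<close>

locale sylow13_coordinates = sylow13_action +
  fixes x P0
  assumes x: "x \<in> ord_set 13" and P0: "P0 \<in> Syl" "P0 \<noteq> cyc x"
begin

definition pt :: "nat \<Rightarrow> 'a set" where
  "pt i = (if i < 13 then act (x [^] i) P0 else cyc x)"

definition \<sigma> :: "'a \<Rightarrow> nat \<Rightarrow> nat" where
  "\<sigma> g i = inv_into {..<14} pt (act g (pt i))"

definition perm :: "'a \<Rightarrow> nat list" where
  "perm g = map (\<sigma> g) [0..<14]"

lemma xc [simp]: "x \<in> carrier G" and ord_x: "ord x = 13"
  using x ord_setD by auto

lemma cyc_x_Syl [simp]: "cyc x \<in> Syl"
  using x by (simp add: Syl_def)

lemma bij_pt: "bij_betw pt {..<14} Syl"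
proof -
  have eq: "{..<14} = insert 13 {..<13::nat}" by auto
  have "inj_on pt {..<13}"
    using act_pow_inj[OF x P0] by (simp add: pt_def inj_on_def)
  moreover have img: "pt ` {..<13} = Syl - {cyc x}"
    using act_pow_image[OF x P0] by (simp add: pt_def image_def)
  moreover have "pt 13 = cyc x" by (simp add: pt_def)
  ultimately show ?thesis
    unfolding eq bij_betw_def by (auto simp: insert_absorb)
qed

lemma pt_Syl [simp]: "i < 14 \<Longrightarrow> pt i \<in> Syl"
  using bij_pt by (auto simp: bij_betw_def)

lemma \<sigma>_less [simp]: "g \<in> carrier G \<Longrightarrow> i < 14 \<Longrightarrow> \<sigma> g i < 14"
  unfolding \<sigma>_def using bij_pt inv_into_into[of "act g (pt i)" pt "{..<14}"]
  by (auto simp: bij_betw_def)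

lemma pt_\<sigma>: "g \<in> carrier G \<Longrightarrow> i < 14 \<Longrightarrow> pt (\<sigma> g i) = act g (pt i)"
  unfolding \<sigma>_def using bij_pt by (auto simp: bij_betw_def f_inv_into_f)

lemma \<sigma>_eqI: "act g (pt i) = pt j \<Longrightarrow> j < 14 \<Longrightarrow> \<sigma> g i = j"
  unfolding \<sigma>_def using bij_pt by (auto simp: bij_betw_def)

lemma \<sigma>_mult: "g \<in> carrier G \<Longrightarrow> h \<in> carrier G \<Longrightarrow> i < 14 \<Longrightarrow> \<sigma> (g \<otimes> h) i = \<sigma> g (\<sigma> h i)"
  by (intro \<sigma>_eqI) (simp_all add: pt_\<sigma> act_mult)

lemma \<sigma>_one: "i < 14 \<Longrightarrow> \<sigma> \<one> i = i"
  by (intro \<sigma>_eqI) simp_all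

lemma \<sigma>_inv: "g \<in> carrier G \<Longrightarrow> i < 14 \<Longrightarrow> \<sigma> (inv g) (\<sigma> g i) = i"
  by (simp flip: \<sigma>_mult add: \<sigma>_one)

lemma \<sigma>_inj: "g \<in> carrier G \<Longrightarrow> i < 14 \<Longrightarrow> j < 14 \<Longrightarrow> \<sigma> g i = \<sigma> g j \<longleftrightarrow> i = j"
  by (metis \<sigma>_inv)

lemma perm_mult_hom: "g \<in> carrier G \<Longrightarrow> h \<in> carrier G \<Longrightarrow> perm (g \<otimes> h) = lcomp (perm g) (perm h)"
  by (simp add: perm_def lcomp_def \<sigma>_mult)

lemma perm_one: "perm \<one> = [0..<14]"
  unfolding perm_def by (rule map_idI) (simp add: \<sigma>_one)

lemma perm_nth: "i < 14 \<Longrightarrow> perm g ! i = \<sigma> g i"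
  by (simp add: perm_def)

lemma perm_eq_iff: "perm g = perm g' \<longleftrightarrow> (\<forall>i<14. \<sigma> g i = \<sigma> g' i)"
  by (auto simp: perm_def)

lemma \<sigma>_pow_x: "i < 14 \<Longrightarrow> \<sigma> (x [^] j) i = shift j i"
proof (rule \<sigma>_eqI)
  assume i: "i < 14"
  show "act (x [^] j) (pt i) = pt (shift j i)"
  proof (cases "i < 13")
    case True
    have "x [^] ((i + j) mod 13) = x [^] j \<otimes> x [^] i"
      using pow_mod_13[OF xc ord_x, of "i + j"] by (simp add: nat_pow_mult add.commute)
    then show ?thesis using True P0 by (simp add: pt_def shift_def act_mult)
  next
    case False
    then show ?thesis using act_pow_self[OF x] by (simp add: pt_def shift_def)
  qed
  show "shift j i < 14" using i by (simp add: shift_def) (use mod_less_divisor[of 13 "i + j"] in linarith)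
qed

lemma \<sigma>_x: "i < 14 \<Longrightarrow> \<sigma> x i = shift 1 i"
  using \<sigma>_pow_x[of i 1] by simp

lemma perm_x: "perm x = perm_add 1"
proof -
  have "[0..<14] = [0..<13] @ [13]" by (simp add: upt_rec)
  then show ?thesis by (simp add: perm_def perm_add_def shift_def \<sigma>_x)
qed

lemma act_iff: "g \<in> carrier G \<Longrightarrow> \<sigma> g 13 = 13 \<longleftrightarrow> act g (cyc x) = cyc x"
  "g \<in> carrier G \<Longrightarrow> \<sigma> g 0 = 0 \<longleftrightarrow> act g P0 = P0"
proof -
  have pts: "pt 13 = cyc x" "pt 0 = P0" using P0 by (simp_all add: pt_def)
  show "g \<in> carrier G \<Longrightarrow> \<sigma> g 13 = 13 \<longleftrightarrow> act g (cyc x) = cyc x"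
    using pt_\<sigma>[of g 13] \<sigma>_eqI[of g 13 13] by (auto simp: pts)
  show "g \<in> carrier G \<Longrightarrow> \<sigma> g 0 = 0 \<longleftrightarrow> act g P0 = P0"
    using pt_\<sigma>[of g 0] \<sigma>_eqI[of g 0 0] by (auto simp: pts)
qed

abbreviation stab :: "'a set" where
  "stab \<equiv> {g \<in> carrier G. act g (cyc x) = cyc x \<and> act g P0 = P0}"

text \<open>The stabilizer has order 6, so the multiplier satisfies \<open>k ^ 6 = 1\<close> and is
  a square modulo 13. Since \<open>g\<close> fixes \<open>P0\<close>, the rule
  \<open>g \<otimes> x [^] i = x [^] (k * i) \<otimes> g\<close> says that the label
  \<open>i\<close> moves to \<open>k * i\<close>.\<close>

lemma stab_perm:
  assumes g: "g \<in> stab"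
  obtains k where "k \<in> {1, 3, 4, 9, 10, 12}" "conjug g x = x [^] k" "perm g = perm_mult k"
proof -
  have gc: "g \<in> carrier G" "act g (cyc x) = cyc x" "act g P0 = P0" using g by auto
  have "conjug g x \<in> cyc x"
    using gc(2) self_mem_cyc[OF fin xc] by (auto simp: act_def)
  then obtain k where k: "k \<in> {1..12}" "conjug g x = x [^] (k::nat)"
    "k ^ 6 mod 13 = 1 \<longleftrightarrow> g [^] (6::nat) \<in> Cen (carrier G) x"
    using conjug_cyc_13[OF fin xc ord_x gc(1)] by blast
  have "ord g dvd 6"
    using ord_dvd_card_subgroup[OF stabilizer2_subgroup g] card_stabilizer2[of "cyc x" P0] P0 by simp
  then have "g [^] (6::nat) = \<one>" using gc by (simp add: pow_eq_id)
  then have "k ^ 6 mod 13 = 1" using k(3) by (simp add: Cen_def)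
  then have Sq: "k \<in> {1, 3, 4, 9, 10, 12}"
    using nat_1_12_cases[OF k(1)] by (elim disjE) simp_all
  have "\<sigma> g i = k * i mod 13" if i: "i < 13" for i
  proof (rule \<sigma>_eqI)
    have "g \<otimes> x [^] i = conjug g (x [^] i) \<otimes> g"
      using gc by (simp add: conjug_def m_assoc)
    also have "conjug g (x [^] i) = x [^] (k * i)"
      using gc k by (simp add: conj_pow nat_pow_pow)
    also have "\<dots> = x [^] (k * i mod 13)" by (rule pow_mod_13[OF xc ord_x])
    finally have "act (g \<otimes> x [^] i) P0 = act (x [^] (k * i mod 13) \<otimes> g) P0" by simp
    then show "act g (pt i) = pt (k * i mod 13)"
      using i gc P0 by (simp add: act_mult pt_def)
    show "k * i mod 13 < 14" using mod_less_divisor[of 13 "k * i"] by linarith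
  qed
  moreover have "\<sigma> g 13 = 13" using act_iff(1) gc by blast
  moreover have "[0..<14] = [0..<13] @ [13]" by (simp add: upt_rec)
  ultimately have "perm g = perm_mult k" by (simp add: perm_def perm_mult_def)
  then show ?thesis using that Sq k by blast
qed

text \<open>An element fixing 13 and 0 multiplies labels by some \<open>k\<close>, and fixing 1
  gives \<open>k = 1\<close>. It then centralizes \<open>x\<close>, so it is a power of
  \<open>x\<close>, and only the trivial power fixes 0.\<close>

lemma perm_inj:
  assumes "g \<in> carrier G" "g' \<in> carrier G" "perm g = perm g'" shows "g = g'"
proof -
  define u where "u = inv g \<otimes> g'"
  have uc: "u \<in> carrier G" using assms by (simp add: u_def)
  have "\<sigma> u i = i" if "i < 14" for i
  proof -
    have "\<sigma> u i = \<sigma> (inv g) (\<sigma> g i)" using assms that by (simp add: u_def \<sigma>_mult perm_eq_iff)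
    then show ?thesis using assms that by (simp add: \<sigma>_inv)
  qed
  then have fix13: "\<sigma> u 13 = 13" and fix0: "\<sigma> u 0 = 0" and fix1: "\<sigma> u 1 = 1" by simp_all
  then have us: "u \<in> stab" using act_iff uc by blast
  then obtain k where k: "k \<in> {1, 3, 4, 9, 10, 12}" "conjug u x = x [^] k" "perm u = perm_mult k"
    using stab_perm by blast
  have "perm u ! 1 = k mod 13" unfolding k(3) by (simp add: perm_mult_def nth_append)
  then have "k mod 13 = 1" using fix1 by (simp add: perm_nth)
  then have "k = 1" using k(1) by auto
  then have "u \<in> Cen (carrier G) x" using k(2) mem_Cen_iff[OF uc xc] by simp
  then obtain i where i: "i < 13" "u = x [^] (i::nat)"
    using Cen_eq_cyc[OF x] ord_x by (auto simp: cyc_def)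
  have "\<sigma> u 0 = i" using \<sigma>_pow_x[of 0 i] i by (simp add: shift_def)
  then have "u = \<one>" using fix0 i by simp
  then have "g \<otimes> u = g" using assms by simp
  moreover have "g \<otimes> u = g'" using assms by (simp add: u_def flip: m_assoc)
  ultimately show ?thesis by simp
qed

text \<open>The stabilizer has six elements, these have distinct permutations, and only six
  permutations are possible.\<close>

lemma obtain_stab:
  assumes "s \<in> {1, 3, 4, 9, 10, 12}"
  obtains g where "g \<in> stab" "perm g = perm_mult s"
proof -
  have sub: "perm ` stab \<subseteq> perm_mult ` {1, 3, 4, 9, 10, 12}"
  proof (rule image_subsetI)
    fix g assume "g \<in> stab"
    then obtain k where "k \<in> {1, 3, 4, 9, 10, 12}" "perm g = perm_mult k" by (rule stab_perm)
    then show "perm g \<in> perm_mult ` {1, 3, 4, 9, 10, 12}" by (simp only: imageI)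
  qed
  have "inj_on perm stab" using perm_inj by (intro inj_onI) simp
  then have "card (perm ` stab) = 6"
    using card_stabilizer2[of "cyc x" P0] P0 by (simp add: card_image)
  moreover have "card (perm_mult ` {1, 3, 4, 9, 10, 12}) \<le> 6"
    using card_image_le[of "{1, 3, 4, 9, 10, 12}" perm_mult] by simp
  ultimately have "perm ` stab = perm_mult ` {1, 3, 4, 9, 10, 12}"
    by (intro card_seteq sub) simp_all
  then have "perm_mult s \<in> perm ` stab" using assms by blast
  then obtain g where "perm_mult s = perm g" "g \<in> stab" by (rule imageE)
  then show ?thesis using that[of g] by simp
qed

text \<open>After exchanging the two points by double transitivity, a multiplication by a square
  moves the value at 1 to the representative of its class: 1 for the squares, 2 for the
  nonsquares.\<close>

lemma obtain_swap:
  obtains w where "w \<in> carrier G" "\<sigma> w 13 = 0" "\<sigma> w 0 = 13" "\<sigma> w 1 \<in> {1, 2}"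
proof -
  obtain v where v: "v \<in> carrier G" "act v (cyc x) = P0" "act v P0 = cyc x"
    using transitive2[of "cyc x" P0 P0 "cyc x"] P0 by auto
  have pts: "pt 13 = cyc x" "pt 0 = P0" using P0 by (simp_all add: pt_def)
  have v0: "\<sigma> v 13 = 0" "\<sigma> v 0 = 13" by (intro \<sigma>_eqI; simp add: pts v)+
  have "\<sigma> v 1 \<noteq> \<sigma> v 13" "\<sigma> v 1 \<noteq> \<sigma> v 0" "\<sigma> v 1 < 14" using v(1) \<sigma>_inj[of v] \<sigma>_less[of v 1] by simp_all
  then have "\<sigma> v 1 \<in> {1..12}" using v0 by auto
  note nat_1_12_cases[OF this]
  then have "\<exists>s\<in>{1, 3, 4, 9, 10, 12}. s * \<sigma> v 1 mod 13 \<in> {1, 2}" by (elim disjE) simp_all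
  then obtain s where s: "s \<in> {1, 3, 4, 9, 10, 12}" "s * \<sigma> v 1 mod 13 \<in> {1, 2}" by blast
  obtain g where g: "g \<in> stab" "perm g = perm_mult s" using obtain_stab[OF s(1)] by blast
  have gc: "g \<in> carrier G" "\<sigma> g 13 = 13" "\<sigma> g 0 = 0" using g act_iff by auto
  have "\<sigma> g (\<sigma> v 1) = perm g ! \<sigma> v 1" using v by (simp add: perm_nth)
  also have "\<dots> = s * \<sigma> v 1 mod 13" using \<open>\<sigma> v 1 \<in> {1..12}\<close> by (simp add: g perm_mult_def nth_append)
  finally have "\<sigma> g (\<sigma> v 1) \<in> {1, 2}" using s by simp
  then show ?thesis using that[of "g \<otimes> v"] gc v v0 by (simp add: \<sigma>_mult)
qed

text \<open>Conjugation by \<open>w\<close> preserves the stabilizer of the two points, so it turns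
  multiplication by 4 into multiplication by some \<open>k\<close>, and \<open>w\<close> is
  determined by \<open>k\<close> and its values at 1 and 2. A word in \<open>x\<close> and
  \<open>w\<close> that fixes both points must again be multiplication by a square, which singles
  out one table.\<close>

lemma swap_perm:
  assumes w: "w \<in> carrier G" "\<sigma> w 13 = 0" "\<sigma> w 0 = 13" "\<sigma> w 1 \<in> {1, 2}"
  shows "perm w = perm_inverse"
proof -
  obtain h where h: "h \<in> stab" "perm h = perm_mult 4" using obtain_stab[of 4] by auto
  have hc: "h \<in> carrier G" "\<sigma> h 13 = 13" "\<sigma> h 0 = 0" using h act_iff by auto
  define h' where "h' = w \<otimes> h \<otimes> inv w"
  have inv_w: "\<sigma> (inv w) 0 = 13" "\<sigma> (inv w) 13 = 0"
    using \<sigma>_inv[OF w(1), of 13] \<sigma>_inv[OF w(1), of 0] w by simp_all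
  have h'c: "h' \<in> carrier G" using hc w by (simp add: h'_def)
  have "\<sigma> h' 13 = 13" "\<sigma> h' 0 = 0" using hc w inv_w by (simp_all add: h'_def \<sigma>_mult)
  then have "h' \<in> stab" using act_iff h'c by blast
  then obtain k where k: "k \<in> {1, 3, 4, 9, 10, 12}" "perm h' = perm_mult k" by (rule stab_perm)
  have w_range: "\<sigma> w t \<in> {1..12}" if "t \<in> {1..12}" for t
  proof -
    have "\<sigma> w t \<noteq> \<sigma> w 13" "\<sigma> w t \<noteq> \<sigma> w 0" "\<sigma> w t < 14" using that w(1) \<sigma>_inj[of w t] \<sigma>_less[of w t] by auto
    then show ?thesis using w by auto
  qed
  have R: "\<sigma> w (4 * t mod 13) = k * \<sigma> w t mod 13" if t: "t \<in> {1..12}" for t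
  proof -
    have "\<sigma> h t = 4 * t mod 13"
      using perm_nth[of t h] t unfolding h(2) by (simp add: perm_mult_def nth_append)
    moreover have "\<sigma> h' (\<sigma> w t) = k * \<sigma> w t mod 13"
      using perm_nth[of "\<sigma> w t" h'] w_range[OF t] unfolding k(2) by (simp add: perm_mult_def nth_append)
    moreover have "h' \<otimes> w = w \<otimes> h" using w hc by (simp add: h'_def m_assoc)
    then have "\<sigma> h' (\<sigma> w t) = \<sigma> w (\<sigma> h t)"
      using t w(1) hc(1) h'c \<sigma>_mult[of h' w t] \<sigma>_mult[of w h t] by simp
    ultimately show ?thesis by simp
  qed
  define a where "a = \<sigma> w 1"
  define d where "d = \<sigma> w 2"
  have "[0..<14] = [0,1,2,3,4,5,6,7,8,9,10,11,12,13::nat]" by (simp add: upt_rec)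
  then have "perm w = map (\<sigma> w) [0,1,2,3,4,5,6,7,8,9,10,11,12,13]" by (simp only: perm_def)
  also have "\<dots> = swap_table k a d"
  proof -
    define m where "m i = k * i mod 13" for i
    have tab: "swap_table k a d = [13, a, d, m (m a), m a, m (m (m (m d))), m (m d),
      m (m (m (m (m d)))), m d, m (m (m (m a))), m (m (m (m (m a)))), m (m (m d)), m (m (m a)), 0]"
      by (simp only: swap_table_def Let_def m_def)
    have m: "t' = 4 * t mod 13 \<Longrightarrow> \<sigma> w t = b \<Longrightarrow> t \<in> {1..12} \<Longrightarrow> \<sigma> w t' = m b" for t t' b
      using R unfolding m_def by blast
    have 4: "\<sigma> w 4 = m a" by (rule m[of _ 1]) (simp_all add: a_def)
    have 3: "\<sigma> w 3 = m (m a)" by (rule m[OF _ 4]) simp_all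
    have 12: "\<sigma> w 12 = m (m (m a))" by (rule m[OF _ 3]) simp_all
    have 9: "\<sigma> w 9 = m (m (m (m a)))" by (rule m[OF _ 12]) simp_all
    have 10: "\<sigma> w 10 = m (m (m (m (m a))))" by (rule m[OF _ 9]) simp_all
    have 8: "\<sigma> w 8 = m d" by (rule m[of _ 2]) (simp_all add: d_def)
    have 6: "\<sigma> w 6 = m (m d)" by (rule m[OF _ 8]) simp_all
    have 11: "\<sigma> w 11 = m (m (m d))" by (rule m[OF _ 6]) simp_all
    have 5: "\<sigma> w 5 = m (m (m (m d)))" by (rule m[OF _ 11]) simp_all
    have 7: "\<sigma> w 7 = m (m (m (m (m d))))" by (rule m[OF _ 5]) simp_all
    show ?thesis
      unfolding tab by (simp only: list.map 3 4 5 6 7 8 9 10 11 12 w(2,3) a_def[symmetric] d_def[symmetric])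
  qed
  finally have tab: "perm w = swap_table k a d" .
  have dist: "distinct (perm w)"
    unfolding perm_def using w(1) \<sigma>_inj by (auto simp: distinct_map inj_on_def)
  have ad: "a \<in> {1, 2}" "d \<in> {1..12}" using w(4) w_range[of 2] by (simp_all add: a_def d_def)
  \<comment> \<open>4, 3 and 12 are the first three powers of 4, so injectivity excludes that
    \<open>k\<close>, its square or its cube is 1. The squares of order 6 modulo 13 are 4 and
    10.\<close>
  have "\<sigma> w 4 \<noteq> \<sigma> w 1" "\<sigma> w 3 \<noteq> \<sigma> w 1" "\<sigma> w 12 \<noteq> \<sigma> w 1" using w(1) by (simp_all add: \<sigma>_inj)
  then have "k * a mod 13 \<noteq> a" "k * (k * a mod 13) mod 13 \<noteq> a" "k * (k * (k * a mod 13) mod 13) mod 13 \<noteq> a"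
    using R[of 1] R[of 4] R[of 3] unfolding a_def by simp_all
  then have k410: "k \<in> {4, 10}" using k(1) ad(1) by (elim insertE emptyE; simp)
  \<comment> \<open>The translations \<open>i\<close> and \<open>e\<close> make the word
    \<open>u\<close> below fix both points. Its six factors move 13 along 0, 1, \<open>a\<close>, 0,
    13, 13 and move 0 along 13, 13, 0, \<open>i\<close>, \<open>\<sigma> w i\<close>, 0.\<close>
  define i where "i = 13 - perm w ! 1"
  have i: "i = 13 - a" by (simp add: i_def a_def perm_nth)
  define e where "e = 13 - perm w ! i"
  have i_range: "i \<in> {1..12}" using ad by (auto simp: i)
  have e: "e = 13 - \<sigma> w i" using i_range by (simp add: e_def perm_nth)
  define u where "u = x [^] e \<otimes> (w \<otimes> (x [^] i \<otimes> (w \<otimes> (x \<otimes> w))))"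
  have uc: "u \<in> carrier G" using w by (simp add: u_def)
  have shift14: "shift j t < 14" if "t < 14" for j t
    using \<sigma>_pow_x[OF that, of j] \<sigma>_less[of "x [^] j" t] that by simp
  have \<sigma>_u: "\<sigma> u t = shift e (\<sigma> w (shift i (\<sigma> w (shift 1 (\<sigma> w t)))))" if "t < 14" for t
    unfolding u_def using that w(1) by (simp add: \<sigma>_mult \<sigma>_pow_x \<sigma>_x shift14)
  have "\<sigma> u 0 = 0"
    using w w_range[OF i_range] i_range \<sigma>_u[of 0] by (simp add: shift_def e)
  moreover have "\<sigma> u 13 = 13"
    using w ad(1) \<sigma>_u[of 13] by (auto simp: shift_def i a_def)
  ultimately have "u \<in> stab" using act_iff uc by blast
  then obtain s where s: "s \<in> {1, 3, 4, 9, 10, 12}" "perm u = perm_mult s" by (rule stab_perm)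
  have "perm u ! 1 = s mod 13" "perm u ! 2 = 2 * s mod 13"
    unfolding s(2) by (simp_all add: perm_mult_def nth_append mult_2_right mult_2)
  then have u12: "\<sigma> u 1 = s" "\<sigma> u 2 = 2 * s mod 13" using s(1) by (auto simp: perm_nth)

  show ?thesis
  proof (rule swap_unique[OF tab k410 ad i_def e_def refl refl refl refl refl refl _ _ dist])
    have *: "shift e (perm w ! shift i (perm w ! shift 1 (perm w ! t))) = \<sigma> u t" if "t < 14" for t
      using that w(1) \<sigma>_u[OF that] by (simp add: perm_nth shift14)
    show "shift e (perm w ! shift i (perm w ! shift 1 (perm w ! 1))) \<in> {1, 3, 4, 9, 10, 12}"
      using *[of 1] u12 s(1) by simp
    show "shift e (perm w ! shift i (perm w ! shift 1 (perm w ! 2)))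
      = 2 * shift e (perm w ! shift i (perm w ! shift 1 (perm w ! 1))) mod 13"
      using *[of 1] *[of 2] u12 by simp
  qed
qed

text \<open>The elements \<open>x\<close>, \<open>h\<close> and \<open>w\<close> realize the three
  generators. Conversely, multiplying by powers of \<open>x\<close> and, if necessary, by
  \<open>w\<close> makes a given element fix 13 and then 0; what remains is multiplication by a
  square, a power of the generator 4 t.\<close>

lemma perm_image: "perm ` carrier G = proj_perms"
proof
  obtain h where h: "h \<in> stab" "perm h = perm_mult 4" using obtain_stab[of 4] by auto
  obtain w where w: "w \<in> carrier G" "\<sigma> w 13 = 0" "\<sigma> w 0 = 13" "\<sigma> w 1 \<in> {1, 2}"
    using obtain_swap by blast
  have pw: "perm w = perm_inverse" using swap_perm[OF w] .
  show "proj_perms \<subseteq> perm ` carrier G"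
  proof
    fix L assume "L \<in> proj_perms"
    then show "L \<in> perm ` carrier G"
    proof induction
      case id
      then show ?case using perm_one by (metis image_eqI one_closed)
    next
      case (add1 L)
      then obtain g where "g \<in> carrier G" "L = perm g" by blast
      then have "lcomp (perm_add 1) L = perm (x \<otimes> g)" "x \<otimes> g \<in> carrier G"
        using perm_mult_hom[of x g] perm_x by auto
      then show ?case by blast
    next
      case (mult4 L)
      then obtain g where "g \<in> carrier G" "L = perm g" by blast
      then have "lcomp (perm_mult 4) L = perm (h \<otimes> g)" "h \<otimes> g \<in> carrier G"
        using h perm_mult_hom[of h g] by auto
      then show ?case by blast
    next
      case (inverse L)
      then obtain g where "g \<in> carrier G" "L = perm g" by blast
      then have "lcomp perm_inverse L = perm (w \<otimes> g)" "w \<otimes> g \<in> carrier G"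
        using w(1) pw perm_mult_hom[of w g] by auto
      then show ?case by blast
    qed
  qed
  have x_step: "perm (x [^] (i::nat) \<otimes> g) \<in> proj_perms" if "g \<in> carrier G" "perm g \<in> proj_perms" for g i
  proof (induction i)
    case (Suc i)
    have "x [^] Suc i = x \<otimes> x [^] i" by (rule nat_pow_Suc2) simp
    then have "x [^] Suc i \<otimes> g = x \<otimes> (x [^] i \<otimes> g)" using that by (simp only: m_assoc xc nat_pow_closed)
    then show ?case using Suc proj_perms.add1 perm_mult_hom[of x "x [^] i \<otimes> g"] perm_x that by simp
  qed (use that in simp)
  have x_cancel: "x [^] c \<otimes> (x [^] (13 - c) \<otimes> g) = g" if "c \<le> 13" "g \<in> carrier G" for c :: nat and g
  proof -
    have "x [^] c \<otimes> x [^] (13 - c) = \<one>"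
      using that ord_x by (simp add: nat_pow_mult pow_eq_id)
    then show ?thesis using that by (simp flip: m_assoc)
  qed
  have fix13: "perm g \<in> proj_perms" if g: "g \<in> carrier G" "\<sigma> g 13 = 13" for g
  proof -
    define c where "c = \<sigma> g 0"
    have "c \<noteq> \<sigma> g 13" using g(1) by (simp add: c_def \<sigma>_inj)
    moreover have "c < 14" using g by (simp add: c_def)
    ultimately have c: "c < 13" using g by simp
    define u where "u = x [^] (13 - c) \<otimes> g"
    have uc: "u \<in> carrier G" using g by (simp add: u_def)
    have "\<sigma> u 0 = 0" "\<sigma> u 13 = 13"
      using g c by (simp_all add: u_def \<sigma>_mult \<sigma>_pow_x shift_def flip: c_def)
    then have "u \<in> stab" using act_iff uc by blast
    then obtain s where "s \<in> {1, 3, 4, 9, 10, 12}" "perm u = perm_mult s" by (rule stab_perm)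
    then have "perm u \<in> proj_perms" using perm_mult_mem by simp
    then have "perm (x [^] c \<otimes> u) \<in> proj_perms" by (rule x_step[OF uc])
    then show ?thesis using x_cancel c g by (simp add: u_def)
  qed
  show "perm ` carrier G \<subseteq> proj_perms"
  proof
    fix L assume "L \<in> perm ` carrier G"
    then obtain g where g: "g \<in> carrier G" "L = perm g" by blast
    show "L \<in> proj_perms"
    proof (cases "\<sigma> g 13 = 13")
      case True
      then show ?thesis using fix13 g by simp
    next
      case False
      define c where "c = \<sigma> g 13"
      have "c < 14" "c \<noteq> 13" using False g by (simp_all add: c_def)
      then have c: "c < 13" by simp
      define v where "v = x [^] (13 - c) \<otimes> g"
      have vc: "v \<in> carrier G" using g by (simp add: v_def)
      have "\<sigma> v 13 = 0" using g c by (simp add: v_def \<sigma>_mult \<sigma>_pow_x shift_def flip: c_def)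
      then have "\<sigma> (w \<otimes> v) 13 = 13" using w vc by (simp add: \<sigma>_mult)
      then have 1: "perm (w \<otimes> v) \<in> proj_perms" using fix13 w vc by simp
      \<comment> \<open>The map t -> 1/t is an involution, so by faithfulness \<open>w\<close> is
        its own inverse and can be cancelled by applying it once more.\<close>
      have "perm (w \<otimes> w) = perm \<one>"
        unfolding perm_mult_hom[OF w(1) w(1)] pw perm_one
        by (simp add: lcomp_def perm_inverse_def upt_rec)
      then have "w \<otimes> w = \<one>" using perm_inj w by blast
      then have "w \<otimes> (w \<otimes> v) = v" using w vc by (simp flip: m_assoc)
      then have "perm v = lcomp perm_inverse (perm (w \<otimes> v))"
        using perm_mult_hom[of w "w \<otimes> v"] w vc pw by simp
      then have "perm v \<in> proj_perms" using proj_perms.inverse[OF 1] by simp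
      then have "perm (x [^] c \<otimes> v) \<in> proj_perms" by (rule x_step[OF vc])
      then show ?thesis using x_cancel c g by (simp add: v_def)
    qed
  qed
qed

lemma iso_coordinates: "G \<cong> proj_perm_monoid"
proof -
  have "perm \<in> iso G proj_perm_monoid"
    using perm_image perm_inj perm_mult_hom
    by (auto simp: iso_def hom_def bij_betw_def inj_on_def proj_perm_monoid_def)
  then show ?thesis by (auto simp: is_iso_def)
qed

end

lemma (in sylow13_action) iso_proj_perm_monoid: "G \<cong> proj_perm_monoid"
proof -
  have "Syl \<noteq> {}" using card_Syl by (auto simp: Syl_def)
  then obtain x where x: "x \<in> ord_set 13" by (auto simp: Syl_def)
  have "card {cyc x} < card Syl" using card_Syl by (simp add: Syl_def)
  then have "\<not> Syl \<subseteq> {cyc x}" using card_mono[of "{cyc x}" Syl] by auto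
  then obtain P0 where "P0 \<in> Syl" "P0 \<noteq> cyc x" by auto
  then interpret sylow13_coordinates G x P0 using x by unfold_locales
  show ?thesis by (rule iso_coordinates)
qed

section \<open>Element orders in PSL(2,13)\<close>

text \<open>Signed representatives suit the traces, which are determined in PSL(2,13) only up to
  sign.\<close>

lemma UNIV_13: "(UNIV :: 13 set) = {0, 1, -1, 2, -2, 3, -3, 4, -4, 5, -5, 6, -6}"
proof -
  have "x \<in> {0, 1, -1, 2, -2, 3, -3, 4, -4, 5, -5, 6, -6}" for x :: 13
  proof (cases x)
    case (of_int z)
    then have "z < 13" by simp
    then have "z = 0 \<or> z = 1 \<or> z = 2 \<or> z = 3 \<or> z = 4 \<or> z = 5 \<or> z = 6 \<or> z = 7 \<or> z = 8 \<or> z = 9 \<or>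
      z = 10 \<or> z = 11 \<or> z = 12"
      using of_int(2) by presburger
    then show ?thesis unfolding of_int(1) by (elim disjE) simp_all
  qed
  then show ?thesis by blast
qed

lemma all_13_iff: "(\<forall>x::13. P x) \<longleftrightarrow> (\<forall>x\<in>{0, 1, -1, 2, -2, 3, -3, 4, -4, 5, -5, 6, -6}. P x)"
  using UNIV_13 by (metis UNIV_I)

lemma inverse_13: "\<exists>y. x * y = 1" if "x \<noteq> 0" for x :: 13
proof -
  have "\<forall>x::13. x \<noteq> 0 \<longrightarrow> x * 1 = 1 \<or> x * (-1) = 1 \<or> x * 7 = 1 \<or> x * (-7) = 1 \<or> x * 9 = 1 \<or> x * (-9) = 1 \<or>
    x * 10 = 1 \<or> x * (-10) = 1 \<or> x * 8 = 1 \<or> x * (-8) = 1 \<or> x * 11 = 1 \<or> x * (-11) = 1"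
    unfolding all_13_iff by simp
  then show ?thesis using that by blast
qed

lemma square_eq_1_13: "x = 1 \<or> x = -1" if "x * x = 1" for x :: 13
proof -
  have "\<forall>x::13. x * x = 1 \<longrightarrow> x = 1 \<or> x = -1" unfolding all_13_iff by simp
  then show ?thesis using that by blast
qed

definition mat2 :: "'a::zero \<Rightarrow> 'a \<Rightarrow> 'a \<Rightarrow> 'a \<Rightarrow> 'a^2^2" where
  "mat2 a b c d = vector [vector [a, b], vector [c, d]]"

lemma mat2_nth [simp]:
  "mat2 a b c d $ 1 $ 1 = a" "mat2 a b c d $ 1 $ 2 = b"
  "mat2 a b c d $ 2 $ 1 = c" "mat2 a b c d $ 2 $ 2 = d"
  by (simp_all add: mat2_def)

lemma mat2_eq_iff:
  "A = B \<longleftrightarrow> A $ 1 $ 1 = B $ 1 $ 1 \<and> A $ 1 $ 2 = B $ 1 $ 2 \<and> A $ 2 $ 1 = B $ 2 $ 1 \<and> A $ 2 $ 2 = B $ 2 $ 2"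
  for A B :: "'a^2^2"
  by (auto simp: vec_eq_iff forall_2)

lemma mult2_nth:
  "(A ** B) $ i $ j = A $ i $ 1 * B $ 1 $ j + A $ i $ 2 * B $ 2 $ j" for A B :: "'a::comm_ring_1^2^2"
  by (simp add: matrix_matrix_mult_def sum_2)

lemma mat_1_nth: "(mat 1 :: 'a::comm_ring_1^2^2) $ 1 $ 1 = 1" "(mat 1 :: 'a^2^2) $ 1 $ 2 = 0"
  "(mat 1 :: 'a^2^2) $ 2 $ 1 = 0" "(mat 1 :: 'a^2^2) $ 2 $ 2 = 1"
  by (simp_all add: mat_def)

abbreviation SL13 :: "(13^2^2) monoid" where "SL13 \<equiv> SL"

abbreviation tr2 :: "'a::comm_ring_1^2^2 \<Rightarrow> 'a" where "tr2 A \<equiv> A $ 1 $ 1 + A $ 2 $ 2"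

lemma carrier_SL13: "A \<in> carrier SL13 \<longleftrightarrow> A $ 1 $ 1 * A $ 2 $ 2 - A $ 1 $ 2 * A $ 2 $ 1 = 1"
  by (simp add: SL_def det_2)

lemma center_SL13: "center SL13 = {mat 1, - mat 1}"
proof
  show "center SL13 \<subseteq> {mat 1, - mat 1}"
  proof
    fix A assume A: "A \<in> center SL13"
    then have det: "A $ 1 $ 1 * A $ 2 $ 2 - A $ 1 $ 2 * A $ 2 $ 1 = 1"
      using carrier_SL13 by (auto simp: center_def)
    have comm: "A ** B = B ** A" if "B \<in> carrier SL13" for B
      using A that by (auto simp: center_def SL_def)
    \<comment> \<open>Commuting with the upper transvection gives a lower left entry 0 and equal
      diagonal entries, commuting with the lower one an upper right entry 0.\<close>
    have "A ** mat2 1 1 0 1 = mat2 1 1 0 1 ** A" "A ** mat2 1 0 1 1 = mat2 1 0 1 1 ** A"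
      by (rule comm; simp add: carrier_SL13)+
    then have *: "A $ 2 $ 1 = 0" "A $ 1 $ 1 = A $ 2 $ 2" "A $ 1 $ 2 = 0"
      by (simp_all add: mat2_eq_iff mult2_nth add.commute)
    then have "A $ 2 $ 2 = 1 \<or> A $ 2 $ 2 = -1" using det square_eq_1_13 by simp
    then show "A \<in> {mat 1, - mat 1}"
      using * by (auto simp: mat2_eq_iff mat_1_nth)
  qed
  show "{mat 1, - mat 1} \<subseteq> center SL13"
    by (auto simp: center_def SL_def det_2 mat2_eq_iff mult2_nth mat_1_nth)
qed

text \<open>By the Cayley-Hamilton theorem a power of \<open>A\<close> of determinant 1 and trace \<open>t\<close> is
  \<open>u A + v\<close>, where \<open>(u, v)\<close> depends on \<open>t\<close> only.\<close>

primrec ch_coeffs :: "'a::comm_ring_1 \<Rightarrow> nat \<Rightarrow> 'a \<times> 'a" where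
  "ch_coeffs t 0 = (0, 1)"
| "ch_coeffs t (Suc n) = (fst (ch_coeffs t n) * t + snd (ch_coeffs t n), - fst (ch_coeffs t n))"

lemma SL13_pow:
  assumes A: "A \<in> carrier SL13" and uv: "ch_coeffs (tr2 A) n = (u, v)"
  shows "A [^]\<^bsub>SL13\<^esub> n = mat2 (u * A $ 1 $ 1 + v) (u * A $ 1 $ 2) (u * A $ 2 $ 1) (u * A $ 2 $ 2 + v)"
  using uv
proof (induction n arbitrary: u v)
  case 0
  then show ?case by (simp add: nat_pow_def SL_def mat2_eq_iff mat_1_nth)
next
  case (Suc n)
  define r where "r = fst (ch_coeffs (tr2 A) n)"
  define s where "s = snd (ch_coeffs (tr2 A) n)"
  have uv: "u = r * tr2 A + s" "v = - r" using Suc.prems by (simp_all add: r_def s_def)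
  \<comment> \<open>The determinant condition expresses the product of the off-diagonal entries by
    the diagonal ones; this is how A^2 = t A - 1 enters, turning (r A + s) A into (r t + s) A -
    r.\<close>
  have bc: "A $ 1 $ 2 * A $ 2 $ 1 = A $ 1 $ 1 * A $ 2 $ 2 - 1"
    using A carrier_SL13[of A] by (simp add: algebra_simps)
  have IH: "A [^]\<^bsub>SL13\<^esub> n = mat2 (r * A $ 1 $ 1 + s) (r * A $ 1 $ 2) (r * A $ 2 $ 1) (r * A $ 2 $ 2 + s)"
    using Suc.IH[of r s] by (simp add: r_def s_def)
  have "A [^]\<^bsub>SL13\<^esub> Suc n = (A [^]\<^bsub>SL13\<^esub> n) ** A" by (simp add: SL_def nat_pow_def)
  then have step: "A [^]\<^bsub>SL13\<^esub> Suc n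
    = mat2 (r * A $ 1 $ 1 + s) (r * A $ 1 $ 2) (r * A $ 2 $ 1) (r * A $ 2 $ 2 + s) ** A"
    by (simp only: IH)
  have "r * A $ 1 $ 2 * A $ 2 $ 1 = r * (A $ 1 $ 1 * A $ 2 $ 2 - 1)"
    "r * A $ 2 $ 1 * A $ 1 $ 2 = r * (A $ 1 $ 1 * A $ 2 $ 2 - 1)"
    by (simp_all add: mult.assoc flip: bc)
  then show ?case
    unfolding step by (simp add: mat2_eq_iff mult2_nth uv algebra_simps)
qed

section \<open>Counting matrices of determinant 1 by trace\<close>

definition T13 :: "13 \<Rightarrow> (13^2^2) set" where
  "T13 t = {A \<in> carrier SL13. tr2 A = t}"

text \<open>Each of the 12 nonzero \<open>b\<close> determines \<open>c\<close>;
  \<open>b = 0\<close> admits all 13 values of \<open>c\<close> when \<open>m = 0\<close> and none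
  otherwise.\<close>

lemma card_mult_eq_13: "card {(b, c). b * c = (m::13)} = 12 + (if m = 0 then 13 else 0)"
proof -
  have "{(b, c). b * c = m} = Sigma UNIV (\<lambda>b. {c. b * c = m})" by auto
  then have "card {(b, c). b * c = m} = (\<Sum>b\<in>UNIV. card {c. b * c = m})" by (simp add: card_SigmaI)
  also have "\<dots> = card {c. 0 * c = m} + (\<Sum>b\<in>UNIV - {0}. card {c. b * c = m})"
    by (simp add: sum.remove[of UNIV 0])
  also have "(\<Sum>b\<in>UNIV - {0}. card {c. b * c = m}) = (\<Sum>b\<in>UNIV - {0::13}. 1)"
  proof (rule sum.cong)
    fix b :: 13 assume "b \<in> UNIV - {0}"
    then obtain y where y: "b * y = 1" using inverse_13 by blast
    have "c = m * y" if "b * c = m" for c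
    proof -
      have "c = (b * y) * c" using y by simp
      also have "\<dots> = b * c * y" by (simp only: ac_simps)
      finally show ?thesis using that by simp
    qed
    moreover have "b * (m * y) = m" using y by (metis mult.left_commute mult.right_neutral)
    ultimately have "{c. b * c = m} = {m * y}" by blast
    then show "card {c. b * c = m} = 1" by simp
  qed simp
  also have "\<dots> = 12" by (simp add: card_Diff_subset)
  finally show ?thesis by auto
qed

text \<open>The diagonal is \<open>a\<close>, \<open>t - a\<close>, and the off-diagonal entries
  have product \<open>a * (t - a) - 1\<close>. Each of the 13 values of \<open>a\<close> allows 12
  pairs of them, and 13 more if \<open>a\<close> is a root of the characteristic polynomial.\<close>

lemma card_T13: "card (T13 t) = 156 + 13 * card {a. a * (t - a) = 1}"
proof -
  let ?S = "Sigma UNIV (\<lambda>a. {(b, c). b * c = a * (t - a) - 1})"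
  have "bij_betw (\<lambda>A. (A $ 1 $ 1, A $ 1 $ 2, A $ 2 $ 1)) (T13 t) ?S"
  proof (rule bij_betw_byWitness[where f' = "\<lambda>(a, b, c). mat2 a b c (t - a)"])
    show "\<forall>A\<in>T13 t. (case (A $ 1 $ 1, A $ 1 $ 2, A $ 2 $ 1) of (a, b, c) \<Rightarrow> mat2 a b c (t - a)) = A"
      by (auto simp: T13_def mat2_eq_iff)
    show "(\<lambda>A. (A $ 1 $ 1, A $ 1 $ 2, A $ 2 $ 1)) ` T13 t \<subseteq> ?S"
      by (auto simp: T13_def carrier_SL13 algebra_simps)
    show "(\<lambda>(a, b, c). mat2 a b c (t - a)) ` ?S \<subseteq> T13 t"
      by (auto simp: T13_def carrier_SL13)
  qed auto
  then have "card (T13 t) = card ?S" by (rule bij_betw_same_card)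
  also have "\<dots> = (\<Sum>a\<in>UNIV. 12 + (if a * (t - a) - 1 = 0 then 13 else 0))"
    by (simp add: card_SigmaI card_mult_eq_13)
  also have "\<dots> = 156 + (\<Sum>a\<in>UNIV. if a * (t - a) = 1 then 13 else 0)"
    by (simp add: sum.distrib)
  also have "(\<Sum>a\<in>UNIV. if a * (t - a) = 1 then 13 else 0) = 13 * card {a. a * (t - a) = 1}"
    by (simp add: sum.If_cases)
  finally show ?thesis .
qed

lemma card_Collect_13:
  "card {x::13. P x} = (\<Sum>x\<in>{0, 1, -1, 2, -2, 3, -3, 4, -4, 5, -5, 6, -6}. of_bool (P x))"
  unfolding UNIV_13[symmetric] by (simp add: of_bool_def sum.If_cases)

text \<open>The three groups of traces are those for which t^2 - 4 is a nonzero square, zero or a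
  nonsquare, giving two, one or no eigenvalues in the field.\<close>

lemma card_T13_values:
  "t \<in> {0, 1, -1, 4, -4} \<Longrightarrow> card (T13 t) = 182"
  "t \<in> {2, -2} \<Longrightarrow> card (T13 t) = 169"
  "t \<in> {3, -3, 5, -5, 6, -6} \<Longrightarrow> card (T13 t) = 156"
proof -
  note simps = card_Collect_13 card_T13
  show "t \<in> {0, 1, -1, 4, -4} \<Longrightarrow> card (T13 t) = 182"
    by (elim insertE emptyE) (simp_all add: simps)
  show "t \<in> {2, -2} \<Longrightarrow> card (T13 t) = 169"
    by (elim insertE emptyE) (simp_all add: simps)
  show "t \<in> {3, -3, 5, -5, 6, -6} \<Longrightarrow> card (T13 t) = 156"
    by (elim insertE emptyE) (simp_all add: simps)
qed

lemma card_trace_in: "card {A \<in> carrier SL13. tr2 A \<in> S} = (\<Sum>t\<in>S. card (T13 t))"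
proof -
  have "{A \<in> carrier SL13. tr2 A \<in> S} = (\<Union>t\<in>S. T13 t)" by (auto simp: T13_def)
  moreover have "card (\<Union>t\<in>S. T13 t) = (\<Sum>t\<in>S. card (T13 t))"
    by (rule card_UN_disjoint) (auto simp: T13_def)
  ultimately show ?thesis by simp
qed

section \<open>Passing to the quotient by the centre\<close>

interpretation SL13: group SL13 by (rule group_SL_2)
interpretation PSL13: group PSL_2_13 by (rule group_PSL_2)

interpretation center13: normal "center SL13" SL13 by (rule SL13.center_normal)

abbreviation cls :: "13^2^2 \<Rightarrow> (13^2^2) set" where
  "cls A \<equiv> center SL13 #>\<^bsub>SL13\<^esub> A"

interpretation cls: group_hom SL13 PSL_2_13 "\<lambda>A. cls A"
  unfolding PSL_def
  by (intro group_hom.intro group_hom_axioms.intro group_SL_2 center13.factorgroup_is_group center13.r_coset_hom_Mod)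

lemma carrier_PSL13: "carrier PSL_2_13 = cls ` carrier SL13"
  by (auto simp: PSL_def FactGroup_def RCOSETS_def)

lemma cls_eq_one_iff: "A \<in> carrier SL13 \<Longrightarrow> cls A = \<one>\<^bsub>PSL_2_13\<^esub> \<longleftrightarrow> A \<in> {mat 1, - mat 1}"
  using SL13.coset_join1[of "center SL13" A] SL13.coset_join2[of A "center SL13"]
    center13.subgroup_axioms center13.subset
  by (auto simp: PSL_def FactGroup_def simp flip: center_SL13)

lemma cls_pow_eq_one_iff:
  "A \<in> carrier SL13 \<Longrightarrow> cls A [^]\<^bsub>PSL_2_13\<^esub> n = \<one>\<^bsub>PSL_2_13\<^esub> \<longleftrightarrow> A [^]\<^bsub>SL13\<^esub> n \<in> {mat 1, - mat 1}" for n :: nat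
  using cls.hom_nat_pow[of A n] cls_eq_one_iff[of "A [^]\<^bsub>SL13\<^esub> n"] by simp

lemma finite_carrier_PSL13: "finite (carrier PSL_2_13)"
  by (simp add: carrier_PSL13)

text \<open>Every coset of the centre consists of two matrices, so counts in SL(2,13) are
  halved.\<close>

lemma card_PSL13_Collect:
  "card {A \<in> carrier SL13. P (cls A)} = card {X \<in> carrier PSL_2_13. P X} * 2"
proof -
  have img: "cls ` {A \<in> carrier SL13. P (cls A)} = {X \<in> carrier PSL_2_13. P X}"
    by (auto simp: carrier_PSL13)
  show ?thesis unfolding img[symmetric]
  proof (rule card_eq_card_image_mult)
    fix X assume "X \<in> cls ` {A \<in> carrier SL13. P (cls A)}"
    then obtain A where A: "A \<in> carrier SL13" "P (cls A)" "X = cls A" by blast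
    have "{B \<in> {A \<in> carrier SL13. P (cls A)}. cls B = X} = cls A"
    proof (rule subset_antisym; rule subsetI)
      fix B assume "B \<in> {B \<in> {A \<in> carrier SL13. P (cls A)}. cls B = X}"
      then show "B \<in> cls A"
        using SL13.rcos_self[of B "center SL13"] center13.subgroup_axioms A by auto
    next
      fix B assume B: "B \<in> cls A"
      then have "cls B = cls A"
        using SL13.repr_independence[of B "center SL13" A] center13.subgroup_axioms A by simp
      moreover have "B \<in> carrier SL13"
        using B A SL13.r_coset_subset_G[OF center13.subset A(1)] by blast
      ultimately show "B \<in> {B \<in> {A \<in> carrier SL13. P (cls A)}. cls B = X}" using A by simp
    qed
    moreover have "card (cls A) = card (center SL13)"
      using SL13.card_rcosets_equal[of "cls A" "center SL13"] A center13.subset SL13.rcosetsI by metis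
    moreover have "mat 1 \<noteq> - (mat 1 :: 13^2^2)" by (simp add: mat2_eq_iff mat_1_nth)
    then have "card (center SL13) = 2" by (simp add: center_SL13)
    ultimately show "card {B \<in> {A \<in> carrier SL13. P (cls A)}. cls B = X} = 2" by simp
  qed simp
qed

lemma tr2_center: "A \<in> {mat 1, - mat 1} \<Longrightarrow> tr2 A \<in> {2, -2 :: 13}"
  by (auto simp: mat_1_nth)

lemma pow_center_if_ch_coeffs:
  assumes "A \<in> carrier SL13" "ch_coeffs (tr2 A) n \<in> {(0, 1), (0, -1)}"
  shows "A [^]\<^bsub>SL13\<^esub> n \<in> {mat 1, - mat 1}"
proof -
  consider "ch_coeffs (tr2 A) n = (0, 1)" | "ch_coeffs (tr2 A) n = (0, -1)" using assms(2) by blast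
  then show ?thesis
    by cases (simp_all add: SL13_pow[OF assms(1)] mat2_eq_iff mat_1_nth)
qed

lemma ord_cls_eq_prime:
  assumes A: "A \<in> carrier SL13" "A \<notin> {mat 1, - mat 1}" and r: "prime r"
    and ch: "ch_coeffs (tr2 A) r \<in> {(0, 1), (0, -1)}"
  shows "PSL13.ord (cls A) = r"
proof -
  have c: "cls A \<in> carrier PSL_2_13" using A carrier_PSL13 by blast
  have "cls A [^]\<^bsub>PSL_2_13\<^esub> r = \<one>\<^bsub>PSL_2_13\<^esub>"
    using cls_pow_eq_one_iff[OF A(1)] pow_center_if_ch_coeffs[OF A(1) ch] by blast
  then have "PSL13.ord (cls A) dvd r" using PSL13.pow_eq_id[OF c] by blast
  moreover have "PSL13.ord (cls A) \<noteq> 1" using PSL13.ord_eq_1[OF c] cls_eq_one_iff[OF A(1)] A(2) by blast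
  ultimately show ?thesis using r by (metis prime_nat_iff)
qed

text \<open>A power u A + v of a noncentral \<open>A\<close> is central only if u = 0. For a prime
  order a single vanishing coefficient suffices; order 6 also needs nonzero coefficients at the
  exponents 2 and 3.\<close>

lemma ord_cls:
  assumes A: "A \<in> carrier SL13"
  shows "tr2 A = 0 \<Longrightarrow> PSL13.ord (cls A) = 2"
    and "tr2 A \<in> {1, -1} \<Longrightarrow> PSL13.ord (cls A) = 3"
    and "tr2 A \<in> {4, -4} \<Longrightarrow> PSL13.ord (cls A) = 6"
    and "tr2 A \<in> {3, -3, 5, -5, 6, -6} \<Longrightarrow> PSL13.ord (cls A) = 7"
    and "tr2 A \<in> {2, -2} \<Longrightarrow> A \<notin> {mat 1, - mat 1} \<Longrightarrow> PSL13.ord (cls A) = 13"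
    and "A \<in> {mat 1, - mat 1} \<Longrightarrow> PSL13.ord (cls A) = 1"
proof -
  note num = eval_nat_numeral
  have nc: "A \<notin> {mat 1, - mat 1}" if "tr2 A \<noteq> 2" "tr2 A \<noteq> -2" using tr2_center that by blast
  show "PSL13.ord (cls A) = 2" if t: "tr2 A = 0"
  proof (rule ord_cls_eq_prime[OF A nc])
    show "ch_coeffs (tr2 A) 2 \<in> {(0, 1), (0, -1)}" unfolding t by (simp add: num)
  qed (simp_all add: t)
  show "PSL13.ord (cls A) = 3" if t: "tr2 A \<in> {1, -1}"
  proof (rule ord_cls_eq_prime[OF A nc])
    have "t \<in> {1, -1} \<Longrightarrow> ch_coeffs t 3 \<in> {(0, 1), (0, -1)}" for t :: 13 by (auto simp: num)
    then show "ch_coeffs (tr2 A) 3 \<in> {(0, 1), (0, -1)}" using t by blast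
  qed (use t in auto)
  show "PSL13.ord (cls A) = 7" if t: "tr2 A \<in> {3, -3, 5, -5, 6, -6}"
  proof (rule ord_cls_eq_prime[OF A nc])
    have "t \<in> {3, -3, 5, -5, 6, -6} \<Longrightarrow> ch_coeffs t 7 \<in> {(0, 1), (0, -1)}" for t :: 13
      by (elim insertE emptyE) (simp_all add: num)
    then show "ch_coeffs (tr2 A) 7 \<in> {(0, 1), (0, -1)}" using t by blast
  qed (use t in auto)
  show "PSL13.ord (cls A) = 13" if t: "tr2 A \<in> {2, -2}" and n: "A \<notin> {mat 1, - mat 1}"
  proof (rule ord_cls_eq_prime[OF A n])
    \<comment> \<open>A double eigenvalue 1 or -1 makes the coefficient grow linearly in
      \<open>n\<close>, up to sign, so it vanishes at 13 by the characteristic of the field.\<close>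
    have "ch_coeffs 2 n = (of_nat n, 1 - of_nat n :: 13)"
      "ch_coeffs (-2) n = ((-1) ^ n * (- of_nat n), (-1) ^ n * (1 - of_nat n) :: 13)" for n
      by (induction n) (simp_all add: algebra_simps)
    from this[of 13] have "ch_coeffs 2 13 = (0, 1 :: 13)" "ch_coeffs (-2) 13 = (0, -1 :: 13)"
      by simp_all
    with t show "ch_coeffs (tr2 A) 13 \<in> {(0, 1), (0, -1)}" by (elim insertE emptyE) simp_all
  qed simp
  have c: "cls A \<in> carrier PSL_2_13" using A carrier_PSL13 by blast
  show "PSL13.ord (cls A) = 1" if "A \<in> {mat 1, - mat 1}"
    using PSL13.ord_eq_1[OF c] cls_eq_one_iff[OF A] that by blast
  show "PSL13.ord (cls A) = 6" if t: "tr2 A \<in> {4, -4}"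
  proof -
    have "t \<in> {4, -4} \<Longrightarrow> ch_coeffs t 6 \<in> {(0, 1), (0, -1)}" for t :: 13
      by (elim insertE emptyE) (simp_all add: num)
    then have "A [^]\<^bsub>SL13\<^esub> (6::nat) \<in> {mat 1, - mat 1}"
      using t by (intro pow_center_if_ch_coeffs[OF A]) blast
    then have dvd: "PSL13.ord (cls A) dvd 6"
      using cls_pow_eq_one_iff[OF A] PSL13.pow_eq_id[OF c] by blast
    \<comment> \<open>If u A + v is 1 or -1 with u invertible, then \<open>A\<close> is scalar of
      determinant 1, so its trace would be 2 or -2.\<close>
    have not_dvd: "\<not> PSL13.ord (cls A) dvd n" if n: "ch_coeffs (tr2 A) n = (u, v)" "u \<noteq> 0" for n u v
    proof
      assume "PSL13.ord (cls A) dvd n"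
      then have "A [^]\<^bsub>SL13\<^esub> n \<in> {mat 1, - mat 1}"
        using cls_pow_eq_one_iff[OF A] PSL13.pow_eq_id[OF c] by blast
      then have *: "u * A $ 1 $ 2 = 0" "u * A $ 2 $ 1 = 0"
        and "u * A $ 1 $ 1 + v = 1 \<and> u * A $ 2 $ 2 + v = 1 \<or> u * A $ 1 $ 1 + v = -1 \<and> u * A $ 2 $ 2 + v = -1"
        unfolding SL13_pow[OF A n(1)] by (auto simp: mat2_eq_iff mat_1_nth)
      then have "u * A $ 1 $ 1 = u * A $ 2 $ 2" by (metis add_right_cancel)
      note * = * this
      obtain y where y: "u * y = 1" using inverse_13[OF n(2)] by blast
      have cancel: "a = b" if "u * a = u * b" for a b
      proof -
        have "(u * y) * a = (u * y) * b" using that by (metis mult.assoc mult.commute)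
        then show ?thesis using y by simp
      qed
      have "A $ 1 $ 2 = 0" "A $ 2 $ 1 = 0" "A $ 1 $ 1 = A $ 2 $ 2"
        using cancel[of "A $ 1 $ 2" 0] cancel[of "A $ 2 $ 1" 0] cancel[of "A $ 1 $ 1" "A $ 2 $ 2"] * by simp_all
      moreover from this have "A $ 2 $ 2 = 1 \<or> A $ 2 $ 2 = -1"
        using A carrier_SL13[of A] square_eq_1_13 by simp
      ultimately have "A \<in> {mat 1, - mat 1}" by (auto simp: mat2_eq_iff mat_1_nth)
      then have "tr2 A \<in> {2, -2}" by (rule tr2_center)
      then show False using t by auto
    qed
    have "t \<in> {4, -4} \<Longrightarrow> fst (ch_coeffs t 2) \<noteq> 0" "t \<in> {4, -4} \<Longrightarrow> fst (ch_coeffs t 3) \<noteq> 0" for t :: 13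
      by (auto simp: num)
    then have "\<not> PSL13.ord (cls A) dvd 2" "\<not> PSL13.ord (cls A) dvd 3"
      using t not_dvd by (metis prod.collapse)+
    moreover have "PSL13.ord (cls A) \<in> {..6}" using dvd by (simp add: dvd_imp_le)
    moreover have "\<forall>d\<in>{..6::nat}. d dvd 6 \<longrightarrow> \<not> d dvd 2 \<longrightarrow> \<not> d dvd 3 \<longrightarrow> d = 6"
      by (simp add: atMost_nat_numeral atMost_Suc)
    ultimately show ?thesis using dvd by blast
  qed
qed

lemma trace_cases:
  "tr2 A = 0 \<or> tr2 A \<in> {1, -1} \<or> tr2 A \<in> {4, -4} \<or> tr2 A \<in> {3, -3, 5, -5, 6, -6} \<or> tr2 A \<in> {2, -2 :: 13}"
proof -
  have "tr2 A \<in> (UNIV :: 13 set)" by simp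
  then show ?thesis unfolding UNIV_13 insert_iff empty_iff by blast
qed

text \<open>\<open>c\<close> stands for the matrix being central, which separates the orders 1 and
  13 at the traces 2 and -2.\<close>

lemma order_by_trace:
  fixes t :: 13 and r :: nat
  assumes "t = 0 \<and> r = 2 \<or> t \<in> {1, -1} \<and> r = 3 \<or> t \<in> {4, -4} \<and> r = 6 \<or>
     t \<in> {3, -3, 5, -5, 6, -6} \<and> r = 7 \<or> t \<in> {2, -2} \<and> \<not> c \<and> r = 13 \<or> t \<in> {2, -2} \<and> c \<and> r = 1"
  shows "2 dvd r \<longleftrightarrow> t \<in> {0, 4, -4}" "3 dvd r \<longleftrightarrow> t \<in> {1, -1, 4, -4}"
    "7 dvd r \<longleftrightarrow> t \<in> {3, -3, 5, -5, 6, -6}" "13 dvd r \<longleftrightarrow> t \<in> {2, -2} \<and> \<not> c" "\<not> 4 dvd r"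
  using assms by (elim disjE conjE insertE emptyE; simp)+

text \<open>Before halving: 3 * 182 matrices for 2, 4 * 182 for 3, 6 * 156 for 7, and 2 * 169 less
  the two central ones for 13.\<close>

lemma PSL13_counts:
  "card {X \<in> carrier PSL_2_13. 2 dvd PSL13.ord X} = 273"
  "card {X \<in> carrier PSL_2_13. 3 dvd PSL13.ord X} = 364"
  "card {X \<in> carrier PSL_2_13. 7 dvd PSL13.ord X} = 468"
  "card {X \<in> carrier PSL_2_13. 13 dvd PSL13.ord X} = 168"
  "order PSL_2_13 = 1092"
  "\<And>X. X \<in> carrier PSL_2_13 \<Longrightarrow> \<not> 4 dvd PSL13.ord X"
proof -
  have cs: "tr2 A = 0 \<and> PSL13.ord (cls A) = 2 \<or> tr2 A \<in> {1, -1} \<and> PSL13.ord (cls A) = 3 \<or>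
     tr2 A \<in> {4, -4} \<and> PSL13.ord (cls A) = 6 \<or> tr2 A \<in> {3, -3, 5, -5, 6, -6} \<and> PSL13.ord (cls A) = 7 \<or>
     tr2 A \<in> {2, -2} \<and> \<not> A \<in> {mat 1, - mat 1} \<and> PSL13.ord (cls A) = 13 \<or>
     tr2 A \<in> {2, -2} \<and> A \<in> {mat 1, - mat 1} \<and> PSL13.ord (cls A) = 1" if "A \<in> carrier SL13" for A
    using trace_cases[of A] ord_cls[OF that] by blast
  have "2 dvd PSL13.ord (cls A) \<longleftrightarrow> tr2 A \<in> {0, 4, -4}" if "A \<in> carrier SL13" for A
    by (rule order_by_trace(1)[OF cs[OF that]])
  then have "{A \<in> carrier SL13. 2 dvd PSL13.ord (cls A)} = {A \<in> carrier SL13. tr2 A \<in> {0, 4, -4}}" by blast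
  then have "card {A \<in> carrier SL13. 2 dvd PSL13.ord (cls A)} = 546"
    by (simp only: card_trace_in) (simp add: card_T13_values)
  then show "card {X \<in> carrier PSL_2_13. 2 dvd PSL13.ord X} = 273"
    using card_PSL13_Collect[of "\<lambda>X. 2 dvd PSL13.ord X"] by simp
  have "3 dvd PSL13.ord (cls A) \<longleftrightarrow> tr2 A \<in> {1, -1, 4, -4}" if "A \<in> carrier SL13" for A
    by (rule order_by_trace(2)[OF cs[OF that]])
  then have "{A \<in> carrier SL13. 3 dvd PSL13.ord (cls A)} = {A \<in> carrier SL13. tr2 A \<in> {1, -1, 4, -4}}" by blast
  then have "card {A \<in> carrier SL13. 3 dvd PSL13.ord (cls A)} = 728"
    by (simp only: card_trace_in) (simp add: card_T13_values)
  then show "card {X \<in> carrier PSL_2_13. 3 dvd PSL13.ord X} = 364"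
    using card_PSL13_Collect[of "\<lambda>X. 3 dvd PSL13.ord X"] by simp
  have "7 dvd PSL13.ord (cls A) \<longleftrightarrow> tr2 A \<in> {3, -3, 5, -5, 6, -6}" if "A \<in> carrier SL13" for A
    by (rule order_by_trace(3)[OF cs[OF that]])
  then have "{A \<in> carrier SL13. 7 dvd PSL13.ord (cls A)} = {A \<in> carrier SL13. tr2 A \<in> {3, -3, 5, -5, 6, -6}}" by blast
  then have "card {A \<in> carrier SL13. 7 dvd PSL13.ord (cls A)} = 936"
    by (simp only: card_trace_in) (simp add: card_T13_values)
  then show "card {X \<in> carrier PSL_2_13. 7 dvd PSL13.ord X} = 468"
    using card_PSL13_Collect[of "\<lambda>X. 7 dvd PSL13.ord X"] by simp
  have "13 dvd PSL13.ord (cls A) \<longleftrightarrow> tr2 A \<in> {2, -2} \<and> A \<notin> {mat 1, - mat 1}" if "A \<in> carrier SL13" for A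
    using order_by_trace(4)[OF cs[OF that]] by simp
  then have "{A \<in> carrier SL13. 13 dvd PSL13.ord (cls A)} = {A \<in> carrier SL13. tr2 A \<in> {2, -2}} - {mat 1, - mat 1}" by blast
  moreover have "{mat 1, - mat 1} \<subseteq> {A \<in> carrier SL13. tr2 A \<in> {2, -2}}"
    using tr2_center center13.subset center_SL13 by blast
  moreover have "card {A \<in> carrier SL13. tr2 A \<in> {2, -2}} = 338"
    by (simp only: card_trace_in) (simp add: card_T13_values)
  moreover have "mat 1 \<noteq> - (mat 1 :: 13^2^2)" by (simp add: mat2_eq_iff mat_1_nth)
  ultimately have "card {A \<in> carrier SL13. 13 dvd PSL13.ord (cls A)} = 336"
    by (simp add: card_Diff_subset)
  then show "card {X \<in> carrier PSL_2_13. 13 dvd PSL13.ord X} = 168"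
    using card_PSL13_Collect[of "\<lambda>X. 13 dvd PSL13.ord X"] by simp
  have "card (carrier SL13) = (\<Sum>t\<in>UNIV. card (T13 t))"
    using card_trace_in[of UNIV] by simp
  then have "card (carrier SL13) = 2184" unfolding UNIV_13 by (simp add: card_T13_values)
  then show "order PSL_2_13 = 1092"
    using card_PSL13_Collect[of "\<lambda>_. True"] by (simp add: order_def)
  fix X assume "X \<in> carrier PSL_2_13"
  then obtain A where A: "A \<in> carrier SL13" "X = cls A" using carrier_PSL13 by blast
  show "\<not> 4 dvd PSL13.ord X" unfolding A(2) by (rule order_by_trace(5)[OF cs[OF A(1)]])
qed

lemma Exp_rho_PSL_2_13: "Exp_rho PSL_2_13 = {168, 273, 364, 468}"
  using PSL13.Exp_rho_eqI[OF finite_carrier_PSL13 _ PSL13_counts(6) PSL13_counts(1-4)] PSL13_counts(5) by simp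

section \<open>The characterization\<close>

text \<open>Fourteen subgroups of order 13 do not fit into order 546, since 168 + 468 = 636 elements
  would have order 13 or divisible by 7. The orders are part of the conclusion so that PSL(2,13), an
  instance of order 1092, falls into the second alternative.\<close>

lemma (in group) classification:
  assumes fin: "finite (carrier G)" and E: "Exp_rho G = {168, 273, 364, 468}"
  shows "order G = 546 \<and> G \<cong> integer_mod_group 14 \<times>\<times> Z13_Z3 \<or> order G = 1092 \<and> G \<cong> proj_perm_monoid"
proof -
  note counts = order_cases[OF fin E]
  have "card (ord_set 13) = 12 \<or> card (ord_set 13) = 168"
    using card_ord_set_13[OF fin counts(1,5)] by simp
  moreover have "order G = 546 \<or> order G = 1092" using counts(1) by simp
  ultimately consider "order G = 546" "card (ord_set 13) = 12" | "order G = 546" "card (ord_set 13) = 168"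
    | "order G = 1092" "card (ord_set 13) = 12" | "order G = 1092" "card (ord_set 13) = 168"
    by blast
  then show ?thesis
  proof cases
    case 1
    have "G \<cong> integer_mod_group 14 \<times>\<times> Z13_Z3"
      by (rule order_546_structure[OF fin 1(1) counts(4,5) 1(2)]) (rule iso_Z14_Z13_Z3[OF fin 1(1)])
    then show ?thesis using 1 by simp
  next
    case 2
    have "card (ord_set 13 \<union> {g \<in> carrier G. 7 dvd ord g}) = 168 + 468"
      using fin 2(2) counts(4) by (subst card_Un_disjoint) (auto simp: ord_set_def)
    moreover have "ord_set 13 \<union> {g \<in> carrier G. 7 dvd ord g} \<subseteq> carrier G" by (auto simp: ord_set_def)
    then have "card (ord_set 13 \<union> {g \<in> carrier G. 7 dvd ord g}) \<le> order G"
      unfolding order_def by (rule card_mono[OF fin])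
    ultimately show ?thesis using 2(1) by simp
  next
    case 3
    have "ord_set 13 \<noteq> {}" using 3(2) by auto
    then obtain x where x: "x \<in> ord_set 13" by blast
    have "order G = 13 * 84" "\<not> 13 dvd (84::nat)" using 3(1) by simp_all
    from card_centralizer_unique_cyc(1)[OF fin prime13 this x] have "card (Cen (carrier G) x) = 182"
      using 3(2) counts(5) by simp
    then show ?thesis using not_order_1092_unique_cyc[OF fin 3(1) counts(2) x 3(2)] by blast
  next
    case 4
    interpret sylow13_action G
      using order_1092_cycs_13[OF fin 4(1) counts(5) 4(2)] fin 4(1) by unfold_locales
    show ?thesis using iso_proj_perm_monoid 4(1) by simp
  qed
qed

lemma Exp_rho_iso:
  assumes "group G" "group H" "G \<cong> H" shows "Exp_rho G = Exp_rho H"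
proof -
  obtain h where h: "h \<in> iso G H" using assms(3) by (auto simp: is_iso_def)
  interpret G: group G by fact
  interpret H: group H by fact
  interpret group_hom G H h
    using h by unfold_locales (simp add: iso_def)
  have bij: "bij_betw h (carrier G) (carrier H)" using h by (simp add: iso_def)
  have "H.ord (h g) = G.ord g" if g: "g \<in> carrier G" for g
  proof -
    have "h g [^]\<^bsub>H\<^esub> n = \<one>\<^bsub>H\<^esub> \<longleftrightarrow> g [^]\<^bsub>G\<^esub> n = \<one>\<^bsub>G\<^esub>" for n :: nat
    proof -
      have "h g [^]\<^bsub>H\<^esub> n = h (g [^]\<^bsub>G\<^esub> n)" using g by (simp add: hom_nat_pow)
      moreover have "h (g [^]\<^bsub>G\<^esub> n) = h \<one>\<^bsub>G\<^esub> \<longleftrightarrow> g [^]\<^bsub>G\<^esub> n = \<one>\<^bsub>G\<^esub>"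
        using bij g by (intro inj_on_eq_iff[of h "carrier G"]) (auto simp: bij_betw_def)
      ultimately show ?thesis by simp
    qed
    then show ?thesis using H.ord_unique[of "h g" "G.ord g"] G.pow_eq_id g by simp
  qed
  then have "rho G = rho H"
    unfolding rho_def prod.reindex_bij_betw[OF bij, symmetric] by simp
  then show ?thesis by (simp add: Exp_rho_def)
qed

theorem theorem2p11:
  fixes G :: "('a, 'b) monoid_scheme"
  assumes "group G" and "finite (carrier G)"
  shows "G \<cong> PSL_2_13 \<or> G \<cong> integer_mod_group 14 \<times>\<times> Z13_Z3
     \<longleftrightarrow> Exp_rho G = Exp_rho PSL_2_13"
proof
  assume "G \<cong> PSL_2_13 \<or> G \<cong> integer_mod_group 14 \<times>\<times> Z13_Z3"
  moreover have "group (integer_mod_group 14 \<times>\<times> Z13_Z3)"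
    by (intro DirProd_group group_Z13_Z3) simp
  ultimately show "Exp_rho G = Exp_rho PSL_2_13"
    using Exp_rho_iso[OF assms(1)] group_PSL_2 Exp_rho_Z14_Z13_Z3 Exp_rho_PSL_2_13 by metis
next
  assume "Exp_rho G = Exp_rho PSL_2_13"
  then have E: "Exp_rho G = {168, 273, 364, 468}" by (simp add: Exp_rho_PSL_2_13)
  have "PSL_2_13 \<cong> proj_perm_monoid"
    using PSL13.classification[OF finite_carrier_PSL13 Exp_rho_PSL_2_13] PSL13_counts(5) by simp
  then have "proj_perm_monoid \<cong> PSL_2_13" by (rule PSL13.iso_sym)
  then show "G \<cong> PSL_2_13 \<or> G \<cong> integer_mod_group 14 \<times>\<times> Z13_Z3"
    using group.classification[OF assms E] iso_trans by blast
qed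

end
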